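(* Let $S$ be a Polish space with Borel $\sigma$-field $\mathcal{B}$, let $\lambda$ be a $\sigma$-finite measure on $\mathcal{B}$, and let $X=(X_1,X_2,\ldots)$ be a conditionally identically distributed (c.i.d.) sequence of $S$-valued random variables on a probability space $(\Omega,\mathcal{A},P)$. Let $\alpha_n$ ($n\ge 0$) be the predictive measures of $X$ and let $\alpha$ be the random probability measure on $S$ with $\alpha_n\to\alpha$ weakly a.s. Suppose that $P\{\omega:\alpha_c(\omega)\ll\lambda\}=1$, where $\alpha_c(\omega)$ is the continuous part of $\alpha(\omega)$. Then $\Vert\alpha_n-\alpha\Vert\to 0$ a.s. if and only if the following condition $( * )$ holds: $( * )$ there is a set $A_0\in\mathcal{A}$ such that $P(A_0)=1$ and $\alpha_n(\omega)\{x\}\to\alpha(\omega)\{x\}$ as $n\to\infty$ for all $x\in S$ and all $\omega\in A_0$. Moreover, condition $( * )$ is automatically true if $X$ is exchangeable, so that $\Vert\alpha_n-\alpha\Vert\to 0$ a.s. provided $X$ is exchangeable and $\alpha_c(\omega)\ll\lambda$ for $P$-almost all $\omega$.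
   Context: Let $\mathbb{S}$ be the set of probability measures on $\mathcal{B}$. A random probability measure on $S$ is a map $\alpha:\Omega\to\mathbb{S}$ such that $\omega\mapsto\alpha(\omega)(B)$ is $\mathcal{A}$-measurable for every $B\in\mathcal{B}$; $\sigma(\alpha)$ is the $\sigma$-field on $\Omega$ generated by these maps. The sequence $X$ is conditionally identically distributed (c.i.d.) if $(X_1,\ldots,X_n,X_{n+2})$ and $(X_1,\ldots,X_n,X_{n+1})$ have the same distribution for every $n\geq 0$ (for $n=0$: $X_2\sim X_1$). Every exchangeable sequence is c.i.d. Let $\mathcal{G}_0=\{\varnothing,\Omega\}$, $\mathcal{G}_n=\sigma(X_1,\ldots,X_n)$ for $n\ge1$, $\mathcal{G}_\infty=\sigma(\bigcup_n\mathcal{G}_n)$. For $n\geq1$ the $n$th predictive measure $\alpha_n$ is a random probability measure on $S$ such that, for every $B\in\mathcal{B}$, $\alpha_n(\cdot)(B)$ is a version of $P(X_{n+1}\in B\mid X_1,\ldots,X_n)$; also $\alpha_0(\cdot)=P(X_1\in\cdot)$. Known fact (background): if $X$ is c.i.d., there is a random probability measure $\alpha$ on $S$ such that $\sigma(\alpha)\subset\mathcal{G}_\infty$ and, for every $B\in\mathcal{B}$ and $n\ge 0$, $\alpha_n(B)=E\{\alpha(B)\mid\mathcal{G}_n\}$ a.s.; in particular $\alpha_n(\omega)\to\alpha(\omega)$ weakly for almost all $\omega$, so $\alpha$ is determined up to a $P$-null set. This is the $\alpha$ in the claim (with $\sigma(\alpha)\subset\mathcal{G}_\infty$). For $\nu\in\mathbb{S}$,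 the discrete part $\nu_d$ and continuous part $\nu_c$ are defined by $\nu_d(B)=\sum_{x\in B}\nu\{x\}$ for $B\in\mathcal{B}$, and $\nu_c=\nu-\nu_d$; $\alpha_c(\omega)=(\alpha(\omega))_c$. $\Vert\cdot\Vert$ is total variation norm on $(S,\mathcal{B})$: $\Vert\mu-\nu\Vert=\sup_{B\in\mathcal{B}}|\mu(B)-\nu(B)|$ for $\mu,\nu\in\mathbb{S}$. *)

theory Defs
  imports "HOL-Probability.Probability"
begin

text \<open>
  Sequences are indexed from 0: \<open>X n\<close> stands for $X_{n+1}$, so that the first \<open>n\<close> observations
  are \<open>X 0, \<dots>, X (n - 1)\<close>, while \<open>\<alpha> n\<close> stands for $\alpha_n$ (the prediction of \<open>X n\<close> given
  the first \<open>n\<close> observations).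

  A random probability measure on \<open>S\<close> is an element of \<open>M \<rightarrow>\<^sub>M prob_algebra borel\<close>; the
  \<open>\<sigma>\<close>-algebra of \<^const>\<open>prob_algebra\<close> is the one generated by the evaluation maps
  \<open>\<nu> \<mapsto> \<nu> B\<close> for Borel sets \<open>B\<close>.
\<close>

subsection \<open>Conditionally identically distributed and exchangeable sequences\<close>

definition cid :: "'w measure \<Rightarrow> (nat \<Rightarrow> 'w \<Rightarrow> 'a::topological_space) \<Rightarrow> bool" where
  "cid M X \<longleftrightarrow> (\<forall>n.
     distr M (PiM {..n} (\<lambda>_. borel)) (\<lambda>\<omega>. \<lambda>i\<in>{..n}. if i < n then X i \<omega> else X (Suc n) \<omega>)
   = distr M (PiM {..n} (\<lambda>_. borel)) (\<lambda>\<omega>. \<lambda>i\<in>{..n}. X i \<omega>))"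

definition exchangeable :: "'w measure \<Rightarrow> (nat \<Rightarrow> 'w \<Rightarrow> 'a::topological_space) \<Rightarrow> bool" where
  "exchangeable M X \<longleftrightarrow> (\<forall>n \<pi>. \<pi> permutes {..<n} \<longrightarrow>
     distr M (PiM {..<n} (\<lambda>_. borel)) (\<lambda>\<omega>. \<lambda>i\<in>{..<n}. X (\<pi> i) \<omega>)
   = distr M (PiM {..<n} (\<lambda>_. borel)) (\<lambda>\<omega>. \<lambda>i\<in>{..<n}. X i \<omega>))"

lemma exchangeable_imp_cid:
  fixes X :: "nat \<Rightarrow> 'w \<Rightarrow> 'a::topological_space"
  assumes X[measurable]: "\<And>n. X n \<in> borel_measurable M" and ex: "exchangeable M X"
  shows "cid M X"
  unfolding cid_def
proof
  fix n :: nat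
  let ?N = "{..<Suc (Suc n)}"
  let ?p = "\<lambda>f. \<lambda>i\<in>{..n}. f i :: 'a"
  let ?\<pi> = "Transposition.transpose n (Suc n)"
  have p: "?p \<in> PiM ?N (\<lambda>_. borel) \<rightarrow>\<^sub>M PiM {..n} (\<lambda>_. borel)"
    by (rule measurable_restrict) (auto intro!: measurable_component_singleton)
  have m: "(\<lambda>\<omega>. \<lambda>i\<in>?N. X (\<pi> i) \<omega>) \<in> M \<rightarrow>\<^sub>M PiM ?N (\<lambda>_. borel)" for \<pi>
    by (rule measurable_restrict) simp
  have "?\<pi> permutes ?N"
    by (rule permutes_swap_id) auto
  then have "distr M (PiM ?N (\<lambda>_. borel)) (\<lambda>\<omega>. \<lambda>i\<in>?N. X (?\<pi> i) \<omega>)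
           = distr M (PiM ?N (\<lambda>_. borel)) (\<lambda>\<omega>. \<lambda>i\<in>?N. X (id i) \<omega>)"
    using ex unfolding exchangeable_def by simp
  then have "distr (distr M (PiM ?N (\<lambda>_. borel)) (\<lambda>\<omega>. \<lambda>i\<in>?N. X (?\<pi> i) \<omega>)) (PiM {..n} (\<lambda>_. borel)) ?p
           = distr (distr M (PiM ?N (\<lambda>_. borel)) (\<lambda>\<omega>. \<lambda>i\<in>?N. X (id i) \<omega>)) (PiM {..n} (\<lambda>_. borel)) ?p"
    by simp
  then have "distr M (PiM {..n} (\<lambda>_. borel)) (?p \<circ> (\<lambda>\<omega>. \<lambda>i\<in>?N. X (?\<pi> i) \<omega>))
           = distr M (PiM {..n} (\<lambda>_. borel)) (?p \<circ> (\<lambda>\<omega>. \<lambda>i\<in>?N. X (id i) \<omega>))"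
    by (simp only: distr_distr[OF p m])
  moreover have "?p \<circ> (\<lambda>\<omega>. \<lambda>i\<in>?N. X (?\<pi> i) \<omega>)
      = (\<lambda>\<omega>. \<lambda>i\<in>{..n}. if i < n then X i \<omega> else X (Suc n) \<omega>)"
    by (auto simp: fun_eq_iff restrict_def Transposition.transpose_def)
  moreover have "?p \<circ> (\<lambda>\<omega>. \<lambda>i\<in>?N. X (id i) \<omega>) = (\<lambda>\<omega>. \<lambda>i\<in>{..n}. X i \<omega>)"
    by (auto simp: fun_eq_iff restrict_def)
  ultimately show "distr M (PiM {..n} (\<lambda>_. borel)) (\<lambda>\<omega>. \<lambda>i\<in>{..n}. if i < n then X i \<omega> else X (Suc n) \<omega>)
      = distr M (PiM {..n} (\<lambda>_. borel)) (\<lambda>\<omega>. \<lambda>i\<in>{..n}. X i \<omega>)"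
    by simp
qed

subsection \<open>The natural filtration and the predictive measures\<close>

definition nat_filt :: "'w measure \<Rightarrow> (nat \<Rightarrow> 'w \<Rightarrow> 'a::topological_space) \<Rightarrow> nat \<Rightarrow> 'w measure" where
  "nat_filt M X n = sigma (space M) {X i -` B \<inter> space M | i B. i < n \<and> B \<in> sets borel}"

definition nat_filt_inf :: "'w measure \<Rightarrow> (nat \<Rightarrow> 'w \<Rightarrow> 'a::topological_space) \<Rightarrow> 'w measure" where
  "nat_filt_inf M X = sigma (space M) (\<Union>n. sets (nat_filt M X n))"

lemma sets_nat_filt_0: "sets (nat_filt M X 0) = {{}, space M}"
  by (simp add: nat_filt_def sigma_sets_empty_eq)

text \<open>A version of the conditional probability \<open>P(A | F)\<close>: \<^const>\<open>real_cond_exp\<close> is only one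
  particular version, and versions are required to be \<open>F\<close>-measurable.\<close>

definition is_cond_prob :: "'w measure \<Rightarrow> 'w measure \<Rightarrow> 'w set \<Rightarrow> ('w \<Rightarrow> real) \<Rightarrow> bool" where
  "is_cond_prob M F A g \<longleftrightarrow>
     g \<in> borel_measurable F \<and> (AE \<omega> in M. g \<omega> = real_cond_exp M F (indicator A) \<omega>)"

definition predictive_measures ::
    "'w measure \<Rightarrow> (nat \<Rightarrow> 'w \<Rightarrow> 'a::topological_space) \<Rightarrow> (nat \<Rightarrow> 'w \<Rightarrow> 'a measure) \<Rightarrow> bool" where
  "predictive_measures M X \<alpha> \<longleftrightarrow>
     (\<forall>\<omega>\<in>space M. \<alpha> 0 \<omega> = distr M borel (X 0)) \<and>
     (\<forall>n\<ge>1. \<alpha> n \<in> M \<rightarrow>\<^sub>M prob_algebra borel \<and>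
       (\<forall>B\<in>sets borel.
          is_cond_prob M (nat_filt M X n) (X n -` B \<inter> space M) (\<lambda>\<omega>. measure (\<alpha> n \<omega>) B)))"

subsection \<open>Convergence of measures\<close>

definition weakly_converges :: "(nat \<Rightarrow> 'a::topological_space measure) \<Rightarrow> 'a measure \<Rightarrow> bool" where
  "weakly_converges \<mu> \<nu> \<longleftrightarrow>
     (\<forall>f :: 'a \<Rightarrow> real. continuous_on UNIV f \<and> bounded (range f) \<longrightarrow>
        (\<lambda>n. \<integral>x. f x \<partial>\<mu> n) \<longlonglongrightarrow> (\<integral>x. f x \<partial>\<nu>))"

definition tv_dist :: "'a::topological_space measure \<Rightarrow> 'a measure \<Rightarrow> real" where
  "tv_dist \<mu> \<nu> = (SUP B\<in>sets borel. \<bar>measure \<mu> B - measure \<nu> B\<bar>)"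

definition atoms_converge ::
    "'w measure \<Rightarrow> (nat \<Rightarrow> 'w \<Rightarrow> 'a measure) \<Rightarrow> ('w \<Rightarrow> 'a measure) \<Rightarrow> bool" where
  "atoms_converge M \<alpha> \<alpha>' \<longleftrightarrow>
     (\<exists>A0\<in>sets M. measure M A0 = 1 \<and>
        (\<forall>x. \<forall>\<omega>\<in>A0. (\<lambda>n. measure (\<alpha> n \<omega>) {x}) \<longlonglongrightarrow> measure (\<alpha>' \<omega>) {x}))"

subsection \<open>Discrete and continuous parts\<close>

text \<open>The integral over \<^const>\<open>count_space\<close> is the unordered sum $\sum_{x \in B} \nu\{x\}$.\<close>

definition discrete_part :: "'a measure \<Rightarrow> 'a measure" where
  "discrete_part \<nu> = measure_of (space \<nu>) (sets \<nu>) (\<lambda>B. \<integral>\<^sup>+x. emeasure \<nu> {x} \<partial>count_space B)"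

definition continuous_part :: "'a measure \<Rightarrow> 'a measure" where
  "continuous_part \<nu> = diff_measure \<nu> (discrete_part \<nu>)"

lemma sets_discrete_part [simp]: "sets (discrete_part \<nu>) = sets \<nu>"
  and space_discrete_part [simp]: "space (discrete_part \<nu>) = space \<nu>"
  by (simp_all add: discrete_part_def)

lemma sets_continuous_part [simp]: "sets (continuous_part \<nu>) = sets \<nu>"
  and space_continuous_part [simp]: "space (continuous_part \<nu>) = space \<nu>"
  by (simp_all add: continuous_part_def)

lemma emeasure_discrete_part:
  assumes "B \<in> sets \<nu>"
  shows "emeasure (discrete_part \<nu>) B = (\<integral>\<^sup>+x. emeasure \<nu> {x} \<partial>count_space B)"
  unfolding discrete_part_def
proof (rule emeasure_measure_of_sigma)
  let ?D = "density (count_space UNIV) (\<lambda>x. emeasure \<nu> {x})"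
  have D: "(\<integral>\<^sup>+x. emeasure \<nu> {x} \<partial>count_space B) = emeasure ?D B" for B
    by (simp add: emeasure_density nn_integral_count_space_indicator)
  show "sigma_algebra (space \<nu>) (sets \<nu>)" ..
  show "positive (sets \<nu>) (\<lambda>B. \<integral>\<^sup>+x. emeasure \<nu> {x} \<partial>count_space B)"
    by (simp add: positive_def D)
  show "countably_additive (sets \<nu>) (\<lambda>B. \<integral>\<^sup>+x. emeasure \<nu> {x} \<partial>count_space B)"
    unfolding D by (auto intro!: countably_additiveI suminf_emeasure)
qed fact

lemma emeasure_continuous_part:
  fixes \<nu> :: "'a::t1_space measure"
  assumes "prob_space \<nu>" and [measurable_cong]: "sets \<nu> = sets borel" and B: "B \<in> sets borel"
  shows "emeasure (continuous_part \<nu>) B = emeasure \<nu> B - emeasure (discrete_part \<nu>) B"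
proof -
  interpret prob_space \<nu> by fact
  have sp: "space \<nu> = UNIV"
    using sets_eq_imp_space_eq[OF assms(2)] by simp
  have le: "emeasure (discrete_part \<nu>) A \<le> emeasure \<nu> A" if "A \<in> sets \<nu>" for A
  proof -
    let ?C = "A \<inter> {x. measure \<nu> {x} \<noteq> 0}"
    have C: "countable ?C"
      using countable_support by (rule countable_subset[rotated]) auto
    have "(\<integral>\<^sup>+x. emeasure \<nu> {x} \<partial>count_space A) = (\<integral>\<^sup>+x. emeasure \<nu> {x} \<partial>count_space ?C)"
      by (rule nn_integral_count_space_eq) (auto simp: emeasure_eq_measure)
    also have "\<dots> = emeasure \<nu> ?C"
      using C by (intro emeasure_countable_singleton[symmetric]) (simp_all add: assms(2))
    also have "\<dots> \<le> emeasure \<nu> A"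
      using that by (intro emeasure_mono) auto
    finally show ?thesis
      using that by (simp add: emeasure_discrete_part)
  qed
  have "finite_measure (discrete_part \<nu>)"
    using le[of "space \<nu>"] emeasure_space_1
    by (intro finite_measureI) (auto simp: top_unique)
  then show ?thesis
    unfolding continuous_part_def using le B
    by (intro emeasure_diff_measure) (simp_all add: assms(2) finite_measure_axioms)
qed

end

theory Submission
  imports Defs
begin

text \<open>
  Weak convergence and the c.i.d. property identify \<open>\<alpha> n\<close> with the conditional expectation of
  \<open>\<alpha>'\<close> given the first \<open>n\<close> observations, also on random Borel sets depending on these observations.

  Let \<open>f\<close> be the density of the non-atomic part of \<open>\<alpha>'\<close> with respect to \<open>L\<close>, chosen jointly
  measurable; it is approximated in \<open>L\<^sup>1\<close> by a function \<open>g\<close> depending on finitely many observations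
  only. With \<open>W \<omega> = \<integral> \<bar>f (\<omega>, x) - g (\<omega>, x)\<bar> L(dx)\<close>, eventually \<open>\<alpha> n\<close> exceeds \<open>g L\<close>
  up to \<open>E(W | F n)\<close> simultaneously on all Borel sets, so that \<open>\<alpha> n\<close> exceeds the non-atomic part
  of \<open>\<alpha>'\<close> up to \<open>W + E(W | F n)\<close>. On the countable set of atoms, pointwise convergence gives a
  lower bound directly, and for probability measures one-sided bounds suffice. Doob's maximal
  inequality makes \<open>W + E(W | F n)\<close> uniformly small in \<open>n\<close>.

  In the exchangeable case the probability that \<open>X n\<close> is a new value is at most
  \<open>E \<integral> (1 - \<alpha>' {x})^n \<alpha>'(dx)\<close>, which tends to the expected mass of the non-atomic part of
  \<open>\<alpha>'\<close>; hence almost surely every atom of \<open>\<alpha>'\<close> is some \<open>X i\<close>. Eventually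
  \<open>\<alpha> n {X i} = E(\<alpha>' {X i} | F n)\<close>, so Levy's upward theorem gives convergence at these atoms,
  and at all other points weak convergence suffices.
\<close>

section \<open>Approximation along a filtration and a maximal inequality\<close>

text \<open>The obstacle is that a conditional expectation comes with an exceptional null set for
  each fixed set and each \<open>n\<close>, while total variation asks for all Borel sets at once,
  among them sets such as \<open>B \<inter> non_atoms \<omega>\<close> that depend on
  \<open>\<omega>\<close>. Hence each comparison is brought to the form
  \<open>measure \<rho> U \<le> measure \<sigma> U + c\<close>: once such an inequality holds on a
  countable family of open sets, it passes to all Borel sets with \<open>\<omega>\<close> fixed. The
  function \<open>W\<close> is small only in mean. The inequalities of Doob and Markov turn this
  into smallness off an event of small probability, simultaneously in \<open>n\<close>, and sending
  the mean to 0 gives an almost sure statement. That \<open>\<alpha>'\<close> is measurable with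
  respect to the \<sigma>-field of all observations is what makes \<open>f\<close> approximable by
  functions of finitely many of them. No density of \<open>\<alpha> n\<close> appears:
  \<open>g L\<close> only bounds \<open>\<alpha> n\<close> from below, so \<open>\<alpha> n\<close>
  may have a part singular to \<open>L\<close>. The uncountably many points in the convergence of
  atoms are treated in the same spirit: under exchangeability those with positive limit mass lie
  among the countably many values \<open>X i\<close>.\<close>

text \<open>The intersection of exceptional sets of measure below \<open>1 / Suc k\<close> is null,
  and off it at least one of the countably many implications applies. The set where \<open>P\<close>
  fails may be non-measurable.\<close>

lemma (in finite_measure) AE_if_small_exceptions:
  assumes "\<And>e::real. e > 0 \<Longrightarrow> \<exists>E\<in>sets M. measure M E < e \<and> (AE x in M. x \<notin> E \<longrightarrow> P x)"
  shows "AE x in M. P x"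
proof -
  have "\<exists>E\<in>sets M. measure M E < 1 / real (Suc k) \<and> (AE x in M. x \<notin> E \<longrightarrow> P x)" for k
    by (intro assms) simp
  then obtain E where E[measurable]: "\<And>k. E k \<in> sets M"
    and lt: "\<And>k. measure M (E k) < 1 / real (Suc k)"
    and AE: "\<And>k. AE x in M. x \<notin> E k \<longrightarrow> P x"
    by metis
  have "measure M (\<Inter>k. E k) \<le> 1 / real (Suc k)" for k
  proof -
    have "measure M (\<Inter>k. E k) \<le> measure M (E k)"
      by (rule finite_measure_mono) auto
    with lt[of k] show ?thesis by simp
  qed
  then have "measure M (\<Inter>k. E k) \<le> 0"
    by (intro LIMSEQ_le_const[OF lim_inverse_n']) (metis Suc_pred gr0I less_Suc_eq_le not_less_eq_eq)
  then have "(\<Inter>k. E k) \<in> null_sets M"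
    by (auto simp: null_sets_def emeasure_eq_measure measure_le_0_iff)
  then have "AE x in M. x \<notin> (\<Inter>k. E k)"
    by (rule AE_not_in)
  moreover have "AE x in M. \<forall>k. x \<notin> E k \<longrightarrow> P x"
    unfolding AE_all_countable using AE by blast
  ultimately show ?thesis
    by eventually_elim auto
qed

text \<open>Formulated for finite measures so that it covers \<open>M\<close>, its restriction to
  the \<sigma>-field of all observations, and the product of that restriction with a finite
  \<open>L\<close>.\<close>

locale filtered_finite_measure = finite_measure M for M :: "'b measure" +
  fixes F :: "nat \<Rightarrow> 'b measure"
  assumes subalgebra_F: "\<And>n. subalgebra M (F n)"
    and sets_F_mono: "\<And>m n. m \<le> n \<Longrightarrow> sets (F m) \<subseteq> sets (F n)"
begin

sublocale ce: finite_measure_subalgebra M "F n" for n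
  by unfold_locales (rule subalgebra_F)

lemma space_F: "space (F n) = space M"
  using subalgebra_F by (simp add: subalgebra_def)

lemma sets_F_in_sets: "A \<in> sets (F n) \<Longrightarrow> A \<in> sets M"
  using subalgebra_F by (auto simp: subalgebra_def)

lemma measurable_F_mono: "f \<in> measurable (F m) N \<Longrightarrow> m \<le> n \<Longrightarrow> f \<in> measurable (F n) N"
  using sets_F_mono[of m n] by (rule_tac measurable_from_subalg[of _ "F m"]) (simp_all add: subalgebra_def space_F)

lemma measurable_F_M: "f \<in> measurable (F m) N \<Longrightarrow> f \<in> measurable M N"
  by (rule measurable_from_subalg[OF subalgebra_F])

text \<open>The sets that can be approximated in measure by members of the filtration form a
  \<sigma>-algebra. For a countable union, cut off after \<open>k\<close> sets at a cost below
  \<open>e / 2\<close>, then approximate these \<open>k\<close> sets.\<close>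

lemma approx_set:
  assumes "A \<in> sigma_sets (space M) (\<Union>n. sets (F n))"
  shows "e > 0 \<Longrightarrow> \<exists>n. \<exists>B\<in>sets (F n). measure M (sym_diff A B) < e"
  using assms
proof (induction arbitrary: e rule: sigma_sets.induct)
  case (Basic A)
  then show ?case by (auto intro!: bexI[of _ A])
next
  case Empty
  then show ?case by (intro exI[of _ 0] bexI[of _ "{}"]) auto
next
  case (Compl A)
  then obtain n B where B: "B \<in> sets (F n)" "measure M (sym_diff A B) < e" by blast
  then have "sym_diff (space M - A) (space M - B) = sym_diff A B"
    using sigma_sets_into_sp[OF _ Compl(1)] sets.sets_into_space[of B "F n"]
      sets.sets_into_space[of _ "F _"]
    by (fastforce simp: space_F)
  with B show ?case
    by (metis sets.compl_sets space_F)
next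
  case (Union A)
  have sA[measurable]: "A i \<in> sets M" for i
  proof -
    have "(\<Union>n. sets (F n)) \<subseteq> sets M" using sets_F_in_sets by auto
    with Union(1) show ?thesis using sets.sigma_sets_subset[of "\<Union>n. sets (F n)" M] by (meson subsetD)
  qed
  have "(\<lambda>n. measure M (\<Union>i<n. A i)) \<longlonglongrightarrow> measure M (\<Union>n. \<Union>i<n. A i)"
    by (rule finite_Lim_measure_incseq) (force simp: incseq_def)+
  moreover have "(\<Union>n. \<Union>i<n. A i) = (\<Union>i. A i)" by auto
  ultimately have "(\<lambda>n. measure M (\<Union>i<n. A i)) \<longlonglongrightarrow> measure M (\<Union>i. A i)" by simp
  then obtain k where k: "\<bar>measure M (\<Union>i<k. A i) - measure M (\<Union>i. A i)\<bar> < e / 2"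
    using \<open>e > 0\<close> by (metis LIMSEQ_D half_gt_zero le_refl real_norm_def)
  have diff: "measure M ((\<Union>i. A i) - (\<Union>i<k. A i)) < e / 2"
  proof -
    have "measure M (\<Union>i. A i) - measure M (\<Union>i<k. A i) < e / 2" using k by linarith
    then show ?thesis by (subst finite_measure_Diff) auto
  qed
  \<comment> \<open>The errors of \<open>k\<close> sets add up to at most \<open>e / 2\<close>.
    Dividing by \<open>Suc k\<close> covers \<open>k = 0\<close>, and the strict inequality at the
    end comes from the cut-off error.\<close>
  have "\<exists>n. \<exists>B\<in>sets (F n). measure M (sym_diff (A i) B) < e / 2 / real (Suc k)" for i
    using \<open>e > 0\<close> by (intro Union(2)) simp
  then obtain n B where B: "\<And>i. B i \<in> sets (F (n i))"
    and Bs: "\<And>i. measure M (sym_diff (A i) (B i)) < e / 2 / real (Suc k)" by metis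
  \<comment> \<open>The sum serves only as a common upper bound for finitely many indices.\<close>
  define N where "N = (\<Sum>i<k. n i)"
  have "n i \<le> N" if "i < k" for i
    unfolding N_def using that by (intro member_le_sum) auto
  then have BN: "(\<Union>i<k. B i) \<in> sets (F N)"
    using B sets_F_mono by (intro sets.finite_UN) blast+
  have [measurable]: "B i \<in> sets M" for i
    using B sets_F_in_sets by blast
  have "measure M (sym_diff (\<Union>i. A i) (\<Union>i<k. B i))
      \<le> measure M (((\<Union>i. A i) - (\<Union>i<k. A i)) \<union> (\<Union>i<k. sym_diff (A i) (B i)))"
    by (intro finite_measure_mono) auto
  also have "\<dots> \<le> measure M ((\<Union>i. A i) - (\<Union>i<k. A i)) + measure M (\<Union>i<k. sym_diff (A i) (B i))"
    by (intro measure_Un_le) auto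
  also have "measure M (\<Union>i<k. sym_diff (A i) (B i)) \<le> (\<Sum>i<k. measure M (sym_diff (A i) (B i)))"
    by (intro measure_UNION_le) auto
  also have "\<dots> \<le> (\<Sum>i<k. e / 2 / real (Suc k))"
    by (intro sum_mono less_imp_le Bs)
  also have "\<dots> \<le> e / 2"
    using \<open>e > 0\<close> by (simp add: field_simps)
  finally have "measure M (sym_diff (\<Union>i. A i) (\<Union>i<k. B i)) < e"
    using diff by simp
  with BN show ?case by blast
qed

text \<open>Density of bounded functions of finitely many stages in L1. Boundedness of
  \<open>g\<close> is recorded because it makes \<open>g\<close> integrable for every finite measure
  on which it is measurable.\<close>

lemma approx_integrable:
  fixes f :: "'b \<Rightarrow> real"
  assumes gen: "sets M = sigma_sets (space M) (\<Union>n. sets (F n))"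
    and f: "integrable M f"
  shows "e > 0 \<Longrightarrow> \<exists>n. \<exists>g\<in>borel_measurable (F n). (\<exists>K. \<forall>x. \<bar>g x\<bar> \<le> K) \<and> (\<integral>x. \<bar>f x - g x\<bar> \<partial>M) < e"
  using f
proof (induction arbitrary: e rule: integrable_induct)
  case (base A c)
  \<comment> \<open>The summand 1 allows \<open>c = 0\<close>.\<close>
  then have "0 < e / (\<bar>c\<bar> + 1)" by simp
  with approx_set[of A] base(1) gen obtain n B
    where B: "B \<in> sets (F n)" "measure M (sym_diff A B) < e / (\<bar>c\<bar> + 1)" by metis
  have [measurable]: "B \<in> sets M" using B sets_F_in_sets by blast
  have "(\<integral>x. \<bar>indicator A x *\<^sub>R c - indicator B x * c\<bar> \<partial>M) = (\<integral>x. \<bar>c\<bar> * indicator (sym_diff A B) x \<partial>M)"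
    by (intro Bochner_Integration.integral_cong) (auto simp: indicator_def)
  also have "\<dots> = \<bar>c\<bar> * measure M (sym_diff A B)"
    using base by simp
  also have "\<dots> \<le> (\<bar>c\<bar> + 1) * measure M (sym_diff A B)"
    by (intro mult_right_mono) auto
  also have "\<dots> < e"
    using B(2) by (simp add: pos_less_divide_eq mult.commute)
  finally have *: "(\<integral>x. \<bar>indicator A x *\<^sub>R c - indicator B x * c\<bar> \<partial>M) < e" .
  have "(\<lambda>x. indicator B x * c) \<in> borel_measurable (F n)"
    using B(1) by measurable
  moreover have "\<forall>x. \<bar>indicator B x * c\<bar> \<le> \<bar>c\<bar>"
    by (auto simp: indicator_def)
  ultimately show ?case using *
    by (intro exI[of _ n] bexI[of _ "\<lambda>x. indicator B x * c"] conjI) (rule exI[of _ "\<bar>c\<bar>"])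
next
  case (add f1 f2)
  from \<open>e > 0\<close> have e2: "e / 2 > 0" by simp
  obtain n1 g1 K1 where g1: "g1 \<in> borel_measurable (F n1)" "\<And>x. \<bar>g1 x\<bar> \<le> K1"
    "(\<integral>x. \<bar>f1 x - g1 x\<bar> \<partial>M) < e / 2"
    using add(3)[OF e2] by blast
  obtain n2 g2 K2 where g2: "g2 \<in> borel_measurable (F n2)" "\<And>x. \<bar>g2 x\<bar> \<le> K2"
    "(\<integral>x. \<bar>f2 x - g2 x\<bar> \<partial>M) < e / 2"
    using add(4)[OF e2] by blast
  note g = g1(1) g2(1) g1(2) g2(2) g1(3) g2(3)
  define n where "n = max n1 n2"
  have gm: "g1 \<in> borel_measurable (F n)" "g2 \<in> borel_measurable (F n)"
    using g(1,2) by (auto simp: n_def intro: measurable_F_mono)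
  have [measurable]: "g1 \<in> borel_measurable M" "g2 \<in> borel_measurable M"
    using g(1,2) by (auto intro: measurable_F_M)
  have i: "integrable M g1" "integrable M g2"
    using g(3,4) by (auto intro: integrable_const_bound[where B=K1] integrable_const_bound[where B=K2])
  have "(\<integral>x. \<bar>f1 x + f2 x - (g1 x + g2 x)\<bar> \<partial>M) \<le> (\<integral>x. \<bar>f1 x - g1 x\<bar> + \<bar>f2 x - g2 x\<bar> \<partial>M)"
    using add(1,2) i by (intro integral_mono) auto
  also have "\<dots> < e"
    using add(1,2) i g(5,6) by simp
  finally have "(\<integral>x. \<bar>f1 x + f2 x - (g1 x + g2 x)\<bar> \<partial>M) < e" .
  moreover have "(\<lambda>x. g1 x + g2 x) \<in> borel_measurable (F n)" using gm by measurable
  moreover have "\<forall>x. \<bar>g1 x + g2 x\<bar> \<le> K1 + K2"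
  proof
    fix x show "\<bar>g1 x + g2 x\<bar> \<le> K1 + K2" using g(3,4)[of x] by linarith
  qed
  ultimately show ?case
    by (intro exI[of _ n] bexI[of _ "\<lambda>x. g1 x + g2 x"] conjI) (rule exI[of _ "K1 + K2"])
next
  case (lim f s)
  have "(\<lambda>i. \<integral>x. \<bar>f x - s i x\<bar> \<partial>M) \<longlonglongrightarrow> (\<integral>x. 0 \<partial>M)"
  proof (rule integral_dominated_convergence)
    \<comment> \<open>The simple functions supplied by the induction satisfy
      \<open>\<bar>s i x\<bar> \<le> 2 * \<bar>f x\<bar>\<close>, whence the factor 3.\<close>
    show "integrable M (\<lambda>x. 3 * \<bar>f x\<bar>)" using lim.hyps by simp
    show "AE x in M. (\<lambda>i. \<bar>f x - s i x\<bar>) \<longlonglongrightarrow> 0"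
    proof (rule AE_I2)
      fix x assume "x \<in> space M"
      then have "(\<lambda>i. \<bar>f x - s i x\<bar>) \<longlonglongrightarrow> \<bar>f x - f x\<bar>"
        by (intro tendsto_intros lim.hyps)
      then show "(\<lambda>i. \<bar>f x - s i x\<bar>) \<longlonglongrightarrow> 0" by simp
    qed
    show "AE x in M. norm \<bar>f x - s i x\<bar> \<le> 3 * \<bar>f x\<bar>" for i
      using lim.hyps(3)[of _ i] by (intro AE_I2) (fastforce simp: abs_if split: if_splits)
  qed (use lim.hyps in auto)
  then have "eventually (\<lambda>i. (\<integral>x. \<bar>f x - s i x\<bar> \<partial>M) < e / 2) sequentially"
    using \<open>e > 0\<close> by (intro order_tendstoD) auto
  then obtain i where i: "(\<integral>x. \<bar>f x - s i x\<bar> \<partial>M) < e / 2"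
    by (auto simp: eventually_sequentially)
  from \<open>e > 0\<close> have e2: "e / 2 > 0" by simp
  obtain n g K where g: "g \<in> borel_measurable (F n)"
    "\<And>x. \<bar>g x\<bar> \<le> K" "(\<integral>x. \<bar>s i x - g x\<bar> \<partial>M) < e / 2"
    using lim.IH[OF e2] by blast
  have [measurable]: "g \<in> borel_measurable M" using g(1) by (rule measurable_F_M)
  have gi: "integrable M g"
    using g(2) by (auto intro: integrable_const_bound[where B=K])
  have "(\<integral>x. \<bar>f x - g x\<bar> \<partial>M) \<le> (\<integral>x. \<bar>f x - s i x\<bar> + \<bar>s i x - g x\<bar> \<partial>M)"
    using lim.hyps(1,4) gi by (intro integral_mono) auto
  also have "\<dots> < e" using lim.hyps(1,4) gi i g(3) by simp
  finally show ?case using g by blast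
qed

text \<open>Doob's maximal inequality, by stopping at the first \<open>n\<close> with \<open>E(W|F n) > d\<close>.\<close>

lemma maximal_inequality:
  assumes W: "integrable M W" and nn: "\<And>x. 0 \<le> W x" and d: "d > 0"
  shows "d * measure M {x\<in>space M. \<exists>n. real_cond_exp M (F n) W x > d} \<le> (\<integral>x. W x \<partial>M)"
proof -
  let ?W = "\<lambda>n. real_cond_exp M (F n) W"
  define A where "A n = {x\<in>space M. ?W n x > d}" for n
  have A: "A n \<in> sets (F n)" for n
  proof -
    have "{x\<in>space (F n). ?W n x > d} \<in> sets (F n)" by measurable
    then show ?thesis by (simp add: A_def space_F)
  qed
  define D where "D = disjointed A"
  have D: "D n \<in> sets (F n)" for n
    unfolding D_def disjointed_def using A sets_F_mono[of _ n]
    by (intro sets.Diff sets.finite_UN) (auto, blast intro: less_imp_le)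
  then have [measurable]: "D n \<in> sets M" for n by (rule sets_F_in_sets)
  have step: "d * measure M (D n) \<le> (\<integral>x\<in>D n. W x \<partial>M)" for n
  proof -
    have "d * measure M (D n) = (\<integral>x\<in>D n. d \<partial>M)"
      by (simp add: set_lebesgue_integral_def)
    also have "\<dots> \<le> (\<integral>x\<in>D n. ?W n x \<partial>M)"
      unfolding set_lebesgue_integral_def
    proof (rule integral_mono)
      show "integrable M (\<lambda>x. indicator (D n) x *\<^sub>R ?W n x)"
        using ce.real_cond_exp_int(1)[OF W, of n] by (intro integrable_mult_indicator) auto
      show "indicator (D n) x *\<^sub>R d \<le> indicator (D n) x *\<^sub>R ?W n x" for x
        using disjointed_subset[of A n] by (auto simp: D_def A_def indicator_def)
    qed (auto intro!: integrable_scaleR_left integrable_real_indicator simp: emeasure_eq_measure)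
    also have "\<dots> = (\<integral>x\<in>D n. W x \<partial>M)"
      using ce.real_cond_exp_intA[OF W D] by simp
    finally show ?thesis .
  qed
  have fin: "d * measure M (\<Union>i<n. D i) \<le> (\<integral>x. W x \<partial>M)" for n
  proof -
    have dj: "disjoint_family_on D {..<n}"
      using disjoint_family_disjointed[of A] by (auto simp: D_def disjoint_family_on_def)
    have "d * measure M (\<Union>i<n. D i) = (\<Sum>i<n. d * measure M (D i))"
      using finite_measure_finite_Union[OF _ _ dj] by (simp add: sum_distrib_left image_subset_iff)
    also have "\<dots> \<le> (\<Sum>i<n. \<integral>x\<in>D i. W x \<partial>M)"
      by (intro sum_mono step)
    also have "\<dots> = (\<integral>x. (\<Sum>i<n. indicator (D i) x *\<^sub>R W x) \<partial>M)"
      unfolding set_lebesgue_integral_def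
      by (rule Bochner_Integration.integral_sum[symmetric]) (intro integrable_mult_indicator W, simp)
    also have "\<dots> \<le> (\<integral>x. W x \<partial>M)"
    proof (intro integral_mono W)
      show "integrable M (\<lambda>x. \<Sum>i<n. indicator (D i) x *\<^sub>R W x)"
        by (intro Bochner_Integration.integrable_sum integrable_mult_indicator W) simp
      have "(\<Sum>i<n. indicator (D i) x) = (indicator (\<Union>i<n. D i) x :: real)" for x
        using indicator_UN_disjoint[OF finite_lessThan dj] by metis
      then show "(\<Sum>i<n. indicator (D i) x *\<^sub>R W x) \<le> W x" for x
        using nn by (simp add: sum_distrib_right[symmetric] indicator_def)
    qed
    finally show ?thesis .
  qed
  have "(\<lambda>n. d * measure M (\<Union>i<n. D i)) \<longlonglongrightarrow> d * measure M (\<Union>n. \<Union>i<n. D i)"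
    by (intro tendsto_mult tendsto_const finite_Lim_measure_incseq) (force simp: incseq_def)+
  then have "d * measure M (\<Union>n. \<Union>i<n. D i) \<le> (\<integral>x. W x \<partial>M)"
    using fin by (intro LIMSEQ_le_const2) auto
  moreover have "(\<Union>n. \<Union>i<n. D i) = (\<Union>n. A n)"
    using UN_disjointed_eq[of A] by (auto simp: D_def)
  moreover have "(\<Union>n. A n) = {x\<in>space M. \<exists>n. ?W n x > d}"
    by (auto simp: A_def)
  ultimately show ?thesis by simp
qed

text \<open>\<open>Z\<close> is arbitrary because it will be a total variation distance, a supremum
  over uncountably many sets. Only \<open>W\<close> has to be measurable, and its mean can be made
  as small as desired.\<close>

lemma AE_eventually_small:
  fixes Z :: "nat \<Rightarrow> 'b \<Rightarrow> real"
  assumes "\<And>e::real. e > 0 \<Longrightarrow> \<exists>W. integrable M W \<and> (\<forall>x. 0 \<le> W x) \<and> (\<integral>x. W x \<partial>M) < e \<and>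
      (AE x in M. \<forall>d>0. eventually (\<lambda>n. Z n x \<le> W x + real_cond_exp M (F n) W x + d) sequentially)"
  shows "AE x in M. \<forall>d>0. eventually (\<lambda>n. Z n x \<le> d) sequentially"
proof -
  have "AE x in M. eventually (\<lambda>n. Z n x \<le> 3 * (1 / real (Suc k))) sequentially" for k
  proof (rule AE_if_small_exceptions)
    \<comment> \<open>The bound \<open>3 * d\<close> is spent as \<open>d\<close> on
      \<open>W\<close>, \<open>d\<close> on its conditional expectations and \<open>d\<close> on the
      slack. With the mean of \<open>W\<close> below \<open>e * d / 2\<close>, the maximal
      inequality and Markov's inequality each leave an exceptional event of probability below
      \<open>e / 2\<close>.\<close>
    define d where "d = 1 / real (Suc k)"
    fix e :: real assume "e > 0"
    have d: "d > 0" by (simp add: d_def)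
    with \<open>e > 0\<close> assms[of "e * d / 2"] obtain W where W: "integrable M W" "\<And>x. 0 \<le> W x"
      "(\<integral>x. W x \<partial>M) < e * d / 2"
      "AE x in M. \<forall>d>0. eventually (\<lambda>n. Z n x \<le> W x + real_cond_exp M (F n) W x + d) sequentially"
      by (auto)
    have [measurable]: "W \<in> borel_measurable M" using W by auto
    define E1 where "E1 = {x\<in>space M. \<exists>n. real_cond_exp M (F n) W x > d}"
    define E2 where "E2 = {x\<in>space M. W x \<ge> d}"
    have [measurable]: "E1 \<in> sets M" "E2 \<in> sets M" by (auto simp: E1_def E2_def)
    have "d * measure M E1 < e * d / 2"
      using maximal_inequality[OF W(1,2) d] W(3) by (simp add: E1_def)
    then have 1: "measure M E1 < e / 2" using d by (simp add: field_simps)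
    have "measure M E2 \<le> (\<integral>x. W x \<partial>M) / d"
      unfolding E2_def using W d by (intro integral_Markov_inequality_measure[where A="{}"]) auto
    also have "\<dots> < e / 2" using W(3) d by (simp add: field_simps)
    finally have "measure M (E1 \<union> E2) < e"
      using 1 measure_Un_le[of E1 M E2] by simp
    moreover have "AE x in M. x \<notin> E1 \<union> E2 \<longrightarrow> eventually (\<lambda>n. Z n x \<le> 3 * (1 / real (Suc k))) sequentially"
      using W(4) AE_space
    proof eventually_elim
      case (elim x)
      show ?case
      proof
        assume "x \<notin> E1 \<union> E2"
        then have *: "W x < d" "\<And>n. real_cond_exp M (F n) W x \<le> d"
          using elim(2) by (auto simp: E1_def E2_def not_less not_le)
        from elim(1) d have "eventually (\<lambda>n. Z n x \<le> W x + real_cond_exp M (F n) W x + d) sequentially"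
          by blast
        then show "eventually (\<lambda>n. Z n x \<le> 3 * (1 / real (Suc k))) sequentially"
        proof eventually_elim
          case (elim n)
          then show ?case using * *(2)[of n] unfolding d_def[symmetric] by linarith
        qed
      qed
    qed
    ultimately show "\<exists>E\<in>sets M. measure M E < e \<and>
        (AE x in M. x \<notin> E \<longrightarrow> eventually (\<lambda>n. Z n x \<le> 3 * (1 / real (Suc k))) sequentially)"
      by (intro bexI[of _ "E1 \<union> E2"]) auto
  qed
  then have "AE x in M. \<forall>k. eventually (\<lambda>n. Z n x \<le> 3 * (1 / real (Suc k))) sequentially"
    by (simp add: AE_all_countable)
  then show ?thesis
  proof eventually_elim
    case (elim x)
    show ?case
    proof (intro allI impI)
      fix d :: real assume "d > 0"
      then obtain k where "1 / real (Suc k) < d / 3"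
        using nat_approx_posE[of "d/3"] by auto
      then show "eventually (\<lambda>n. Z n x \<le> d) sequentially"
        using elim[rule_format, of k] by (auto elim!: eventually_mono)
    qed
  qed
qed

end

section \<open>Products of a measure with a probability kernel\<close>

text \<open>The semidirect product: the law of a pair whose first coordinate is distributed as
  \<open>N\<close> and whose second, given the first coordinate \<open>x\<close>, has law
  \<open>\<kappa> x\<close>.\<close>

definition kernel_prod :: "'b measure \<Rightarrow> 'c measure \<Rightarrow> ('b \<Rightarrow> 'c measure) \<Rightarrow> ('b \<times> 'c) measure" where
  "kernel_prod N S \<kappa> = N \<bind> (\<lambda>x. distr (\<kappa> x) (N \<Otimes>\<^sub>M S) (Pair x))"

lemma
  assumes \<kappa>: "\<kappa> \<in> N \<rightarrow>\<^sub>M prob_algebra S" and N: "space N \<noteq> {}"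
  shows sets_kernel_prod: "sets (kernel_prod N S \<kappa>) = sets (N \<Otimes>\<^sub>M S)"
    and nn_integral_kernel_prod: "f \<in> borel_measurable (N \<Otimes>\<^sub>M S) \<Longrightarrow>
      (\<integral>\<^sup>+z. f z \<partial>kernel_prod N S \<kappa>) = (\<integral>\<^sup>+x. \<integral>\<^sup>+y. f (x, y) \<partial>\<kappa> x \<partial>N)"
    and emeasure_kernel_prod: "E \<in> sets (N \<Otimes>\<^sub>M S) \<Longrightarrow>
      emeasure (kernel_prod N S \<kappa>) E = (\<integral>\<^sup>+x. emeasure (\<kappa> x) (Pair x -` E) \<partial>N)"
proof -
  have sub: "(\<lambda>x. distr (\<kappa> x) (N \<Otimes>\<^sub>M S) (Pair x)) \<in> N \<rightarrow>\<^sub>M subprob_algebra (N \<Otimes>\<^sub>M S)"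
    by (rule measurable_distr2[OF _ measurable_prob_algebraD[OF \<kappa>]]) simp
  have \<kappa>s: "sets (\<kappa> x) = sets S" if "x \<in> space N" for x
    using measurable_space[OF \<kappa> that] by (simp add: space_prob_algebra)
  have Pm: "Pair x \<in> \<kappa> x \<rightarrow>\<^sub>M N \<Otimes>\<^sub>M S" if "x \<in> space N" for x
    using that by (simp add: measurable_cong_sets[OF \<kappa>s refl])
  show "sets (kernel_prod N S \<kappa>) = sets (N \<Otimes>\<^sub>M S)"
    unfolding kernel_prod_def using sub N by (rule sets_bind_measurable)
  show "(\<integral>\<^sup>+z. f z \<partial>kernel_prod N S \<kappa>) = (\<integral>\<^sup>+x. \<integral>\<^sup>+y. f (x, y) \<partial>\<kappa> x \<partial>N)"
    if f: "f \<in> borel_measurable (N \<Otimes>\<^sub>M S)"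
    unfolding kernel_prod_def nn_integral_bind[OF f sub]
    using f by (intro nn_integral_cong nn_integral_distr Pm) simp_all
  show "emeasure (kernel_prod N S \<kappa>) E = (\<integral>\<^sup>+x. emeasure (\<kappa> x) (Pair x -` E) \<partial>N)"
    if E: "E \<in> sets (N \<Otimes>\<^sub>M S)"
    unfolding kernel_prod_def emeasure_bind[OF N sub E]
  proof (intro nn_integral_cong)
    fix x assume x: "x \<in> space N"
    have "Pair x -` E \<inter> space (\<kappa> x) = Pair x -` E"
      using sets.sets_into_space[OF E] sets_eq_imp_space_eq[OF \<kappa>s[OF x]]
      by (auto simp: space_pair_measure)
    then show "emeasure (distr (\<kappa> x) (N \<Otimes>\<^sub>M S) (Pair x)) E = emeasure (\<kappa> x) (Pair x -` E)"
      by (simp add: emeasure_distr Pm x E)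
  qed
qed

text \<open>If \<open>g\<close> is \<open>F m\<close>-measurable and \<open>n \<ge> m\<close>, then
  \<open>g\<close> is its own conditional expectation, so E(Y | F n) - Y equals E(Y - g | F n) - (Y
  - g) and is bounded by \<open>W + E(W | F n)\<close> with \<open>W = \<bar>Y - g\<bar>\<close>.
  Since \<open>g\<close> can be chosen with \<open>W\<close> small in mean,
  \<open>AE_eventually_small\<close> applies.\<close>

lemma (in prob_space) levy_upward:
  fixes Y :: "'a \<Rightarrow> real"
  assumes sub: "\<And>n. subalgebra M (F n)" and mono: "\<And>m n. m \<le> n \<Longrightarrow> sets (F m) \<subseteq> sets (F n)"
    and G: "subalgebra M G" "sets G = sigma_sets (space M) (\<Union>n. sets (F n))"
    and Y: "integrable M Y" "Y \<in> borel_measurable G"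
  shows "AE x in M. (\<lambda>n. real_cond_exp M (F n) Y x) \<longlonglongrightarrow> Y x"
proof -
  let ?Q = "restr_to_subalg M G"
  interpret filtered_finite_measure M F
    by unfold_locales (use sub mono in auto)
  have sQ: "sets ?Q = sets G" by (rule sets_restr_to_subalg[OF G(1)])
  have "finite_measure ?Q"
    using finite_measure_restr_to_subalg[OF G(1)] finite_measure_axioms by blast
  \<comment> \<open>The approximation theorem wants a measure whose \<sigma>-algebra is generated by
    the filtration. It is therefore applied to \<open>M\<close> restricted to \<open>G\<close>,
    while conditional expectations stay over \<open>M\<close>.\<close>
  then interpret Q: filtered_finite_measure ?Q F
    using sub mono sQ G(2)
    by (auto simp: filtered_finite_measure_def filtered_finite_measure_axioms_def
        subalgebra_def space_restr_to_subalg)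
  have YQ: "integrable ?Q Y" by (rule integrable_in_subalg[OF G(1) Y(2,1)])
  have gen: "sets ?Q = sigma_sets (space ?Q) (\<Union>n. sets (F n))"
    using sQ G(2) by (simp add: space_restr_to_subalg)
  let ?Z = "\<lambda>n x. \<bar>real_cond_exp M (F n) Y x - Y x\<bar>"
  have "AE x in M. \<forall>d>0. eventually (\<lambda>n. ?Z n x \<le> d) sequentially"
  proof (rule AE_eventually_small)
    fix e :: real assume "e > 0"
    from Q.approx_integrable[OF gen YQ this] obtain m g K where g: "g \<in> borel_measurable (F m)"
      "\<And>x. \<bar>g x\<bar> \<le> K" "(\<integral>x. \<bar>Y x - g x\<bar> \<partial>?Q) < e" by blast
    have gM[measurable]: "g \<in> borel_measurable M" using g(1) by (rule measurable_F_M)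
    have gG: "g \<in> borel_measurable G"
      using Q.measurable_F_M[OF g(1)] measurable_in_subalg'[OF G(1)] by blast
    have gi: "integrable M g" using g(2) by (auto intro: integrable_const_bound[where B=K])
    define W where "W = (\<lambda>x. \<bar>Y x - g x\<bar>)"
    have W: "integrable M W" using Y gi by (simp add: W_def)
    have "W \<in> borel_measurable G" unfolding W_def using Y gG by measurable
    then have We: "(\<integral>x. W x \<partial>M) < e"
      using g(3) integral_subalgebra2[OF G(1), of W] by (simp add: W_def)
    have "AE x in M. ?Z n x \<le> W x + real_cond_exp M (F n) W x" if "m \<le> n" for n
    proof -
      have gn: "g \<in> borel_measurable (F n)" using g(1) that by (rule measurable_F_mono)
      have "AE x in M. real_cond_exp M (F n) (\<lambda>x. Y x - g x) x \<le> real_cond_exp M (F n) W x"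
        using Y gi W by (intro ce.real_cond_exp_mono) (auto simp: W_def)
      moreover have "AE x in M. real_cond_exp M (F n) (\<lambda>x. g x - Y x) x \<le> real_cond_exp M (F n) W x"
        using Y gi W by (intro ce.real_cond_exp_mono) (auto simp: W_def)
      moreover note ce.real_cond_exp_diff[OF Y(1) gi, of n] ce.real_cond_exp_diff[OF gi Y(1), of n]
        ce.real_cond_exp_F_meas[OF gi gn]
      ultimately show ?thesis
        by eventually_elim (auto simp: W_def)
    qed
    then have "AE x in M. \<forall>n. m \<le> n \<longrightarrow> ?Z n x \<le> W x + real_cond_exp M (F n) W x"
      unfolding AE_all_countable by auto
    then have "AE x in M. \<forall>d>0. eventually (\<lambda>n. ?Z n x \<le> W x + real_cond_exp M (F n) W x + d) sequentially"
    proof eventually_elim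
      case (elim x)
      then have "?Z n x \<le> W x + real_cond_exp M (F n) W x + d" if "m \<le> n" "d > 0" for n d
        using that by (meson add_increasing2 less_imp_le order_trans order_refl)
      then show ?case by (auto simp: eventually_sequentially)
    qed
    with W We show "\<exists>W. integrable M W \<and> (\<forall>x. 0 \<le> W x) \<and> (\<integral>x. W x \<partial>M) < e \<and>
      (AE x in M. \<forall>d>0. eventually (\<lambda>n. ?Z n x \<le> W x + real_cond_exp M (F n) W x + d) sequentially)"
      by (intro exI[of _ W]) (auto simp: W_def)
  qed
  then show ?thesis
  proof eventually_elim
    case (elim x)
    show ?case
    proof (rule tendstoI)
      fix e :: real assume "e > 0"
      with elim have "eventually (\<lambda>n. ?Z n x \<le> e / 2) sequentially" by (meson half_gt_zero)
      then show "eventually (\<lambda>n. dist (real_cond_exp M (F n) Y x) (Y x) < e) sequentially"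
        using \<open>e > 0\<close> by (auto simp: dist_real_def elim!: eventually_mono)
    qed
  qed
qed

section \<open>Predictive measures of c.i.d. sequences\<close>

locale cid_sequence = prob_space M for M :: "'w measure" +
  fixes X :: "nat \<Rightarrow> 'w \<Rightarrow> 'a::polish_space"
    and \<alpha> :: "nat \<Rightarrow> 'w \<Rightarrow> 'a measure"
    and \<alpha>' :: "'w \<Rightarrow> 'a measure"
  assumes measurable_X[measurable]: "\<And>n. X n \<in> M \<rightarrow>\<^sub>M borel"
    and cid: "cid M X"
    and predictive: "predictive_measures M X \<alpha>"
    and limit_kernel: "\<alpha>' \<in> M \<rightarrow>\<^sub>M prob_algebra borel"
    and limit_sets: "sets (vimage_algebra (space M) \<alpha>' (prob_algebra borel)) \<subseteq> sets (nat_filt_inf M X)"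
    and weak_limit: "AE \<omega> in M. weakly_converges (\<lambda>n. \<alpha> n \<omega>) (\<alpha>' \<omega>)"
begin

abbreviation "F \<equiv> nat_filt M X"
abbreviation "G \<equiv> nat_filt_inf M X"

lemma space_nat_filt: "space (F n) = space M"
  unfolding nat_filt_def by (rule space_measure_of) auto

lemma sets_nat_filt: "sets (F n) = sigma_sets (space M) {X i -` B \<inter> space M | i B. i < n \<and> B \<in> sets borel}"
  unfolding nat_filt_def by (rule sets_measure_of) auto

lemma subalgebra_nat_filt: "subalgebra M (F n)"
  unfolding subalgebra_def space_nat_filt sets_nat_filt
  by (auto intro!: sets.sigma_sets_subset measurable_sets measurable_X)

sublocale filtered_finite_measure M F
proof unfold_locales
  show "subalgebra M (F n)" for n by (rule subalgebra_nat_filt)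
  show "sets (F m) \<subseteq> sets (F n)" if "m \<le> n" for m n
    unfolding sets_nat_filt using that by (intro sigma_sets_mono') (blast intro: less_le_trans)
qed

lemma space_G: "space G = space M"
  unfolding nat_filt_inf_def
  by (rule space_measure_of) (use sets.sets_into_space[of _ "F _"] space_F in auto)

lemma sets_G: "sets G = sigma_sets (space M) (\<Union>n. sets (F n))"
  unfolding nat_filt_inf_def
  by (rule sets_measure_of) (use sets.sets_into_space[of _ "F _"] space_F in auto)

lemma subalgebra_G: "subalgebra M G"
proof -
  have "(\<Union>n. sets (F n)) \<subseteq> sets M" using sets_F_in_sets by auto
  then show ?thesis
    by (simp add: subalgebra_def space_G sets_G sets.sigma_sets_subset)
qed

lemma subalgebra_G_F: "subalgebra G (F n)"
  by (auto simp: subalgebra_def space_G space_F sets_G)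

lemma measurable_X_F: "i < n \<Longrightarrow> X i \<in> F n \<rightarrow>\<^sub>M borel"
  by (rule measurableI) (auto simp: space_F sets_nat_filt)

lemma limit_kernel_G: "\<alpha>' \<in> G \<rightarrow>\<^sub>M prob_algebra borel"
proof (rule measurableI)
  fix \<omega> assume "\<omega> \<in> space G"
  then show "\<alpha>' \<omega> \<in> space (prob_algebra borel)"
    using measurable_space[OF limit_kernel] by (simp add: space_G)
next
  fix A :: "'a measure set" assume "A \<in> sets (prob_algebra borel)"
  then show "\<alpha>' -` A \<inter> space G \<in> sets G"
    using limit_sets in_vimage_algebra[of A "prob_algebra borel" \<alpha>' "space M"] by (auto simp: space_G)
qed

lemma measurable_emeasure_predictive:
  assumes "B \<in> sets borel"
  shows "(\<lambda>\<omega>. emeasure (\<alpha> n \<omega>) B) \<in> borel_measurable (F n)"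
proof (cases "n = 0")
  case True
  have "(\<lambda>\<omega>. emeasure (\<alpha> n \<omega>) B) \<in> borel_measurable (F n) \<longleftrightarrow>
      (\<lambda>\<omega>. emeasure (distr M borel (X 0)) B) \<in> borel_measurable (F n)"
    using predictive True by (intro measurable_cong) (simp add: predictive_measures_def space_F)
  then show ?thesis by simp
next
  case False
  then have k: "\<alpha> n \<in> M \<rightarrow>\<^sub>M prob_algebra borel" and m: "(\<lambda>\<omega>. measure (\<alpha> n \<omega>) B) \<in> borel_measurable (F n)"
    using predictive assms by (auto simp: predictive_measures_def is_cond_prob_def)
  have "(\<lambda>\<omega>. emeasure (\<alpha> n \<omega>) B) \<in> borel_measurable (F n) \<longleftrightarrow>
      (\<lambda>\<omega>. ennreal (measure (\<alpha> n \<omega>) B)) \<in> borel_measurable (F n)"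
    using measurable_space[OF k]
    by (intro measurable_cong)
      (auto simp: space_F space_prob_algebra prob_space_def intro!: finite_measure.emeasure_eq_measure)
  then show ?thesis using m by simp
qed

lemma predictive_in_space: "\<omega> \<in> space M \<Longrightarrow> \<alpha> n \<omega> \<in> space (prob_algebra borel)"
  using predictive measurable_space[of "\<alpha> n" M "prob_algebra borel"]
  by (cases "n = 0") (auto simp: predictive_measures_def space_prob_algebra intro: prob_space_distr)

lemma
  assumes "\<omega> \<in> space M"
  shows prob_space_predictive: "prob_space (\<alpha> n \<omega>)"
    and sets_predictive: "sets (\<alpha> n \<omega>) = sets borel"
    and prob_space_limit: "prob_space (\<alpha>' \<omega>)"
    and sets_limit: "sets (\<alpha>' \<omega>) = sets borel"
  using predictive_in_space[OF assms] measurable_space[OF limit_kernel assms]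
  by (auto simp: space_prob_algebra)

text \<open>The predictive measures are given as kernels from \<open>M\<close>. The
  \<open>F n\<close>-measurability of the versions, set by set, upgrades this to a kernel from
  \<open>F n\<close>, as needed when \<open>\<alpha> n\<close> is evaluated on sets depending on the
  first \<open>n\<close> observations.\<close>

lemma predictive_kernel: "\<alpha> n \<in> F n \<rightarrow>\<^sub>M prob_algebra borel"
  by (rule measurable_prob_algebra_generated[where G="sets borel" and \<Omega>=UNIV])
    (auto simp: space_F prob_space_predictive sets_predictive measurable_emeasure_predictive
      sets.Int_stable sets.sigma_sets_eq[of borel, simplified])

lemma emeasure_predictive_rectangle:
  assumes H: "H \<in> sets (F n)" and B[measurable]: "B \<in> sets borel"
  shows "(\<integral>\<^sup>+\<omega>. indicator H \<omega> * emeasure (\<alpha> n \<omega>) B \<partial>M) = emeasure M (H \<inter> (X n -` B \<inter> space M))"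
proof -
  have HM[measurable]: "H \<in> sets M" using H by (rule sets_F_in_sets)
  show ?thesis
  proof (cases "n = 0")
    case True
    have "(\<integral>\<^sup>+\<omega>. indicator H \<omega> * emeasure (\<alpha> n \<omega>) B \<partial>M)
        = (\<integral>\<^sup>+\<omega>. indicator H \<omega> * emeasure (distr M borel (X 0)) B \<partial>M)"
      using predictive True by (intro nn_integral_cong) (simp add: predictive_measures_def)
    also have "\<dots> = emeasure M H * emeasure M (X 0 -` B \<inter> space M)"
      by (simp add: nn_integral_multc emeasure_distr)
    \<comment> \<open>\<open>F 0\<close> is trivial: \<open>H\<close> is empty or the whole space,
      so the product of probabilities is the probability of the intersection.\<close>
    also have "\<dots> = emeasure M (H \<inter> (X n -` B \<inter> space M))"
      using H True by (auto simp: sets_nat_filt_0 emeasure_space_1 Int_absorb1)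
    finally show ?thesis .
  next
    case False
    let ?A = "X n -` B \<inter> space M"
    have k: "AE \<omega> in M. measure (\<alpha> n \<omega>) B = real_cond_exp M (F n) (indicator ?A) \<omega>"
      using predictive False B by (auto simp: predictive_measures_def is_cond_prob_def)
    have m: "(\<lambda>\<omega>. measure (\<alpha> n \<omega>) B) \<in> borel_measurable M"
      using measurable_F_M[OF measurable_emeasure_predictive[OF B]] by (simp add: measure_def)
    have i: "integrable M (indicator ?A :: 'w \<Rightarrow> real)"
      by (intro integrable_real_indicator) (auto simp: less_top[symmetric])
    have "(\<integral>\<^sup>+\<omega>. indicator H \<omega> * emeasure (\<alpha> n \<omega>) B \<partial>M)
        = (\<integral>\<^sup>+\<omega>. ennreal (indicator H \<omega> * measure (\<alpha> n \<omega>) B) \<partial>M)"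
      using prob_space_predictive
      by (intro nn_integral_cong)
        (simp add: ennreal_mult'' prob_space_def finite_measure.emeasure_eq_measure ennreal_indicator)
    also have "\<dots> = ennreal (\<integral>\<omega>\<in>H. measure (\<alpha> n \<omega>) B \<partial>M)"
      unfolding set_lebesgue_integral_def real_scaleR_def
      using m by (intro nn_integral_eq_integral integrable_const_bound[where B=1])
        (auto simp: prob_space.prob_le_1 prob_space_predictive indicator_def intro!: AE_I2)
    also have "(\<integral>\<omega>\<in>H. measure (\<alpha> n \<omega>) B \<partial>M) = (\<integral>\<omega>\<in>H. real_cond_exp M (F n) (indicator ?A) \<omega> \<partial>M)"
      unfolding set_lebesgue_integral_def using k m by (intro integral_cong_AE) auto
    also have "\<dots> = (\<integral>\<omega>\<in>H. indicator ?A \<omega> \<partial>M)"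
      by (rule ce.real_cond_exp_intA[OF i H, symmetric])
    also have "\<dots> = (\<integral>\<omega>. indicator (H \<inter> ?A) \<omega> \<partial>M)"
      by (simp add: set_lebesgue_integral_def indicator_inter_arith)
    also have "\<dots> = measure M (H \<inter> ?A)" by simp
    finally show ?thesis by (simp add: emeasure_eq_measure)
  qed
qed

text \<open>Measurable rectangles form an intersection-stable generator, so the identity on
  rectangles determines the joint law of \<open>\<omega>\<close> and \<open>X n\<close> on the
  product with \<open>F n\<close>. The kernel is left open because \<open>\<alpha> n\<close> and
  \<open>\<alpha>'\<close> both satisfy this identity, and therefore agree on all such
  integrands.\<close>

lemma nn_integral_kernel_eqI:
  assumes \<kappa>: "\<kappa> \<in> M \<rightarrow>\<^sub>M prob_algebra borel"
    and eq: "\<And>H B. H \<in> sets (F n) \<Longrightarrow> B \<in> sets borel \<Longrightarrow>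
      (\<integral>\<^sup>+\<omega>. indicator H \<omega> * emeasure (\<kappa> \<omega>) B \<partial>M) = emeasure M (H \<inter> (X n -` B \<inter> space M))"
    and f: "f \<in> borel_measurable (F n \<Otimes>\<^sub>M borel)"
  shows "(\<integral>\<^sup>+\<omega>. \<integral>\<^sup>+x. f (\<omega>, x) \<partial>\<kappa> \<omega> \<partial>M) = (\<integral>\<^sup>+\<omega>. f (\<omega>, X n \<omega>) \<partial>M)"
proof -
  let ?S = "F n \<Otimes>\<^sub>M (borel :: 'a measure)" and ?K = "kernel_prod M borel \<kappa>"
  have sK: "sets ?K = sets (M \<Otimes>\<^sub>M borel)"
    by (rule sets_kernel_prod[OF \<kappa> not_empty])
  have id: "(\<lambda>z. z) \<in> M \<Otimes>\<^sub>M borel \<rightarrow>\<^sub>M ?S"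
    using measurable_F_M[OF measurable_ident_sets[OF refl], of n]
    by (simp add: measurable_pair_iff comp_def measurable_compose[OF measurable_fst])
  then have idK: "(\<lambda>z. z) \<in> ?K \<rightarrow>\<^sub>M ?S" by (simp add: measurable_cong_sets[OF sK refl])
  have pair: "(\<lambda>\<omega>. (\<omega>, X n \<omega>)) \<in> M \<rightarrow>\<^sub>M ?S"
    by (rule measurable_Pair[OF measurable_F_M[OF measurable_ident_sets[OF refl]] measurable_X])
  \<comment> \<open>The kernel product carries events of \<open>M\<close> in its first coordinate,
    but the rectangle identity is assumed only for events of \<open>F n\<close>. The push-forward
    under the identity coarsens the \<sigma>-algebra accordingly.\<close>
  have "distr ?K ?S (\<lambda>z. z) = distr M ?S (\<lambda>\<omega>. (\<omega>, X n \<omega>))"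
  proof (rule measure_eqI_generator_eq[where \<Omega>="space (F n) \<times> space borel" and
        E="{a \<times> b | a b. a \<in> sets (F n) \<and> b \<in> sets borel}" and A="\<lambda>_. space (F n) \<times> space borel"])
    show *: "emeasure (distr ?K ?S (\<lambda>z. z)) R = emeasure (distr M ?S (\<lambda>\<omega>. (\<omega>, X n \<omega>))) R"
      if "R \<in> {a \<times> b | a b. a \<in> sets (F n) \<and> b \<in> sets borel}" for R
    proof -
      from that obtain H B where R: "R = H \<times> B" and H: "H \<in> sets (F n)" and B[measurable]: "B \<in> sets borel"
        by auto
      have HB: "H \<times> B \<in> sets ?S" and HBM: "H \<times> B \<in> sets (M \<Otimes>\<^sub>M borel)"
        using H sets_F_in_sets by auto
      have "emeasure (distr ?K ?S (\<lambda>z. z)) R = emeasure ?K (H \<times> B)"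
        unfolding R emeasure_distr[OF idK HB]
        using sets.sets_into_space[OF HBM] sets_eq_imp_space_eq[OF sK] by (auto simp: Int_absorb2)
      also have "\<dots> = (\<integral>\<^sup>+\<omega>. emeasure (\<kappa> \<omega>) (Pair \<omega> -` (H \<times> B)) \<partial>M)"
        by (rule emeasure_kernel_prod[OF \<kappa> not_empty HBM])
      also have "\<dots> = (\<integral>\<^sup>+\<omega>. indicator H \<omega> * emeasure (\<kappa> \<omega>) B \<partial>M)"
        by (intro nn_integral_cong) (simp add: indicator_def)
      also have "\<dots> = emeasure M (H \<inter> (X n -` B \<inter> space M))" by (rule eq[OF H B])
      also have "\<dots> = emeasure (distr M ?S (\<lambda>\<omega>. (\<omega>, X n \<omega>))) R"
        unfolding R emeasure_distr[OF pair HB]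
        by (rule arg_cong[where f="emeasure M"]) (use sets.sets_into_space[OF H] space_F in auto)
      finally show ?thesis .
    qed
    have top: "space (F n) \<times> space borel \<in> {a \<times> b | a b. a \<in> sets (F n) \<and> b \<in> sets (borel :: 'a measure)}"
      by blast
    then show "range (\<lambda>_. space (F n) \<times> space borel) \<subseteq> {a \<times> b | a b. a \<in> sets (F n) \<and> b \<in> sets (borel :: 'a measure)}"
      by blast
    interpret D: prob_space "distr M ?S (\<lambda>\<omega>. (\<omega>, X n \<omega>))" by (rule prob_space_distr[OF pair])
    show "emeasure (distr ?K ?S (\<lambda>z. z)) (space (F n) \<times> space borel) \<noteq> \<infinity>"
      unfolding *[OF top] by simp
  qed (auto simp: sets_pair_measure Int_stable_pair_measure_generator dest: sets.sets_into_space)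
  then have "(\<integral>\<^sup>+z. f z \<partial>distr ?K ?S (\<lambda>z. z)) = (\<integral>\<^sup>+z. f z \<partial>distr M ?S (\<lambda>\<omega>. (\<omega>, X n \<omega>)))"
    by simp
  then show ?thesis
    using f measurable_comp[OF id f]
    by (simp add: nn_integral_distr[OF idK] nn_integral_distr[OF pair] comp_def
        nn_integral_kernel_prod[OF \<kappa> not_empty])
qed

lemma nn_integral_predictive:
  assumes "f \<in> borel_measurable (F n \<Otimes>\<^sub>M borel)"
  shows "(\<integral>\<^sup>+\<omega>. \<integral>\<^sup>+x. f (\<omega>, x) \<partial>\<alpha> n \<omega> \<partial>M) = (\<integral>\<^sup>+\<omega>. f (\<omega>, X n \<omega>) \<partial>M)"
  by (rule nn_integral_kernel_eqI[OF measurable_F_M[OF predictive_kernel] emeasure_predictive_rectangle assms])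

section \<open>The c.i.d. property on events of the filtration\<close>

text \<open>The c.i.d. property compares laws of finite vectors. Writing events of
  \<open>F n\<close> as preimages under the vector of observations makes that comparison available
  for them.\<close>

lemma vimage_nat_filt:
  assumes "H \<in> sets (F n)"
  obtains C where "C \<in> sets (PiM {..<n} (\<lambda>_. borel))" "H = (\<lambda>\<omega>. \<lambda>i\<in>{..<n}. X i \<omega>) -` C \<inter> space M"
proof -
  let ?T = "\<lambda>\<omega>. \<lambda>i\<in>{..<n}. X i \<omega>" and ?P = "PiM {..<n} (\<lambda>_. borel :: 'a measure)"
  have T: "?T \<in> space M \<rightarrow> space ?P" by (auto simp: space_PiM)
  have "sets (F n) \<subseteq> sets (vimage_algebra (space M) ?T ?P)"
    unfolding sets_nat_filt
  proof (rule sets.sigma_sets_subset[of _ "vimage_algebra (space M) ?T ?P", simplified], safe)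
    fix i and B :: "'a set" assume "i < n" "B \<in> sets borel"
    then have "(\<lambda>y. y i) -` B \<inter> space ?P \<in> sets ?P"
      by (intro measurable_sets[OF measurable_component_singleton]) auto
    from in_vimage_algebra[OF this, of ?T "space M"]
    show "X i -` B \<inter> space M \<in> sets (vimage_algebra (space M) ?T ?P)"
    proof (rule back_subst[where P="\<lambda>A. A \<in> _"])
      show "?T -` ((\<lambda>y. y i) -` B \<inter> space ?P) \<inter> space M = X i -` B \<inter> space M"
        using T \<open>i < n\<close> by auto
    qed
  qed
  with assms have "H \<in> sets (vimage_algebra (space M) ?T ?P)" by blast
  then show ?thesis using that unfolding sets_vimage_algebra2[OF T] by blast
qed

lemma cid_step:
  assumes H: "H \<in> sets (F n)" and B[measurable]: "B \<in> sets borel"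
  shows "emeasure M (H \<inter> (X (Suc n) -` B \<inter> space M)) = emeasure M (H \<inter> (X n -` B \<inter> space M))"
proof -
  obtain C where C[measurable]: "C \<in> sets (PiM {..<n} (\<lambda>_. borel))"
    and HC: "H = (\<lambda>\<omega>. \<lambda>i\<in>{..<n}. X i \<omega>) -` C \<inter> space M"
    using vimage_nat_filt[OF H] .
  let ?P = "PiM {..n} (\<lambda>_. borel :: 'a measure)"
  have r: "(\<lambda>y. restrict y {..<n}) \<in> ?P \<rightarrow>\<^sub>M PiM {..<n} (\<lambda>_. borel)"
    by (rule measurable_restrict_subset) auto
  \<comment> \<open>The first \<open>n\<close> coordinates encode \<open>H\<close>, and the
    coordinate \<open>n\<close> carries \<open>X (Suc n)\<close> under \<open>?f\<close> and
    \<open>X n\<close> under \<open>?g\<close>. So both sides of the claim are masses of the same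
    set \<open>D\<close>.\<close>
  define D where "D = ((\<lambda>y. restrict y {..<n}) -` C \<inter> space ?P) \<inter> ((\<lambda>y. y n) -` B \<inter> space ?P)"
  have D: "D \<in> sets ?P"
    unfolding D_def
    by (intro sets.Int measurable_sets[OF r C] measurable_sets[OF measurable_component_singleton[where M="\<lambda>_. borel"] B]) auto
  let ?f = "\<lambda>\<omega>. \<lambda>i\<in>{..n}. if i < n then X i \<omega> else X (Suc n) \<omega>"
  let ?g = "\<lambda>\<omega>. \<lambda>i\<in>{..n}. X i \<omega>"
  have f: "?f \<in> M \<rightarrow>\<^sub>M ?P" and g: "?g \<in> M \<rightarrow>\<^sub>M ?P"
    by (auto intro!: measurable_restrict)
  have rf: "restrict (?f \<omega>) {..<n} = (\<lambda>i\<in>{..<n}. X i \<omega>)" "restrict (?g \<omega>) {..<n} = (\<lambda>i\<in>{..<n}. X i \<omega>)" for \<omega>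
    by (auto simp: fun_eq_iff)
  have "emeasure M (H \<inter> (X (Suc n) -` B \<inter> space M)) = emeasure (distr M ?P ?f) D"
    unfolding emeasure_distr[OF f D]
    by (rule arg_cong[where f="emeasure M"]) (use rf in \<open>auto simp: HC D_def space_PiM\<close>)
  also have "distr M ?P ?f = distr M ?P ?g" using cid by (simp add: cid_def)
  also have "emeasure (distr M ?P ?g) D = emeasure M (H \<inter> (X n -` B \<inter> space M))"
    unfolding emeasure_distr[OF g D]
    by (rule arg_cong[where f="emeasure M"]) (use rf in \<open>auto simp: HC D_def space_PiM\<close>)
  finally show ?thesis .
qed

lemma cid_later:
  assumes H: "H \<in> sets (F n)" and B: "B \<in> sets borel" and "n \<le> m"
  shows "emeasure M (H \<inter> (X m -` B \<inter> space M)) = emeasure M (H \<inter> (X n -` B \<inter> space M))"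
  using \<open>n \<le> m\<close>
proof (induction rule: dec_induct)
  case (step k)
  then show ?case using cid_step[of H k B] H B sets_F_mono[of n k] by auto
qed simp

lemma nn_integral_cid_later:
  assumes H: "H \<in> sets (F n)" and f[measurable]: "f \<in> borel_measurable borel" and "n \<le> m"
  shows "(\<integral>\<^sup>+\<omega>. indicator H \<omega> * f (X m \<omega>) \<partial>M) = (\<integral>\<^sup>+\<omega>. indicator H \<omega> * f (X n \<omega>) \<partial>M)"
proof -
  have [measurable]: "H \<in> sets M" using H by (rule sets_F_in_sets)
  have e: "emeasure (distr (density M (indicator H)) borel (X k)) B = emeasure M (H \<inter> (X k -` B \<inter> space M))"
    if [measurable]: "B \<in> sets borel" for k B
  proof -
    have "emeasure (distr (density M (indicator H)) borel (X k)) B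
        = (\<integral>\<^sup>+\<omega>. indicator H \<omega> * indicator (X k -` B \<inter> space M) \<omega> \<partial>M)"
      by (simp add: emeasure_distr emeasure_density)
    also have "\<dots> = (\<integral>\<^sup>+\<omega>. indicator (H \<inter> (X k -` B \<inter> space M)) \<omega> \<partial>M)"
      by (simp add: indicator_inter_arith)
    finally show ?thesis by simp
  qed
  have "distr (density M (indicator H)) borel (X m) = distr (density M (indicator H)) borel (X n)"
    by (rule measure_eqI) (use e cid_later[OF H _ \<open>n \<le> m\<close>] in auto)
  then have "(\<integral>\<^sup>+x. f x \<partial>distr (density M (indicator H)) borel (X m))
      = (\<integral>\<^sup>+x. f x \<partial>distr (density M (indicator H)) borel (X n))" by simp
  then show ?thesis by (simp add: nn_integral_distr nn_integral_density)
qed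

end

section \<open>Continuous approximation of closed sets\<close>

definition closed_bump :: "'a::metric_space set \<Rightarrow> nat \<Rightarrow> 'a \<Rightarrow> real" where
  "closed_bump B k x = max 0 (1 - real k * infdist x B)"

lemma closed_bump_bounds: "0 \<le> closed_bump B k x" "closed_bump B k x \<le> 1"
  by (auto simp: closed_bump_def infdist_nonneg)

lemma closed_bump_in: "x \<in> B \<Longrightarrow> closed_bump B k x = 1"
  by (simp add: closed_bump_def)

lemma continuous_closed_bump: "continuous_on UNIV (closed_bump B k)"
  unfolding closed_bump_def by (intro continuous_intros)

lemma measurable_closed_bump[measurable]: "closed_bump B k \<in> borel_measurable borel"
  by (rule borel_measurable_continuous_onI[OF continuous_closed_bump])

text \<open>For the empty set \<open>infdist\<close> has the default value 0, so the bump is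
  constantly 1 there. This is why \<open>B\<close> has to be nonempty.\<close>

lemma closed_bump_tendsto:
  assumes "closed B" "B \<noteq> {}"
  shows "(\<lambda>k. closed_bump B k x) \<longlonglongrightarrow> indicator B x"
proof (cases "x \<in> B")
  case False
  then have d: "infdist x B > 0"
    using assms in_closed_iff_infdist_zero[of B x] infdist_nonneg[of x B] by force
  obtain K where K: "1 / infdist x B < real K" using reals_Archimedean2 by blast
  have "closed_bump B k x = 0" if "K \<le> k" for k
  proof -
    have "1 / infdist x B < real k" using K that by linarith
    then show ?thesis using d by (simp add: closed_bump_def field_simps)
  qed
  then have "eventually (\<lambda>k. closed_bump B k x = indicator B x) sequentially"
    using False by (auto simp: eventually_sequentially)
  then show ?thesis by (rule tendsto_eventually)
qed (simp add: closed_bump_in)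

lemma nn_integral_bounded_kernel:
  fixes f :: "'a::topological_space \<Rightarrow> real"
  assumes "prob_space \<nu>" and s: "sets \<nu> = sets borel" and f[measurable]: "f \<in> borel_measurable borel"
    and "\<And>x. 0 \<le> f x" "\<And>x. f x \<le> 1"
  shows "(\<integral>\<^sup>+x. ennreal (f x) \<partial>\<nu>) = ennreal (\<integral>x. f x \<partial>\<nu>)" "(\<integral>x. f x \<partial>\<nu>) \<le> 1"
proof -
  interpret \<nu>: prob_space \<nu> by fact
  have "f \<in> borel_measurable \<nu>" by (simp add: measurable_cong_sets[OF s refl])
  then have i: "integrable \<nu> f" using assms(4,5) by (intro \<nu>.integrable_const_bound[where B=1]) auto
  show "(\<integral>\<^sup>+x. ennreal (f x) \<partial>\<nu>) = ennreal (\<integral>x. f x \<partial>\<nu>)"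
    using assms(4) by (intro nn_integral_eq_integral i) auto
  have "(\<integral>x. f x \<partial>\<nu>) \<le> (\<integral>x. 1 \<partial>\<nu>)"
    using assms(5) i by (intro integral_mono) auto
  then show "(\<integral>x. f x \<partial>\<nu>) \<le> 1" by (simp add: \<nu>.prob_space)
qed

lemma measurable_nn_integral_kernel:
  assumes "\<kappa> \<in> N \<rightarrow>\<^sub>M prob_algebra S" "f \<in> borel_measurable S"
  shows "(\<lambda>\<omega>. \<integral>\<^sup>+x. f x \<partial>\<kappa> \<omega>) \<in> borel_measurable N"
  using nn_integral_measurable_subprob_algebra[OF assms(2)] measurable_prob_algebraD[OF assms(1)]
  by (rule measurable_compose[rotated])

lemma measurable_measure_kernel_section:
  assumes "\<kappa> \<in> N \<rightarrow>\<^sub>M prob_algebra borel" "E \<in> sets (N \<Otimes>\<^sub>M (borel :: 'a::topological_space measure))"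
  shows "(\<lambda>\<omega>. measure (\<kappa> \<omega>) (Pair \<omega> -` E)) \<in> borel_measurable N"
proof (rule measure_measurable_prob_algebra2[OF _ assms(1)])
  have "Sigma (space N) (\<lambda>\<omega>. Pair \<omega> -` E) = E"
    using sets.sets_into_space[OF assms(2)] by (auto simp: space_pair_measure)
  then show "Sigma (space N) (\<lambda>\<omega>. Pair \<omega> -` E) \<in> sets (N \<Otimes>\<^sub>M (borel :: 'a measure))" using assms(2) by simp
qed

section \<open>Conditional laws under the limit kernel\<close>

context cid_sequence
begin

text \<open>For \<open>m \<ge> n\<close> the integral over \<open>H\<close> of \<open>f\<close>
  against \<open>\<alpha> m\<close> is the mean of \<open>f (X m)\<close> on \<open>H\<close>, which
  by the c.i.d. property is the mean of \<open>f (X n)\<close> on \<open>H\<close>. The sequence is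
  thus eventually constant, while weak and dominated convergence identify its limit.\<close>

lemma nn_integral_limit_continuous:
  assumes H: "H \<in> sets (F n)" and f: "continuous_on UNIV f" and b: "\<And>x. 0 \<le> f x" "\<And>x. f x \<le> 1"
  shows "(\<integral>\<^sup>+\<omega>. indicator H \<omega> * (\<integral>\<^sup>+x. ennreal (f x) \<partial>\<alpha>' \<omega>) \<partial>M) = (\<integral>\<^sup>+\<omega>. indicator H \<omega> * ennreal (f (X n \<omega>)) \<partial>M)"
proof -
  have f'[measurable]: "f \<in> borel_measurable borel" by (rule borel_measurable_continuous_onI[OF f])
  have [measurable]: "H \<in> sets M" using H by (rule sets_F_in_sets)
  note bk = nn_integral_bounded_kernel[OF prob_space_predictive sets_predictive f' b]
    nn_integral_bounded_kernel[OF prob_space_limit sets_limit f' b]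
  have m: "(\<lambda>\<omega>. \<integral>\<^sup>+x. ennreal (f x) \<partial>\<alpha> m \<omega>) \<in> borel_measurable M" for m
    using measurable_F_M[OF predictive_kernel] by (rule measurable_nn_integral_kernel) simp
  have m': "(\<lambda>\<omega>. \<integral>\<^sup>+x. ennreal (f x) \<partial>\<alpha>' \<omega>) \<in> borel_measurable M"
    using limit_kernel by (rule measurable_nn_integral_kernel) simp
  have "(\<lambda>m. \<integral>\<^sup>+\<omega>. indicator H \<omega> * (\<integral>\<^sup>+x. ennreal (f x) \<partial>\<alpha> m \<omega>) \<partial>M)
      \<longlonglongrightarrow> (\<integral>\<^sup>+\<omega>. indicator H \<omega> * (\<integral>\<^sup>+x. ennreal (f x) \<partial>\<alpha>' \<omega>) \<partial>M)"
  proof (rule nn_integral_dominated_convergence[where w="\<lambda>_. 1"])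
    show "AE \<omega> in M. indicator H \<omega> * (\<integral>\<^sup>+x. ennreal (f x) \<partial>\<alpha> m \<omega>) \<le> 1" for m
      using bk(1,2) by (intro AE_I2) (simp add: indicator_def ennreal_le_1)
    show "AE \<omega> in M. (\<lambda>m. indicator H \<omega> * (\<integral>\<^sup>+x. ennreal (f x) \<partial>\<alpha> m \<omega>))
        \<longlonglongrightarrow> indicator H \<omega> * (\<integral>\<^sup>+x. ennreal (f x) \<partial>\<alpha>' \<omega>)"
      using weak_limit AE_space
    proof eventually_elim
      case (elim \<omega>)
      have "bounded (range f)"
        using b by (intro boundedI[of _ 1]) auto
      then have "(\<lambda>m. \<integral>x. f x \<partial>\<alpha> m \<omega>) \<longlonglongrightarrow> (\<integral>x. f x \<partial>\<alpha>' \<omega>)"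
        using elim(1) f by (simp add: weakly_converges_def)
      then have "(\<lambda>m. ennreal (\<integral>x. f x \<partial>\<alpha> m \<omega>)) \<longlonglongrightarrow> ennreal (\<integral>x. f x \<partial>\<alpha>' \<omega>)"
        by (rule tendsto_ennrealI)
      then show ?case
        unfolding bk(1)[OF elim(2) elim(2)] bk(3)[OF elim(2) elim(2)]
        by (cases "\<omega> \<in> H") simp_all
    qed
  qed (use m m' in \<open>simp_all add: emeasure_space_1\<close>)
  moreover have "eventually (\<lambda>m. (\<integral>\<^sup>+\<omega>. indicator H \<omega> * (\<integral>\<^sup>+x. ennreal (f x) \<partial>\<alpha> m \<omega>) \<partial>M)
      = (\<integral>\<^sup>+\<omega>. indicator H \<omega> * ennreal (f (X n \<omega>)) \<partial>M)) sequentially"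
    unfolding eventually_sequentially
  proof (intro exI[of _ n] allI impI)
    fix m assume nm: "n \<le> m"
    then have Hm: "H \<in> sets (F m)" using H sets_F_mono by blast
    have "(\<integral>\<^sup>+\<omega>. indicator H \<omega> * (\<integral>\<^sup>+x. ennreal (f x) \<partial>\<alpha> m \<omega>) \<partial>M)
        = (\<integral>\<^sup>+\<omega>. \<integral>\<^sup>+x. indicator H \<omega> * ennreal (f x) \<partial>\<alpha> m \<omega> \<partial>M)"
      by (intro nn_integral_cong nn_integral_cmult[symmetric])
        (simp add: measurable_cong_sets[OF sets_predictive refl])
    also have "\<dots> = (\<integral>\<^sup>+\<omega>. indicator H \<omega> * ennreal (f (X m \<omega>)) \<partial>M)"
      using nn_integral_predictive[of "\<lambda>z. indicator H (fst z) * ennreal (f (snd z))" m] Hm by simp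
    also have "\<dots> = (\<integral>\<^sup>+\<omega>. indicator H \<omega> * ennreal (f (X n \<omega>)) \<partial>M)"
      by (rule nn_integral_cid_later[OF H _ nm]) simp
    finally show "(\<integral>\<^sup>+\<omega>. indicator H \<omega> * (\<integral>\<^sup>+x. ennreal (f x) \<partial>\<alpha> m \<omega>) \<partial>M)
        = (\<integral>\<^sup>+\<omega>. indicator H \<omega> * ennreal (f (X n \<omega>)) \<partial>M)" .
  qed
  ultimately show ?thesis
    by (rule LIMSEQ_unique[OF _ tendsto_eventually])
qed

text \<open>Weak convergence speaks only of continuous functions. With \<open>H\<close> fixed, both
  sides are finite measures in \<open>B\<close>; they agree on continuous functions with values in
  [0,1], hence on closed sets by the bumps, and closed sets form an intersection-stable
  generator.\<close>

lemma emeasure_limit_rectangle: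
  assumes H: "H \<in> sets (F n)" and B: "B \<in> sets borel"
  shows "(\<integral>\<^sup>+\<omega>. indicator H \<omega> * emeasure (\<alpha>' \<omega>) B \<partial>M) = emeasure M (H \<inter> (X n -` B \<inter> space M))"
proof -
  have HM[measurable]: "H \<in> sets M" using H by (rule sets_F_in_sets)
  let ?\<mu> = "distr (density M (indicator H)) borel (X n)"
  let ?K = "kernel_prod M borel \<alpha>'"
  let ?\<nu> = "distr (density ?K (\<lambda>z. indicator H (fst z))) borel snd"
  note sK = sets_kernel_prod[OF limit_kernel not_empty]
  have [measurable]: "snd \<in> ?K \<rightarrow>\<^sub>M borel" "fst \<in> ?K \<rightarrow>\<^sub>M M"
    by (simp_all add: measurable_cong_sets[OF sK refl])
  have int\<nu>: "(\<integral>\<^sup>+x. f x \<partial>?\<nu>) = (\<integral>\<^sup>+\<omega>. indicator H \<omega> * (\<integral>\<^sup>+x. f x \<partial>\<alpha>' \<omega>) \<partial>M)"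
    if [measurable]: "f \<in> borel_measurable borel" for f
  proof -
    have "(\<integral>\<^sup>+x. f x \<partial>?\<nu>) = (\<integral>\<^sup>+z. indicator H (fst z) * f (snd z) \<partial>?K)"
      by (simp add: nn_integral_distr nn_integral_density)
    also have "\<dots> = (\<integral>\<^sup>+\<omega>. \<integral>\<^sup>+x. indicator H \<omega> * f x \<partial>\<alpha>' \<omega> \<partial>M)"
      by (subst nn_integral_kernel_prod[OF limit_kernel not_empty]) simp_all
    also have "\<dots> = (\<integral>\<^sup>+\<omega>. indicator H \<omega> * (\<integral>\<^sup>+x. f x \<partial>\<alpha>' \<omega>) \<partial>M)"
      by (intro nn_integral_cong nn_integral_cmult) (simp add: measurable_cong_sets[OF sets_limit refl])
    finally show ?thesis .
  qed
  have int\<mu>: "(\<integral>\<^sup>+x. f x \<partial>?\<mu>) = (\<integral>\<^sup>+\<omega>. indicator H \<omega> * f (X n \<omega>) \<partial>M)"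
    if [measurable]: "f \<in> borel_measurable borel" for f
    by (simp add: nn_integral_distr nn_integral_density)
  have em\<mu>: "emeasure ?\<mu> B = emeasure M (H \<inter> (X n -` B \<inter> space M))" if [measurable]: "B \<in> sets borel" for B
  proof -
    have "emeasure ?\<mu> B = (\<integral>\<^sup>+\<omega>. indicator H \<omega> * indicator (X n -` B \<inter> space M) \<omega> \<partial>M)"
      by (simp add: emeasure_distr emeasure_density)
    also have "\<dots> = (\<integral>\<^sup>+\<omega>. indicator (H \<inter> (X n -` B \<inter> space M)) \<omega> \<partial>M)"
      by (simp add: indicator_inter_arith)
    finally show ?thesis by simp
  qed
  have fin\<mu>: "emeasure ?\<mu> UNIV < \<infinity>"
    by (simp add: em\<mu> less_top[symmetric])
  have eqf: "(\<integral>\<^sup>+x. ennreal (f x) \<partial>?\<nu>) = (\<integral>\<^sup>+x. ennreal (f x) \<partial>?\<mu>)"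
    if "continuous_on UNIV f" "\<And>x. 0 \<le> f x" "\<And>x. f x \<le> 1" for f
  proof -
    have [measurable]: "f \<in> borel_measurable borel" by (rule borel_measurable_continuous_onI[OF that(1)])
    show ?thesis using nn_integral_limit_continuous[OF H that] by (simp add: int\<nu> int\<mu>)
  qed
  have fin\<nu>: "emeasure ?\<nu> UNIV < \<infinity>"
    using eqf[of "\<lambda>_. 1"] fin\<mu> by simp
  have lim: "(\<lambda>k. \<integral>\<^sup>+x. ennreal (closed_bump C k x) \<partial>\<rho>) \<longlonglongrightarrow> emeasure \<rho> C"
    if C: "closed C" "C \<noteq> {}" and \<rho>: "sets \<rho> = sets borel" "emeasure \<rho> UNIV < \<infinity>" for C and \<rho> :: "'a measure"
  proof -
    have [measurable]: "C \<in> sets borel" using C by simp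
    have sp: "space \<rho> = UNIV" using sets_eq_imp_space_eq[OF \<rho>(1)] by simp
    have m: "(\<lambda>x. ennreal (closed_bump C k x)) \<in> borel_measurable \<rho>"
      "(\<lambda>x. ennreal (indicator C x)) \<in> borel_measurable \<rho>" for k
      unfolding measurable_cong_sets[OF \<rho>(1) refl] by measurable
    have "(\<lambda>k. \<integral>\<^sup>+x. ennreal (closed_bump C k x) \<partial>\<rho>) \<longlonglongrightarrow> (\<integral>\<^sup>+x. ennreal (indicator C x) \<partial>\<rho>)"
    proof (rule nn_integral_dominated_convergence[where w="\<lambda>_. 1"])
      show "AE x in \<rho>. ennreal (closed_bump C k x) \<le> 1" for k
        by (intro AE_I2) (simp add: ennreal_le_1 closed_bump_bounds)
      show "AE x in \<rho>. (\<lambda>k. ennreal (closed_bump C k x)) \<longlonglongrightarrow> ennreal (indicator C x)"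
        by (intro AE_I2 tendsto_ennrealI closed_bump_tendsto C)
    qed (use \<rho> sp m in simp_all)
    then show ?thesis by (simp add: ennreal_indicator \<rho>(1))
  qed
  have "?\<nu> = ?\<mu>"
  proof (rule measure_eqI_generator_eq[where \<Omega>=UNIV and E="Collect closed" and A="\<lambda>_. UNIV"])
    fix C :: "'a set" assume "C \<in> Collect closed"
    then have C: "closed C" by simp
    show "emeasure ?\<nu> C = emeasure ?\<mu> C"
    proof (cases "C = {}")
      case False
      have e: "(\<integral>\<^sup>+x. ennreal (closed_bump C k x) \<partial>?\<nu>) = (\<integral>\<^sup>+x. ennreal (closed_bump C k x) \<partial>?\<mu>)" for k
        by (rule eqf[OF continuous_closed_bump closed_bump_bounds])
      show ?thesis
        using lim[OF C False _ fin\<nu>] lim[OF C False _ fin\<mu>] unfolding e sets_distr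
        by (meson LIMSEQ_unique)
    qed simp
  next
    show "sets ?\<nu> = sigma_sets UNIV (Collect closed)" "sets ?\<mu> = sigma_sets UNIV (Collect closed)"
      unfolding sets_distr by (subst borel_eq_closed, simp)+
    show "emeasure ?\<nu> UNIV \<noteq> \<infinity>" using fin\<nu> by (metis less_irrefl)
  qed (auto simp: Int_stable_def)
  then have "emeasure ?\<nu> B = emeasure M (H \<inter> (X n -` B \<inter> space M))"
    using em\<mu>[OF B] by simp
  moreover have "emeasure ?\<nu> B = (\<integral>\<^sup>+\<omega>. indicator H \<omega> * emeasure (\<alpha>' \<omega>) B \<partial>M)"
  proof -
    have "emeasure ?\<nu> B = (\<integral>\<^sup>+x. indicator B x \<partial>?\<nu>)" using B by simp
    also have "\<dots> = (\<integral>\<^sup>+\<omega>. indicator H \<omega> * (\<integral>\<^sup>+x. indicator B x \<partial>\<alpha>' \<omega>) \<partial>M)"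
      using B by (intro int\<nu>) simp
    also have "\<dots> = (\<integral>\<^sup>+\<omega>. indicator H \<omega> * emeasure (\<alpha>' \<omega>) B \<partial>M)"
      using B by (intro nn_integral_cong) (simp add: sets_limit)
    finally show ?thesis .
  qed
  ultimately show ?thesis by simp
qed

lemma nn_integral_limit:
  assumes "f \<in> borel_measurable (F n \<Otimes>\<^sub>M borel)"
  shows "(\<integral>\<^sup>+\<omega>. \<integral>\<^sup>+x. f (\<omega>, x) \<partial>\<alpha>' \<omega> \<partial>M) = (\<integral>\<^sup>+\<omega>. f (\<omega>, X n \<omega>) \<partial>M)"
  by (rule nn_integral_kernel_eqI[OF limit_kernel emeasure_limit_rectangle assms])

text \<open>\<open>\<alpha> n = E(\<alpha>' | F n)\<close>, extended from fixed Borel sets to \<open>F n\<close>-measurable random sets.\<close>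

lemma cond_exp_limit_section:
  assumes E: "E \<in> sets (F n \<Otimes>\<^sub>M borel)"
  shows "AE \<omega> in M. real_cond_exp M (F n) (\<lambda>\<omega>. measure (\<alpha>' \<omega>) (Pair \<omega> -` E)) \<omega> = measure (\<alpha> n \<omega>) (Pair \<omega> -` E)"
proof -
  have EM: "E \<in> sets (M \<Otimes>\<^sub>M borel)"
  proof -
    have "sets (F n \<Otimes>\<^sub>M (borel :: 'a measure)) \<subseteq> sets (M \<Otimes>\<^sub>M borel)"
      by (rule sets_pair_in_sets) (auto intro: sets_F_in_sets)
    with E show ?thesis by blast
  qed
  have m': "(\<lambda>\<omega>. measure (\<alpha>' \<omega>) (Pair \<omega> -` E)) \<in> borel_measurable M"
    by (rule measurable_measure_kernel_section[OF limit_kernel EM])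
  have mF: "(\<lambda>\<omega>. measure (\<alpha> n \<omega>) (Pair \<omega> -` E)) \<in> borel_measurable (F n)"
    by (rule measurable_measure_kernel_section[OF predictive_kernel E])
  have m: "(\<lambda>\<omega>. measure (\<alpha> n \<omega>) (Pair \<omega> -` E)) \<in> borel_measurable M"
    using mF by (rule measurable_F_M)
  have i': "integrable M (\<lambda>\<omega>. measure (\<alpha>' \<omega>) (Pair \<omega> -` E))"
    using m' by (intro integrable_const_bound[where B=1]) (auto simp: prob_space.prob_le_1 prob_space_limit)
  have i: "integrable M (\<lambda>\<omega>. measure (\<alpha> n \<omega>) (Pair \<omega> -` E))"
    using m by (intro integrable_const_bound[where B=1]) (auto simp: prob_space.prob_le_1 prob_space_predictive)
  show ?thesis
  proof (rule ce.real_cond_exp_charact[OF _ i' i mF])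
    fix H assume H: "H \<in> sets (F n)"
    have [measurable]: "H \<in> sets M" using H by (rule sets_F_in_sets)
    have sec: "Pair \<omega> -` E \<in> sets borel" for \<omega> by (rule sets_Pair1[OF E])
    have eq: "ennreal (\<integral>\<omega>\<in>H. measure (\<kappa> \<omega>) (Pair \<omega> -` E) \<partial>M)
        = (\<integral>\<^sup>+\<omega>. \<integral>\<^sup>+x. indicator H \<omega> * indicator E (\<omega>, x) \<partial>\<kappa> \<omega> \<partial>M)"
      if \<kappa>: "\<And>\<omega>. \<omega> \<in> space M \<Longrightarrow> prob_space (\<kappa> \<omega>)" "\<And>\<omega>. \<omega> \<in> space M \<Longrightarrow> sets (\<kappa> \<omega>) = sets borel"
        and i: "integrable M (\<lambda>\<omega>. measure (\<kappa> \<omega>) (Pair \<omega> -` E))" for \<kappa>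
    proof -
      have "ennreal (\<integral>\<omega>\<in>H. measure (\<kappa> \<omega>) (Pair \<omega> -` E) \<partial>M)
          = (\<integral>\<^sup>+\<omega>. ennreal (indicator H \<omega> * measure (\<kappa> \<omega>) (Pair \<omega> -` E)) \<partial>M)"
        unfolding set_lebesgue_integral_def real_scaleR_def
        using integrable_mult_indicator[OF _ i, of H]
        by (intro nn_integral_eq_integral[symmetric]) auto
      also have "\<dots> = (\<integral>\<^sup>+\<omega>. \<integral>\<^sup>+x. indicator H \<omega> * indicator E (\<omega>, x) \<partial>\<kappa> \<omega> \<partial>M)"
      proof (rule nn_integral_cong)
        fix \<omega> assume w: "\<omega> \<in> space M"
        interpret p: prob_space "\<kappa> \<omega>" by (rule \<kappa>(1)[OF w])
        have [measurable]: "Pair \<omega> -` E \<in> sets (\<kappa> \<omega>)" using sec \<kappa>(2)[OF w] by simp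
        have "(\<integral>\<^sup>+x. indicator H \<omega> * indicator E (\<omega>, x) \<partial>\<kappa> \<omega>)
            = (\<integral>\<^sup>+x. indicator H \<omega> * indicator (Pair \<omega> -` E) x \<partial>\<kappa> \<omega>)"
          by (intro nn_integral_cong) (simp add: indicator_def)
        also have "\<dots> = ennreal (indicator H \<omega> * measure (\<kappa> \<omega>) (Pair \<omega> -` E))"
          by (simp add: nn_integral_cmult p.emeasure_eq_measure ennreal_mult'' ennreal_indicator)
        finally show "ennreal (indicator H \<omega> * measure (\<kappa> \<omega>) (Pair \<omega> -` E))
            = (\<integral>\<^sup>+x. indicator H \<omega> * indicator E (\<omega>, x) \<partial>\<kappa> \<omega>)" by simp
      qed
      finally show ?thesis .
    qed
    let ?f = "\<lambda>z. indicator H (fst z) * indicator E z :: ennreal"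
    have f: "?f \<in> borel_measurable (F n \<Otimes>\<^sub>M borel)" using E H by measurable
    \<comment> \<open>Both integrals equal the mean of
      \<open>?f (\<omega>, X n \<omega>)\<close>.\<close>
    have "ennreal (\<integral>\<omega>\<in>H. measure (\<alpha>' \<omega>) (Pair \<omega> -` E) \<partial>M) = ennreal (\<integral>\<omega>\<in>H. measure (\<alpha> n \<omega>) (Pair \<omega> -` E) \<partial>M)"
      using nn_integral_limit[OF f] nn_integral_predictive[OF f]
      by (simp add: eq[OF prob_space_limit sets_limit i'] eq[OF prob_space_predictive sets_predictive i])
    then show "(\<integral>\<omega>\<in>H. measure (\<alpha>' \<omega>) (Pair \<omega> -` E) \<partial>M) = (\<integral>\<omega>\<in>H. measure (\<alpha> n \<omega>) (Pair \<omega> -` E) \<partial>M)"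
      by (subst (asm) ennreal_inj) (auto simp: set_lebesgue_integral_def intro!: integral_nonneg_AE)
  qed
qed

end

section \<open>The continuous part of the limit\<close>

text \<open>Continuity from below extends the inequality from \<U> to all open sets. For Borel
  \<open>B\<close> choose an open \<open>U\<close> around \<open>B\<close> that is nearly optimal
  for \<sigma>; outer regularity is needed only of the dominating measure, since \<rho> is
  monotone.\<close>

lemma borel_measure_le_if_open_le:
  fixes \<rho> \<sigma> :: "'a::polish_space measure"
  assumes \<U>: "\<And>U. open U \<Longrightarrow> \<exists>A. incseq A \<and> range A \<subseteq> \<U> \<and> (\<Union>n. A n) = U" "\<And>U. U \<in> \<U> \<Longrightarrow> open U"
    and le: "\<And>U. U \<in> \<U> \<Longrightarrow> measure \<rho> U \<le> measure \<sigma> U + c"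
    and \<rho>: "finite_measure \<rho>" "sets \<rho> = sets borel"
    and \<sigma>: "finite_measure \<sigma>" "sets \<sigma> = sets borel"
    and B: "B \<in> sets borel"
  shows "measure \<rho> B \<le> measure \<sigma> B + c"
proof -
  interpret \<rho>: finite_measure \<rho> by fact
  interpret \<sigma>: finite_measure \<sigma> by fact
  have op: "measure \<rho> U \<le> measure \<sigma> U + c" if U: "open U" for U
  proof -
    obtain A where A: "incseq A" "range A \<subseteq> \<U>" "(\<Union>n. A n) = U" using \<U>(1)[OF U] by blast
    then have "open (A n)" for n using \<U>(2) by blast
    then have s: "range A \<subseteq> sets \<rho>" "range A \<subseteq> sets \<sigma>" by (auto simp: \<rho> \<sigma>)
    have "(\<lambda>n. measure \<rho> (A n)) \<longlonglongrightarrow> measure \<rho> U"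
      using \<rho>.finite_Lim_measure_incseq[OF s(1) A(1)] A(3) by simp
    moreover have "(\<lambda>n. measure \<sigma> (A n) + c) \<longlonglongrightarrow> measure \<sigma> U + c"
      using \<sigma>.finite_Lim_measure_incseq[OF s(2) A(1)] A(3) by (intro tendsto_add tendsto_const) simp
    ultimately show ?thesis
      by (rule LIMSEQ_le) (use A(2) le in blast)
  qed
  show ?thesis
  proof (rule field_le_epsilon)
    fix e :: real assume e: "e > 0"
    have "emeasure \<sigma> B = (INF U \<in> {U. B \<subseteq> U \<and> open U}. emeasure \<sigma> U)"
      using \<sigma> B by (intro outer_regular) simp_all
    moreover have "emeasure \<sigma> B < emeasure \<sigma> B + ennreal e"
      using e by (simp add: \<sigma>.emeasure_eq_measure ennreal_plus[symmetric] ennreal_less_iff del: ennreal_plus)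
    ultimately obtain U where U: "B \<subseteq> U" "open U" "emeasure \<sigma> U < emeasure \<sigma> B + ennreal e"
      by (auto simp: INF_less_iff)
    then have "measure \<sigma> U < measure \<sigma> B + e"
      using e by (simp add: \<sigma>.emeasure_eq_measure ennreal_plus[symmetric] ennreal_less_iff del: ennreal_plus)
    moreover have "measure \<rho> B \<le> measure \<rho> U"
      using U B by (intro \<rho>.finite_measure_mono) (auto simp: \<rho>)
    ultimately show "measure \<rho> B \<le> measure \<sigma> B + c + e"
      using op[OF U(2)] by linarith
  qed
qed

text \<open>Finite unions of members of a countable base: there are still only countably many, and
  the partial unions of an enumeration exhaust an open set increasingly.\<close>

lemma ex_countable_open_approximants:
  "\<exists>\<U> :: 'a::second_countable_topology set set. countable \<U> \<and> (\<forall>U\<in>\<U>. open U) \<and>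
    (\<forall>U. open U \<longrightarrow> (\<exists>A. incseq A \<and> range A \<subseteq> \<U> \<and> (\<Union>n. A n) = U))"
proof -
  obtain B :: "'a set set" where B: "countable B" "topological_basis B"
    using ex_countable_basis by blast
  define \<U> where "\<U> = Union ` {K. finite K \<and> K \<subseteq> B}"
  have "countable \<U>"
    unfolding \<U>_def using countable_Collect_finite_subset[OF B(1)] by simp
  moreover have "\<forall>U\<in>\<U>. open U"
    using topological_basis_open[OF B(2)] by (auto simp: \<U>_def)
  moreover have "\<exists>A. incseq A \<and> range A \<subseteq> \<U> \<and> (\<Union>n. A n) = U" if "open U" for U
  proof -
    have "\<exists>B'\<subseteq>B. \<Union>B' = U"
      using B(2)[unfolded topological_basis_def, THEN conjunct2, rule_format, OF that] .
    then obtain B' where B': "B' \<subseteq> B" "\<Union>B' = U" by (elim exE conjE)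
    show ?thesis
    proof (cases "B' = {}")
      case True
      have "{} \<in> \<U>" unfolding \<U>_def by (rule image_eqI[of _ _ "{}"]) auto
      with True B' show ?thesis by (intro exI[of _ "\<lambda>_. {}"]) (auto simp: incseq_def)
    next
      case False
      have c: "countable B'" using B'(1) B(1) by (rule countable_subset)
      have r: "range (from_nat_into B') = B'" by (rule range_from_nat_into[OF False c])
      define A where "A n = \<Union>(from_nat_into B' ` {..n})" for n
      have "incseq A" unfolding A_def incseq_def
        by (intro allI impI Union_mono image_mono) simp
      moreover have "range A \<subseteq> \<U>"
      proof safe
        fix n show "A n \<in> \<U>" unfolding A_def \<U>_def
          by (intro imageI CollectI conjI) (use r B'(1) in auto)
      qed
      moreover have "(\<Union>n. A n) = U"
      proof -
        have "(\<Union>n. A n) = \<Union>(range (from_nat_into B'))" by (auto simp: A_def)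
        then show ?thesis using r B'(2) by simp
      qed
      ultimately show ?thesis by (intro exI[of _ A] conjI)
    qed
  qed
  ultimately show ?thesis by (intro exI[of _ \<U>] conjI) simp_all
qed

text \<open>Finitely many atoms carry all but \<open>d / 2\<close> of the atomic mass, and on
  finitely many points pointwise convergence is uniform. This gives one threshold for
  \<open>n\<close> valid for every \<open>B\<close>.\<close>

lemma eventually_atoms_lower_bound:
  fixes \<nu> :: "'a::t1_space measure"
  assumes "prob_space \<nu>" "sets \<nu> = sets borel" "\<And>n. prob_space (\<mu> n)" "\<And>n. sets (\<mu> n) = sets borel"
    and conv: "\<And>x. (\<lambda>n. measure (\<mu> n) {x}) \<longlonglongrightarrow> measure \<nu> {x}"
    and d: "d > 0"
  shows "eventually (\<lambda>n. \<forall>B\<in>sets borel. measure \<nu> (B \<inter> {x. measure \<nu> {x} \<noteq> 0})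
      \<le> measure (\<mu> n) (B \<inter> {x. measure \<nu> {x} \<noteq> 0}) + d) sequentially"
proof -
  interpret \<nu>: prob_space \<nu> by fact
  let ?D = "{x. measure \<nu> {x} \<noteq> 0}"
  have D: "countable ?D" by (rule \<nu>.countable_support)
  have cs: "A \<in> sets borel" if "countable A" for A :: "'a set"
    using that by (rule sets.countable[rotated]) simp
  obtain D' where D': "finite D'" "D' \<subseteq> ?D" "measure \<nu> (?D - D') < d / 2"
  proof (cases "?D = {}")
    case True
    show ?thesis by (rule that[of "{}"]) (use True d in auto)
  next
    case False
    define A where "A n = from_nat_into ?D ` {..n}" for n :: nat
    have r: "range (from_nat_into ?D) = ?D" by (rule range_from_nat_into[OF False D])
    have sub: "A n \<subseteq> ?D" for n using r by (auto simp: A_def)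
    have sA: "range A \<subseteq> sets \<nu>"
      by (auto simp: assms(2) A_def intro!: cs countable_finite)
    have "incseq A" by (auto simp: A_def incseq_def)
    moreover have "(\<Union>n. A n) = ?D"
    proof -
      have "(\<Union>n. A n) = range (from_nat_into ?D)" by (auto simp: A_def)
      then show ?thesis using r by simp
    qed
    ultimately have "(\<lambda>n. measure \<nu> (A n)) \<longlonglongrightarrow> measure \<nu> ?D"
      using \<nu>.finite_Lim_measure_incseq[OF sA] by simp
    then have "eventually (\<lambda>n. measure \<nu> ?D - d / 2 < measure \<nu> (A n)) sequentially"
      using d by (intro order_tendstoD) auto
    then obtain n where n: "measure \<nu> ?D - d / 2 < measure \<nu> (A n)"
      by (auto simp: eventually_sequentially)
    have "measure \<nu> (?D - A n) = measure \<nu> ?D - measure \<nu> (A n)"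
      using sA D by (intro \<nu>.finite_measure_Diff sub) (auto simp: assms(2) intro: cs)
    then show ?thesis
      using n sub by (intro that[of "A n"]) (auto simp: A_def)
  qed
  \<comment> \<open>At most \<open>card D'\<close> errors of size \<open>c\<close> then sum to at
    most \<open>d / 2\<close>. The summand 1 covers an empty \<open>D'\<close>.\<close>
  define c where "c = d / (2 * (real (card D') + 1))"
  have c: "c > 0" using d by (simp add: c_def)
  have "eventually (\<lambda>n. \<forall>x\<in>D'. measure \<nu> {x} - c < measure (\<mu> n) {x}) sequentially"
    using D'(1) c by (intro eventually_ball_finite ballI order_tendstoD(1)[OF conv]) auto
  then show ?thesis
  proof eventually_elim
    case (elim n)
    interpret \<mu>: prob_space "\<mu> n" by fact
    show ?case
    proof
      fix B :: "'a set" assume B: "B \<in> sets borel"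
      have fin: "finite (B \<inter> D')" using D' by simp
      have s: "?D \<in> sets borel" "D' \<in> sets borel" using D D' by (auto intro: cs countable_finite)
      have "measure \<nu> (B \<inter> ?D) \<le> measure \<nu> ((B \<inter> D') \<union> (?D - D'))"
        using B s by (intro \<nu>.finite_measure_mono) (auto simp: assms(2))
      also have "\<dots> \<le> measure \<nu> (B \<inter> D') + measure \<nu> (?D - D')"
        using B s by (intro measure_Un_le) (auto simp: assms(2))
      also have "\<dots> \<le> measure \<nu> (B \<inter> D') + d / 2" using D'(3) by simp
      also have "measure \<nu> (B \<inter> D') = (\<Sum>x\<in>B \<inter> D'. measure \<nu> {x})"
        using fin by (intro \<nu>.finite_measure_eq_sum_singleton) (auto simp: assms(2))
      also have "\<dots> \<le> (\<Sum>x\<in>B \<inter> D'. measure (\<mu> n) {x} + c)"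
      proof (rule sum_mono)
        fix x assume "x \<in> B \<inter> D'"
        then show "measure \<nu> {x} \<le> measure (\<mu> n) {x} + c" using elim by force
      qed
      also have "\<dots> = measure (\<mu> n) (B \<inter> D') + real (card (B \<inter> D')) * c"
        using fin by (subst \<mu>.finite_measure_eq_sum_singleton) (auto simp: assms(4) sum.distrib)
      also have "real (card (B \<inter> D')) * c \<le> (real (card D') + 1) * c"
        using card_mono[OF D'(1), of "B \<inter> D'"] c by (intro mult_right_mono) auto
      also have "(real (card D') + 1) * c = d / 2" by (simp add: c_def field_simps)
      also have "measure (\<mu> n) (B \<inter> D') \<le> measure (\<mu> n) (B \<inter> ?D)"
        using B s D'(2) by (intro \<mu>.finite_measure_mono) (auto simp: assms(4))
      finally show "measure \<nu> (B \<inter> ?D) \<le> measure (\<mu> n) (B \<inter> ?D) + d" by simp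
    qed
  qed
qed

text \<open>The singleton \<open>{snd z}\<close> is a section of the diagonal, which is measurable
  in the product because the space is second countable and Hausdorff.\<close>

lemma measurable_atom:
  fixes \<kappa> :: "'b \<Rightarrow> 'a::{second_countable_topology, t2_space} measure"
  assumes \<kappa>: "\<kappa> \<in> N \<rightarrow>\<^sub>M prob_algebra borel"
  shows "(\<lambda>z. measure (\<kappa> (fst z)) {snd z}) \<in> borel_measurable (N \<Otimes>\<^sub>M borel)"
proof (rule measure_measurable_prob_algebra2)
  show "(\<lambda>z. \<kappa> (fst z)) \<in> N \<Otimes>\<^sub>M (borel :: 'a measure) \<rightarrow>\<^sub>M prob_algebra borel"
    using \<kappa> by (rule measurable_compose[OF measurable_fst])
  have "(SIGMA z:space (N \<Otimes>\<^sub>M (borel :: 'a measure)). {snd z})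
      = {w \<in> space ((N \<Otimes>\<^sub>M borel) \<Otimes>\<^sub>M borel). snd w = snd (fst w)}"
    by (auto simp: space_pair_measure)
  also have "\<dots> \<in> sets ((N \<Otimes>\<^sub>M (borel :: 'a measure)) \<Otimes>\<^sub>M borel)"
    by measurable
  finally show "(SIGMA z:space (N \<Otimes>\<^sub>M (borel :: 'a measure)). {snd z}) \<in> sets ((N \<Otimes>\<^sub>M borel) \<Otimes>\<^sub>M borel)" .
qed

context cid_sequence
begin

abbreviation "non_atoms \<omega> \<equiv> {x. measure (\<alpha>' \<omega>) {x} = 0}"

lemma non_atoms_borel: "\<omega> \<in> space M \<Longrightarrow> non_atoms \<omega> \<in> sets borel"
proof -
  assume w: "\<omega> \<in> space M"
  have "{z \<in> space (M \<Otimes>\<^sub>M borel). measure (\<alpha>' (fst z)) {snd z} = 0} \<in> sets (M \<Otimes>\<^sub>M borel)"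
    using measurable_atom[OF limit_kernel] by measurable
  from sets_Pair1[OF this, of \<omega>] show ?thesis
    using w by (simp add: space_pair_measure vimage_def)
qed

text \<open>On a set free of atoms the discrete part vanishes, so there
  \<open>\<alpha>' \<omega>\<close> coincides with its continuous part. From here on the restriction
  of \<open>\<alpha>' \<omega>\<close> to \<open>non_atoms \<omega>\<close> stands in for
  \<open>continuous_part\<close>.\<close>

lemma null_non_atoms:
  assumes w: "\<omega> \<in> space M" and ac: "absolutely_continuous L (continuous_part (\<alpha>' \<omega>))"
    and sL: "sets L = sets borel"
    and B: "B \<in> null_sets L" "B \<subseteq> non_atoms \<omega>"
  shows "emeasure (\<alpha>' \<omega>) B = 0"
proof -
  interpret p: prob_space "\<alpha>' \<omega>" by (rule prob_space_limit[OF w])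
  have Bb: "B \<in> sets borel" using B(1) sL by auto
  have "B \<in> null_sets (continuous_part (\<alpha>' \<omega>))" using ac B(1) by (auto simp: absolutely_continuous_def)
  then have "emeasure (\<alpha>' \<omega>) B - emeasure (discrete_part (\<alpha>' \<omega>)) B = 0"
    using emeasure_continuous_part[OF prob_space_limit[OF w] sets_limit[OF w] Bb] by auto
  moreover have "emeasure (discrete_part (\<alpha>' \<omega>)) B = (\<integral>\<^sup>+x. emeasure (\<alpha>' \<omega>) {x} \<partial>count_space B)"
    using Bb by (intro emeasure_discrete_part) (simp add: sets_limit[OF w])
  moreover have "\<dots> = (\<integral>\<^sup>+x. 0 \<partial>count_space B)"
    using B(2) by (intro nn_integral_cong) (auto simp: p.emeasure_eq_measure)
  ultimately show ?thesis by simp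
qed

abbreviation "restr_G \<equiv> restr_to_subalg M G"

lemma sets_restr_G [measurable_cong]: "sets restr_G = sets G"
  by (rule sets_restr_to_subalg[OF subalgebra_G])

lemma space_restr_G: "space restr_G = space M"
  by (rule space_restr_to_subalg)

lemma limit_kernel_restr_G: "\<alpha>' \<in> restr_G \<rightarrow>\<^sub>M prob_algebra borel"
  using limit_kernel_G by (rule measurable_in_subalg[OF subalgebra_G])

text \<open>Densities chosen separately for each \<open>\<omega>\<close> would not be jointly
  measurable, so Radon-Nikodym is applied once on the product space. Working over
  \<open>restr_G\<close> keeps \<open>f\<close> within reach of the approximation along the
  filtration. The null set in the last conclusion depends on \<open>U\<close>.\<close>

lemma continuous_part_density:
  assumes L: "finite_measure L" and sL: "sets L = sets borel"
    and ac: "AE \<omega> in M. absolutely_continuous L (continuous_part (\<alpha>' \<omega>))"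
  obtains f :: "'w \<times> 'a \<Rightarrow> real" where
    "integrable (restr_G \<Otimes>\<^sub>M L) f" "\<And>z. 0 \<le> f z"
    "\<And>U. U \<in> sets borel \<Longrightarrow>
      AE \<omega> in M. measure (\<alpha>' \<omega>) (U \<inter> non_atoms \<omega>) = (\<integral>x. indicator U x * f (\<omega>, x) \<partial>L)"
proof -
  interpret L: finite_measure L by fact
  let ?N = restr_G
  interpret N: prob_space ?N by (rule prob_space_restr_to_subalg[OF subalgebra_G prob_space_axioms])
  interpret NL: pair_sigma_finite ?N L ..
  let ?Q = "?N \<Otimes>\<^sub>M L" and ?K = "kernel_prod ?N borel \<alpha>'"
  interpret Q: finite_measure ?Q by (rule finite_measure_pair_measure[OF L N.finite_measure_axioms])
  note \<kappa> = limit_kernel_restr_G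
  have sNL: "sets ?Q = sets (?N \<Otimes>\<^sub>M (borel :: 'a measure))"
    by (rule sets_pair_measure_cong) (simp_all add: sL)
  have sK: "sets ?K = sets ?Q" by (simp add: sets_kernel_prod[OF \<kappa> N.not_empty] sNL)
  define C where "C = {z \<in> space (?N \<Otimes>\<^sub>M borel). measure (\<alpha>' (fst z)) {snd z} = 0}"
  have C: "C \<in> sets (?N \<Otimes>\<^sub>M borel)"
    unfolding C_def using measurable_atom[OF \<kappa>] by measurable
  then have CK: "C \<in> sets ?K" using sK sNL by simp
  have secC: "Pair \<omega> -` C = non_atoms \<omega>" if "\<omega> \<in> space M" for \<omega>
    using that by (auto simp: C_def space_pair_measure space_restr_G)
  \<comment> \<open>The joint law of \<open>\<omega>\<close> and a draw from
    \<open>\<alpha>' \<omega>\<close>, restricted to draws that are not atoms.\<close>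
  define \<mu> where "\<mu> = density ?K (indicator C)"
  have s\<mu>: "sets \<mu> = sets ?Q" by (simp add: \<mu>_def sK)
  have e\<mu>: "emeasure \<mu> E = (\<integral>\<^sup>+\<omega>. emeasure (\<alpha>' \<omega>) (Pair \<omega> -` E \<inter> non_atoms \<omega>) \<partial>?N)"
    if E: "E \<in> sets ?Q" for E
  proof -
    have "emeasure \<mu> E = (\<integral>\<^sup>+z. indicator (C \<inter> E) z \<partial>?K)"
    proof -
      have "emeasure \<mu> E = (\<integral>\<^sup>+z. indicator C z * indicator E z \<partial>?K)"
        unfolding \<mu>_def using CK E sK by (intro emeasure_density) auto
      then show ?thesis by (simp only: indicator_inter_arith)
    qed
    also have "\<dots> = emeasure ?K (C \<inter> E)"
      using CK E sK by (intro nn_integral_indicator) auto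
    also have "\<dots> = (\<integral>\<^sup>+\<omega>. emeasure (\<alpha>' \<omega>) (Pair \<omega> -` (C \<inter> E)) \<partial>?N)"
      using C E sNL by (intro emeasure_kernel_prod[OF \<kappa> N.not_empty]) auto
    also have "\<dots> = (\<integral>\<^sup>+\<omega>. emeasure (\<alpha>' \<omega>) (Pair \<omega> -` E \<inter> non_atoms \<omega>) \<partial>?N)"
      by (intro nn_integral_cong) (simp add: secC space_restr_G Int_commute)
    finally show ?thesis .
  qed
  \<comment> \<open>By Fubini almost every section of a null set is \<open>L\<close>-null, and such
    a section has no non-atomic mass under \<open>\<alpha>' \<omega>\<close>.\<close>
  have acQ: "absolutely_continuous ?Q \<mu>"
    unfolding absolutely_continuous_def
  proof
    fix E assume E: "E \<in> null_sets ?Q"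
    then have Es: "E \<in> sets ?Q" by auto
    have "(\<integral>\<^sup>+\<omega>. emeasure L (Pair \<omega> -` E) \<partial>?N) = 0"
      using E L.emeasure_pair_measure_alt[OF Es] by auto
    then have "AE \<omega> in ?N. emeasure L (Pair \<omega> -` E) = 0"
      using L.measurable_emeasure_Pair[OF Es] by (simp add: nn_integral_0_iff_AE)
    then have "AE \<omega> in M. emeasure L (Pair \<omega> -` E) = 0" by (rule AE_restr_to_subalg[OF subalgebra_G])
    with ac AE_space have "AE \<omega> in M. emeasure (\<alpha>' \<omega>) (Pair \<omega> -` E \<inter> non_atoms \<omega>) = 0"
    proof eventually_elim
      case (elim \<omega>)
      have "Pair \<omega> -` E \<in> null_sets L" using elim Es by (auto intro: sets_Pair1)
      moreover have "non_atoms \<omega> \<in> sets L" using non_atoms_borel elim sL by simp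
      ultimately have "Pair \<omega> -` E \<inter> non_atoms \<omega> \<in> null_sets L" by (rule null_set_Int2)
      then show ?case by (rule null_non_atoms[OF elim(2,1) sL]) simp
    qed
    moreover have "(\<lambda>\<omega>. emeasure (\<alpha>' \<omega>) (Pair \<omega> -` E \<inter> non_atoms \<omega>)) \<in> borel_measurable G"
    proof -
      have "(\<lambda>\<omega>. emeasure (\<alpha>' \<omega>) (Pair \<omega> -` (E \<inter> C))) \<in> borel_measurable ?N"
      proof (rule emeasure_measurable_subprob_algebra2[OF _ measurable_prob_algebraD[OF \<kappa>]])
        have "E \<inter> C \<in> sets (?N \<Otimes>\<^sub>M borel)" using Es C sNL by auto
        moreover have "(SIGMA \<omega>:space ?N. Pair \<omega> -` (E \<inter> C)) = E \<inter> C"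
          using sets.sets_into_space[OF C] by (auto simp: space_pair_measure)
        ultimately show "(SIGMA \<omega>:space ?N. Pair \<omega> -` (E \<inter> C)) \<in> sets (?N \<Otimes>\<^sub>M borel)" by simp
      qed
      also have "?this \<longleftrightarrow> (\<lambda>\<omega>. emeasure (\<alpha>' \<omega>) (Pair \<omega> -` E \<inter> non_atoms \<omega>)) \<in> borel_measurable ?N"
        by (intro measurable_cong) (simp add: secC space_restr_G)
      finally show ?thesis by (rule measurable_in_subalg'[OF subalgebra_G])
    qed
    ultimately have "emeasure \<mu> E = 0"
      unfolding e\<mu>[OF Es] by (simp add: nn_integral_subalgebra2[OF subalgebra_G] nn_integral_0_iff_AE
          measurable_from_subalg[OF subalgebra_G])
    then show "E \<in> null_sets \<mu>" using Es s\<mu> by auto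
  qed
  obtain h where h[measurable]: "h \<in> borel_measurable ?Q" and dh: "density ?Q h = \<mu>"
    using NL.P.Radon_Nikodym[OF acQ s\<mu>] by blast
  have "(\<integral>\<^sup>+z. h z \<partial>?Q) = emeasure \<mu> (space ?Q)"
    unfolding dh[symmetric] by (simp add: emeasure_density cong: nn_integral_cong)
  also have "\<dots> \<le> (\<integral>\<^sup>+\<omega>. 1 \<partial>?N)"
    unfolding e\<mu>[OF sets.top]
    by (intro nn_integral_mono)
      (auto simp: space_restr_G intro!: prob_space.emeasure_le_1 prob_space_limit)
  also have "\<dots> = 1" by (simp add: N.emeasure_space_1)
  finally have hfin: "(\<integral>\<^sup>+z. h z \<partial>?Q) \<le> 1" .
  \<comment> \<open>\<open>enn2real\<close> sends infinity to 0, which changes \<open>h\<close> only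
    on a null set because its integral is at most 1.\<close>
  define f where "f z = enn2real (h z)" for z
  have f[measurable]: "f \<in> borel_measurable ?Q" unfolding f_def by measurable
  have "AE z in ?Q. h z \<noteq> \<infinity>"
    using hfin by (intro nn_integral_PInf_AE h) (auto simp: top_unique)
  then have hf: "AE z in ?Q. h z = ennreal (f z)"
    by eventually_elim (simp add: f_def less_top)
  have df: "density ?Q (\<lambda>z. ennreal (f z)) = \<mu>"
    unfolding dh[symmetric] using hf by (intro density_cong) auto
  have "(\<integral>\<^sup>+z. ennreal (f z) \<partial>?Q) = (\<integral>\<^sup>+z. h z \<partial>?Q)"
    using hf by (intro nn_integral_cong_AE) auto
  then have fi: "integrable ?Q f"
    using hfin by (intro integrableI_nonneg) (auto simp: f_def le_less_trans)
  moreover have "0 \<le> f z" for z by (simp add: f_def)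
  moreover have "AE \<omega> in M. measure (\<alpha>' \<omega>) (U \<inter> non_atoms \<omega>) = (\<integral>x. indicator U x * f (\<omega>, x) \<partial>L)"
    if U[measurable]: "U \<in> sets borel" for U
  proof -
    have UL[measurable]: "U \<in> sets L" using sL by simp
    define a where "a \<omega> = emeasure (\<alpha>' \<omega>) (Pair \<omega> -` ((space M \<times> U) \<inter> C))" for \<omega>
    define b where "b \<omega> = (\<integral>\<^sup>+x. ennreal (f (\<omega>, x)) * indicator U x \<partial>L)" for \<omega>
    have a_eq: "a \<omega> = emeasure (\<alpha>' \<omega>) (U \<inter> non_atoms \<omega>)" if "\<omega> \<in> space M" for \<omega>
      using that secC by (auto simp: a_def)
    have top: "space M \<in> sets ?N" using sets.top[of ?N] by (simp add: space_restr_G)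
    have a[measurable]: "a \<in> borel_measurable ?N"
      unfolding a_def
    proof (rule emeasure_measurable_subprob_algebra2[OF _ measurable_prob_algebraD[OF \<kappa>]])
      have "(space M \<times> U) \<inter> C \<in> sets (?N \<Otimes>\<^sub>M borel)" using C top by auto
      moreover have "(SIGMA \<omega>:space ?N. Pair \<omega> -` ((space M \<times> U) \<inter> C)) = (space M \<times> U) \<inter> C"
        by (auto simp: space_restr_G)
      ultimately show "(SIGMA \<omega>:space ?N. Pair \<omega> -` ((space M \<times> U) \<inter> C)) \<in> sets (?N \<Otimes>\<^sub>M borel)" by simp
    qed
    have b[measurable]: "b \<in> borel_measurable ?N" unfolding b_def by measurable
    \<comment> \<open>Two \<open>G\<close>-measurable functions with the same integral over every
      event of \<open>G\<close> agree almost everywhere, provided the integrals are finite;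
      rectangles \<open>H \<times> U\<close> supply these integrals.\<close>
    have "density ?N a = density ?N b"
    proof (rule measure_eqI)
      fix H assume "H \<in> sets (density ?N a)"
      then have H[measurable]: "H \<in> sets ?N" by simp
      have HU: "H \<times> U \<in> sets ?Q" by simp
      have "emeasure (density ?N a) H = (\<integral>\<^sup>+\<omega>. a \<omega> * indicator H \<omega> \<partial>?N)"
        by (simp add: emeasure_density)
      also have "\<dots> = emeasure \<mu> (H \<times> U)"
        unfolding e\<mu>[OF HU] by (intro nn_integral_cong) (simp add: a_eq space_restr_G indicator_def)
      also have "\<dots> = (\<integral>\<^sup>+z. ennreal (f z) * indicator (H \<times> U) z \<partial>?Q)"
        unfolding df[symmetric] using HU by (simp add: emeasure_density)
      also have "\<dots> = (\<integral>\<^sup>+\<omega>. \<integral>\<^sup>+x. ennreal (f (\<omega>, x)) * indicator (H \<times> U) (\<omega>, x) \<partial>L \<partial>?N)"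
        by (rule L.nn_integral_fst[symmetric]) simp
      also have "\<dots> = (\<integral>\<^sup>+\<omega>. b \<omega> * indicator H \<omega> \<partial>?N)"
        unfolding b_def by (intro nn_integral_cong) (simp add: indicator_def)
      finally show "emeasure (density ?N a) H = emeasure (density ?N b) H"
        by (simp add: emeasure_density)
    qed simp
    moreover have "(\<integral>\<^sup>+\<omega>. a \<omega> \<partial>?N) \<le> (\<integral>\<^sup>+\<omega>. 1 \<partial>?N)"
      by (intro nn_integral_mono)
        (auto simp: a_def space_restr_G intro!: prob_space.emeasure_le_1 prob_space_limit)
    then have "(\<integral>\<^sup>+\<omega>. a \<omega> \<partial>?N) \<noteq> \<infinity>"
      by (auto simp: N.emeasure_space_1 top_unique)
    ultimately have "AE \<omega> in ?N. a \<omega> = b \<omega>"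
      using finite_density_unique[OF a b] by simp
    then have "AE \<omega> in M. a \<omega> = b \<omega>" by (rule AE_restr_to_subalg[OF subalgebra_G])
    moreover have "AE \<omega> in M. integrable L (\<lambda>x. f (\<omega>, x))"
      using NL.AE_integrable_fst'[OF fi] by (rule AE_restr_to_subalg[OF subalgebra_G])
    ultimately show ?thesis
      using AE_space
    proof eventually_elim
      case (elim \<omega>)
      interpret p: prob_space "\<alpha>' \<omega>" by (rule prob_space_limit[OF elim(3)])
      have i: "integrable L (\<lambda>x. indicator U x * f (\<omega>, x))"
        using integrable_mult_indicator[OF UL elim(2)] by simp
      have "b \<omega> = (\<integral>\<^sup>+x. ennreal (indicator U x * f (\<omega>, x)) \<partial>L)"
        unfolding b_def by (intro nn_integral_cong) (simp add: indicator_def)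
      also have "\<dots> = ennreal (\<integral>x. indicator U x * f (\<omega>, x) \<partial>L)"
        using i by (intro nn_integral_eq_integral) (auto simp: f_def)
      finally have "ennreal (measure (\<alpha>' \<omega>) (U \<inter> non_atoms \<omega>)) = ennreal (\<integral>x. indicator U x * f (\<omega>, x) \<partial>L)"
        using elim a_eq by (simp add: p.emeasure_eq_measure)
      then show ?case
        by (subst (asm) ennreal_inj) (auto simp: f_def intro!: integral_nonneg_AE)
    qed
  qed
  ultimately show ?thesis by (rule that)
qed

end

section \<open>Total variation from one-sided bounds\<close>

text \<open>Applied to the complement of \<open>B\<close>, the one-sided bound becomes the opposite
  inequality, since both total masses are 1.\<close>

lemma tv_dist_le:
  fixes \<mu> \<nu> :: "'a::topological_space measure"
  assumes \<mu>: "prob_space \<mu>" "sets \<mu> = sets borel" and \<nu>: "prob_space \<nu>" "sets \<nu> = sets borel"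
    and le: "\<And>B. B \<in> sets borel \<Longrightarrow> measure \<nu> B \<le> measure \<mu> B + c"
  shows "tv_dist \<mu> \<nu> \<le> c"
  unfolding tv_dist_def
proof (rule cSUP_least)
  interpret \<mu>: prob_space \<mu> by fact
  interpret \<nu>: prob_space \<nu> by fact
  fix B :: "'a set" assume B: "B \<in> sets borel"
  have "space \<mu> = UNIV" "space \<nu> = UNIV"
    using sets_eq_imp_space_eq[OF \<mu>(2)] sets_eq_imp_space_eq[OF \<nu>(2)] by simp_all
  then have "measure \<mu> (UNIV - B) = 1 - measure \<mu> B" "measure \<nu> (UNIV - B) = 1 - measure \<nu> B"
    using \<mu>.prob_compl[of B] \<nu>.prob_compl[of B] B by (simp_all add: \<mu>(2) \<nu>(2))
  moreover have "UNIV - B \<in> sets borel" using B by (simp add: Compl_eq_Diff_UNIV[symmetric])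
  ultimately show "\<bar>measure \<mu> B - measure \<nu> B\<bar> \<le> c"
    using le[OF B] le[of "UNIV - B"] by linarith
qed auto

lemma measure_density_real:
  assumes i: "integrable L f" and nn: "\<And>x. 0 \<le> f x" and B: "B \<in> sets L"
  shows "finite_measure (density L (\<lambda>x. ennreal (f x)))"
    and "measure (density L (\<lambda>x. ennreal (f x))) B = (\<integral>x. indicator B x * f x \<partial>L)"
proof -
  have fm[measurable]: "f \<in> borel_measurable L" using i by auto
  have "(\<integral>\<^sup>+x. ennreal (f x) \<partial>L) \<noteq> \<infinity>"
    using nn by (subst nn_integral_eq_integral[OF i]) auto
  then show "finite_measure (density L (\<lambda>x. ennreal (f x)))"
    by (intro finite_measureI) (simp add: emeasure_density cong: nn_integral_cong)
  have "emeasure (density L (\<lambda>x. ennreal (f x))) B = (\<integral>\<^sup>+x. ennreal (indicator B x * f x) \<partial>L)"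
    using B by (auto simp: emeasure_density indicator_def intro!: nn_integral_cong)
  also have "\<dots> = ennreal (\<integral>x. indicator B x * f x \<partial>L)"
    using integrable_mult_indicator[OF B i] nn by (intro nn_integral_eq_integral) auto
  finally show "measure (density L (\<lambda>x. ennreal (f x))) B = (\<integral>x. indicator B x * f x \<partial>L)"
    using nn by (simp add: measure_def integral_nonneg_AE)
qed

context cid_sequence
begin

text \<open>The product filtration generates the product \<sigma>-algebra: for fixed
  \<open>b\<close>, the sets \<open>a\<close> with \<open>a \<times> b\<close> generated are closed
  under complements and countable unions. This is the hypothesis under which \<open>f\<close> can be
  approximated.\<close>

lemma sets_restr_G_pair:
  "sets (restr_G \<Otimes>\<^sub>M L) = sigma_sets (space (restr_G \<Otimes>\<^sub>M L)) (\<Union>n. sets (F n \<Otimes>\<^sub>M L))"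
proof -
  let ?Q = "restr_G \<Otimes>\<^sub>M L" and ?A = "\<Union>n. sets (F n \<Otimes>\<^sub>M L)"
  have sp: "space (F n \<Otimes>\<^sub>M L) = space ?Q" for n
    by (simp add: space_pair_measure space_F space_restr_G)
  have A: "?A \<subseteq> Pow (space ?Q)"
    using sets.sets_into_space[of _ "F _ \<Otimes>\<^sub>M L"] sp by auto
  have FQ: "sets (F n \<Otimes>\<^sub>M L) \<subseteq> sets ?Q" for n
    by (rule sets_pair_in_sets) (use subalgebra_G_F in \<open>auto simp: subalgebra_def sets_restr_G\<close>)
  define S where "S = sigma (space ?Q) ?A"
  have sS: "sets S = sigma_sets (space ?Q) ?A" unfolding S_def using A by (rule sets_measure_of)
  have spS: "space S = space ?Q" unfolding S_def using A by (rule space_measure_of)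
  have rect: "a \<times> b \<in> sets S" if "a \<in> sigma_sets (space M) (\<Union>n. sets (F n))" and b: "b \<in> sets L" for a b
    using that(1)
  proof induction
    case (Basic a)
    then show ?case unfolding sS using b by (intro sigma_sets.Basic) auto
  next
    case Empty
    show ?case by simp
  next
    case (Compl a)
    have "space M \<times> b \<in> sets S"
      unfolding sS using b sets.top[of "F 0"] by (intro sigma_sets.Basic) (auto simp: space_F)
    moreover have "(space M - a) \<times> b = space M \<times> b - a \<times> b" by auto
    ultimately show ?case using Compl by auto
  next
    case (Union a)
    have "(\<Union>i. a i) \<times> b = (\<Union>i. a i \<times> b)" by auto
    then show ?case using Union by auto
  qed
  have "sets ?Q \<subseteq> sets S"
    by (rule sets_pair_in_sets) (use rect in \<open>simp add: sets_restr_G sets_G\<close>)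
  moreover have "sets S \<subseteq> sets ?Q"
    unfolding sS using FQ by (intro sets.sigma_sets_subset) auto
  ultimately show ?thesis using sS by auto
qed

lemma measure_Int_non_atoms_le:
  assumes w: "\<omega> \<in> space M" and "U \<in> sets borel"
  shows "measure (\<alpha>' \<omega>) (U \<inter> non_atoms \<omega>) \<le> measure (\<alpha>' \<omega>) U"
proof -
  interpret p: prob_space "\<alpha>' \<omega>" by (rule prob_space_limit[OF w])
  show ?thesis using assms by (intro p.finite_measure_mono) (auto simp: sets_limit)
qed

text \<open>Finiteness of \<open>L\<close> makes the product measure finite and the bounded function
  \<open>g\<close> integrable. On \<open>B \<inter> non_atoms \<omega>\<close> the chain runs from
  \<open>\<alpha>'\<close> to \<open>f\<close> to \<open>g\<close> to \<open>\<alpha> n\<close>,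
  costing \<open>W\<close> and then \<open>E(W | F n)\<close>; on the atoms the cost is
  \<open>d\<close>.\<close>

lemma AE_tv_dist_tendsto_0:
  assumes L: "finite_measure L" and sL: "sets L = sets borel"
    and ac: "AE \<omega> in M. absolutely_continuous L (continuous_part (\<alpha>' \<omega>))"
    and atoms: "AE \<omega> in M. \<forall>x. (\<lambda>n. measure (\<alpha> n \<omega>) {x}) \<longlonglongrightarrow> measure (\<alpha>' \<omega>) {x}"
  shows "AE \<omega> in M. \<forall>d>0. eventually (\<lambda>n. tv_dist (\<alpha> n \<omega>) (\<alpha>' \<omega>) \<le> d) sequentially"
proof (rule AE_eventually_small)
  fix e :: real assume e: "e > 0"
  interpret L: finite_measure L by fact
  let ?N = restr_G
  interpret N: prob_space ?N by (rule prob_space_restr_to_subalg[OF subalgebra_G prob_space_axioms])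
  interpret NL: pair_sigma_finite ?N L ..
  let ?Q = "?N \<Otimes>\<^sub>M L"
  interpret Q: finite_measure ?Q by (rule finite_measure_pair_measure[OF L N.finite_measure_axioms])
  obtain f where fi: "integrable ?Q f" and f0: "\<And>z. 0 \<le> f z"
    and fU: "\<And>U. U \<in> sets borel \<Longrightarrow>
      AE \<omega> in M. measure (\<alpha>' \<omega>) (U \<inter> non_atoms \<omega>) = (\<integral>x. indicator U x * f (\<omega>, x) \<partial>L)"
    by (rule continuous_part_density[OF L sL ac]) (rule that; assumption)
  interpret QF: filtered_finite_measure ?Q "\<lambda>n. F n \<Otimes>\<^sub>M L"
  proof unfold_locales
    show "subalgebra ?Q (F n \<Otimes>\<^sub>M L)" for n
      unfolding subalgebra_def sets_restr_G_pair by (auto simp: space_pair_measure space_F space_restr_G)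
    show "sets (F m \<Otimes>\<^sub>M L) \<subseteq> sets (F n \<Otimes>\<^sub>M L)" if "m \<le> n" for m n
      by (rule sets_pair_in_sets) (use sets_F_mono[OF that] in auto)
  qed
  obtain m g0 K where g0: "g0 \<in> borel_measurable (F m \<Otimes>\<^sub>M L)" "\<And>z. \<bar>g0 z\<bar> \<le> K"
    "(\<integral>z. \<bar>f z - g0 z\<bar> \<partial>?Q) < e"
    using QF.approx_integrable[OF sets_restr_G_pair fi e] by (elim exE bexE conjE) blast
  \<comment> \<open>As \<open>f\<close> is nonnegative, truncation at 0 does not increase the
    distance to \<open>f\<close>, and it turns \<open>g\<close> into a density.\<close>
  define g where "g z = max 0 (g0 z)" for z
  have gF[measurable]: "g \<in> borel_measurable (F m \<Otimes>\<^sub>M L)" unfolding g_def using g0(1) by measurable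
  have gQ: "g \<in> borel_measurable ?Q" "g0 \<in> borel_measurable ?Q"
    by (rule QF.measurable_F_M[OF gF], rule QF.measurable_F_M[OF g0(1)])
  have g: "0 \<le> g z" "g z \<le> K" for z using g0(2)[of z] by (auto simp: g_def)
  have gi: "integrable ?Q g" "integrable ?Q g0"
    using gQ g g0(2) by (auto intro!: Q.integrable_const_bound[where B=K])
  define W where "W \<omega> = (\<integral>x. \<bar>f (\<omega>, x) - g (\<omega>, x)\<bar> \<partial>L)" for \<omega>
  have fgi: "integrable ?Q (\<lambda>z. \<bar>f z - g z\<bar>)" using fi gi by simp
  have WN: "integrable ?N W" unfolding W_def by (rule NL.integrable_fst'[OF fgi])
  have WG: "W \<in> borel_measurable G" using WN by (auto intro: measurable_in_subalg'[OF subalgebra_G])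
  have W: "integrable M W" by (rule integrable_from_subalg[OF subalgebra_G WN])
  have W0: "0 \<le> W \<omega>" for \<omega> by (simp add: W_def)
  have "(\<integral>\<omega>. W \<omega> \<partial>M) = (\<integral>\<omega>. W \<omega> \<partial>?N)" by (rule integral_subalgebra2[OF subalgebra_G WG, symmetric])
  also have "\<dots> = (\<integral>z. \<bar>f z - g z\<bar> \<partial>?Q)" unfolding W_def by (rule NL.integral_fst'[OF fgi])
  also have "\<dots> \<le> (\<integral>z. \<bar>f z - g0 z\<bar> \<partial>?Q)"
  proof (rule integral_mono)
    show "\<bar>f z - g z\<bar> \<le> \<bar>f z - g0 z\<bar>" for z using f0[of z] unfolding g_def by linarith
  qed (use fi gi in auto)
  finally have We: "(\<integral>\<omega>. W \<omega> \<partial>M) < e" using g0(3) by simp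

  have fL: "AE \<omega> in M. integrable L (\<lambda>x. f (\<omega>, x))"
    using NL.AE_integrable_fst'[OF fi] by (rule AE_restr_to_subalg[OF subalgebra_G])
  have gL: "integrable L (\<lambda>x. g (\<omega>, x))" if w: "\<omega> \<in> space M" for \<omega>
  proof -
    have "(\<lambda>x. g (\<omega>, x)) \<in> borel_measurable L"
      by (rule measurable_compose[OF measurable_Pair1' gF]) (simp add: w space_F)
    then show ?thesis using g by (intro L.integrable_const_bound[where B=K]) auto
  qed
  have gW: "(\<integral>x. indicator B x * f (\<omega>, x) \<partial>L) \<le> (\<integral>x. indicator B x * g (\<omega>, x) \<partial>L) + W \<omega>"
    "(\<integral>x. indicator B x * g (\<omega>, x) \<partial>L) \<le> (\<integral>x. indicator B x * f (\<omega>, x) \<partial>L) + W \<omega>"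
    if w: "\<omega> \<in> space M" and i: "integrable L (\<lambda>x. f (\<omega>, x))" and B: "B \<in> sets borel" for \<omega> B
  proof -
    have BL: "B \<in> sets L" using B sL by simp
    note i1 = integrable_mult_indicator[OF BL i, unfolded real_scaleR_def]
      and i2 = integrable_mult_indicator[OF BL gL[OF w], unfolded real_scaleR_def]
    have i3: "integrable L (\<lambda>x. \<bar>f (\<omega>, x) - g (\<omega>, x)\<bar>)" using i gL[OF w] by simp
    have "(\<integral>x. indicator B x * f (\<omega>, x) \<partial>L) \<le> (\<integral>x. indicator B x * g (\<omega>, x) + \<bar>f (\<omega>, x) - g (\<omega>, x)\<bar> \<partial>L)"
      using i1 i2 i3 by (intro integral_mono) (auto simp: indicator_def)
    then show "(\<integral>x. indicator B x * f (\<omega>, x) \<partial>L) \<le> (\<integral>x. indicator B x * g (\<omega>, x) \<partial>L) + W \<omega>"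
      using i2 i3 by (simp add: W_def)
    have "(\<integral>x. indicator B x * g (\<omega>, x) \<partial>L) \<le> (\<integral>x. indicator B x * f (\<omega>, x) + \<bar>f (\<omega>, x) - g (\<omega>, x)\<bar> \<partial>L)"
      using i1 i2 i3 by (intro integral_mono) (auto simp: indicator_def)
    then show "(\<integral>x. indicator B x * g (\<omega>, x) \<partial>L) \<le> (\<integral>x. indicator B x * f (\<omega>, x) \<partial>L) + W \<omega>"
      using i1 i3 by (simp add: W_def)
  qed

  \<comment> \<open>Take conditional expectations given \<open>F n\<close> in
    \<open>b \<le> a + W\<close>. The left side is \<open>F m\<close>-measurable and so unchanged
    for \<open>n \<ge> m\<close>, and \<open>a\<close> becomes the mass of \<open>U\<close> under
    \<open>\<alpha> n\<close>.\<close>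
  have low: "AE \<omega> in M. (\<integral>x. indicator U x * g (\<omega>, x) \<partial>L) \<le> measure (\<alpha> n \<omega>) U + real_cond_exp M (F n) W \<omega>"
    if U[measurable]: "U \<in> sets borel" and n: "m \<le> n" for U n
  proof -
    have UL: "U \<in> sets L" using U sL by simp
    define b where "b \<omega> = (\<integral>x. indicator U x * g (\<omega>, x) \<partial>L)" for \<omega>
    define a where "a \<omega> = measure (\<alpha>' \<omega>) U" for \<omega>
    have "b \<in> borel_measurable (F m)"
      unfolding b_def using UL by measurable
    then have bF: "b \<in> borel_measurable (F n)" using n by (rule measurable_F_mono)
    have "(\<lambda>z. indicator U (snd z) * g z) \<in> borel_measurable ?Q"
      using UL gQ by measurable
    then have "integrable ?Q (\<lambda>z. indicator U (snd z) * g z)"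
      using g by (intro Bochner_Integration.integrable_bound[OF gi(1)]) (auto simp: indicator_def)
    from NL.integrable_fst'[OF this] have bi: "integrable M b"
      unfolding b_def by (simp add: integrable_from_subalg[OF subalgebra_G])
    have "a \<in> borel_measurable M"
      unfolding a_def using limit_kernel U by (rule measurable_compose[OF _ measurable_measure_prob_algebra])
    then have ai: "integrable M a"
      by (intro integrable_const_bound[where B=1]) (auto simp: a_def prob_space.prob_le_1 prob_space_limit)
    have "AE \<omega> in M. b \<omega> \<le> a \<omega> + W \<omega>"
      using fU[OF U] fL AE_space
    proof eventually_elim
      case (elim \<omega>)
      then show ?case
        using gW(2)[OF elim(3,2) U] measure_Int_non_atoms_le[OF elim(3) U] by (simp add: a_def b_def)
    qed
    then have "AE \<omega> in M. real_cond_exp M (F n) b \<omega> \<le> real_cond_exp M (F n) (\<lambda>\<omega>. a \<omega> + W \<omega>) \<omega>"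
      using ai bi W by (intro ce.real_cond_exp_mono) auto
    moreover note ce.real_cond_exp_add[OF ai W, of n] ce.real_cond_exp_F_meas[OF bi bF]
    moreover have "AE \<omega> in M. real_cond_exp M (F n) a \<omega> = measure (\<alpha> n \<omega>) U"
    proof -
      \<comment> \<open>A set with constant section \<open>U\<close>: the statement for random sets
        specializes to a fixed Borel set.\<close>
      have E: "space (F n) \<times> U \<in> sets (F n \<Otimes>\<^sub>M borel)" by simp
      have "AE \<omega> in M. real_cond_exp M (F n) a \<omega>
          = real_cond_exp M (F n) (\<lambda>\<omega>. measure (\<alpha>' \<omega>) (Pair \<omega> -` (space (F n) \<times> U))) \<omega>"
      proof (rule ce.real_cond_exp_cong)
        show "AE \<omega> in M. a \<omega> = measure (\<alpha>' \<omega>) (Pair \<omega> -` (space (F n) \<times> U))"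
          by (rule AE_I2) (simp add: a_def space_F)
        show "(\<lambda>\<omega>. measure (\<alpha>' \<omega>) (Pair \<omega> -` (space (F n) \<times> U))) \<in> borel_measurable M"
          by (rule measurable_measure_kernel_section[OF limit_kernel]) (use sets.top[of M] in \<open>simp add: space_F\<close>)
      qed (use ai in auto)
      then show ?thesis
        using cond_exp_limit_section[OF E] AE_space by eventually_elim (simp add: space_F)
    qed
    ultimately show ?thesis
      by eventually_elim (simp add: b_def)
  qed

  obtain \<U> :: "'a set set" where \<U>: "countable \<U>" "\<And>U. U \<in> \<U> \<Longrightarrow> open U"
    "\<And>U. open U \<Longrightarrow> \<exists>A. incseq A \<and> range A \<subseteq> \<U> \<and> (\<Union>n. A n) = U"
    using ex_countable_open_approximants[where 'a='a] by (elim exE conjE) blast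
  have \<U>b: "U \<in> sets borel" if "U \<in> \<U>" for U using \<U>(2)[OF that] by simp
  have fU': "AE \<omega> in M. \<forall>U\<in>\<U>. measure (\<alpha>' \<omega>) (U \<inter> non_atoms \<omega>) = (\<integral>x. indicator U x * f (\<omega>, x) \<partial>L)"
    using fU \<U>b by (intro AE_ball_countable'[OF _ \<U>(1)]) auto
  have low': "AE \<omega> in M. \<forall>U\<in>\<U>. m \<le> n \<longrightarrow>
      (\<integral>x. indicator U x * g (\<omega>, x) \<partial>L) \<le> measure (\<alpha> n \<omega>) U + real_cond_exp M (F n) W \<omega>" for n
    using low[OF \<U>b, of _ n] by (intro AE_ball_countable'[OF _ \<U>(1)]) auto
  then have low'': "AE \<omega> in M. \<forall>n. \<forall>U\<in>\<U>. m \<le> n \<longrightarrow>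
      (\<integral>x. indicator U x * g (\<omega>, x) \<partial>L) \<le> measure (\<alpha> n \<omega>) U + real_cond_exp M (F n) W \<omega>"
    unfolding AE_all_countable by blast
  have "AE \<omega> in M. \<forall>d>0. eventually (\<lambda>n. tv_dist (\<alpha> n \<omega>) (\<alpha>' \<omega>) \<le> W \<omega> + real_cond_exp M (F n) W \<omega> + d) sequentially"
    using fU' low'' fL atoms AE_space
  proof eventually_elim
    case (elim \<omega>)
    note w = elim(5)
    interpret p: prob_space "\<alpha>' \<omega>" by (rule prob_space_limit[OF w])
    have na: "non_atoms \<omega> \<in> sets borel" by (rule non_atoms_borel[OF w])
    \<comment> \<open>Equality is known on the countable family; it is used as an inequality with
      \<open>c = 0\<close>, the form that extends to all Borel sets.\<close>
    have up: "measure (\<alpha>' \<omega>) (B \<inter> non_atoms \<omega>) \<le> (\<integral>x. indicator B x * f (\<omega>, x) \<partial>L)"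
      if B: "B \<in> sets borel" for B
    proof -
      let ?\<rho> = "density (\<alpha>' \<omega>) (indicator (non_atoms \<omega>))"
      have e\<rho>: "emeasure ?\<rho> B = emeasure (\<alpha>' \<omega>) (B \<inter> non_atoms \<omega>)" if "B \<in> sets borel" for B
      proof -
        have "emeasure ?\<rho> B = (\<integral>\<^sup>+x. indicator (non_atoms \<omega>) x * indicator B x \<partial>\<alpha>' \<omega>)"
        proof (rule emeasure_density)
          have "non_atoms \<omega> \<in> sets (\<alpha>' \<omega>)" using na by (simp add: sets_limit[OF w])
          then show "indicator (non_atoms \<omega>) \<in> borel_measurable (\<alpha>' \<omega>)" by simp
        qed (simp add: sets_limit[OF w] that)
        also have "\<dots> = (\<integral>\<^sup>+x. indicator (B \<inter> non_atoms \<omega>) x \<partial>\<alpha>' \<omega>)"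
          by (intro nn_integral_cong) (auto simp: indicator_def)
        finally show ?thesis using na that by (simp add: sets_limit[OF w])
      qed
      have \<rho>: "measure ?\<rho> B = measure (\<alpha>' \<omega>) (B \<inter> non_atoms \<omega>)" if "B \<in> sets borel" for B
        using e\<rho>[OF that] by (simp add: measure_def)
      have sp: "space ?\<rho> = UNIV" using sets_eq_imp_space_eq[OF sets_limit[OF w]] by simp
      have "measure ?\<rho> B \<le> measure (density L (\<lambda>x. ennreal (f (\<omega>, x)))) B + 0"
      proof (rule borel_measure_le_if_open_le[OF \<U>(3,2) _ _ _ _ _ B])
        fix U assume "U \<in> \<U>"
        then show "measure ?\<rho> U \<le> measure (density L (\<lambda>x. ennreal (f (\<omega>, x)))) U + 0"
          using elim(1) \<rho>[OF \<U>b] measure_density_real(2)[OF elim(3) f0] \<U>b sL by simp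
      next
        show "finite_measure ?\<rho>"
          by (intro finite_measureI) (unfold sp, simp add: e\<rho>)
        show "finite_measure (density L (\<lambda>x. ennreal (f (\<omega>, x))))"
          by (rule measure_density_real(1)[OF elim(3) f0 sets.top])
      qed (simp_all add: sets_limit[OF w] sL)
      then show ?thesis using \<rho>[OF B] measure_density_real(2)[OF elim(3) f0, of B] B sL by simp
    qed
    \<comment> \<open>For fixed \<open>\<omega>\<close> and \<open>n\<close> the slack
      \<open>E(W | F n)\<close> does not depend on the set, so it plays the role of the constant
      \<open>c\<close>.\<close>
    have dn: "(\<integral>x. indicator B x * g (\<omega>, x) \<partial>L) \<le> measure (\<alpha> n \<omega>) B + real_cond_exp M (F n) W \<omega>"
      if B: "B \<in> sets borel" and n: "m \<le> n" for B n
    proof -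
      note gd = measure_density_real[OF gL[OF w] g(1)]
      have "measure (density L (\<lambda>x. ennreal (g (\<omega>, x)))) B \<le> measure (\<alpha> n \<omega>) B + real_cond_exp M (F n) W \<omega>"
      proof (rule borel_measure_le_if_open_le[OF \<U>(3,2) _ _ _ _ _ B])
        fix U assume "U \<in> \<U>"
        then show "measure (density L (\<lambda>x. ennreal (g (\<omega>, x)))) U \<le> measure (\<alpha> n \<omega>) U + real_cond_exp M (F n) W \<omega>"
          using elim(2) n gd(2)[of U] \<U>b sL by simp
      next
        show "finite_measure (density L (\<lambda>x. ennreal (g (\<omega>, x))))"
          by (rule gd(1)[OF sets.top])
        show "finite_measure (\<alpha> n \<omega>)" using prob_space_predictive[OF w] by (simp add: prob_space_def)
      qed (simp_all add: sets_predictive[OF w] sL)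
      then show ?thesis using gd(2)[of B] B sL by simp
    qed
    show ?case
    proof (intro allI impI)
      fix d :: real assume d: "d > 0"
      have "eventually (\<lambda>n. \<forall>B\<in>sets borel. measure (\<alpha>' \<omega>) (B \<inter> {x. measure (\<alpha>' \<omega>) {x} \<noteq> 0})
        \<le> measure (\<alpha> n \<omega>) (B \<inter> {x. measure (\<alpha>' \<omega>) {x} \<noteq> 0}) + d) sequentially"
        using elim(4) d
        by (intro eventually_atoms_lower_bound prob_space_limit[OF w] sets_limit[OF w]
            prob_space_predictive[OF w] sets_predictive[OF w]) auto
      moreover have "eventually (\<lambda>n. m \<le> n) sequentially" by (rule eventually_ge_at_top)
      ultimately show "eventually (\<lambda>n. tv_dist (\<alpha> n \<omega>) (\<alpha>' \<omega>) \<le> W \<omega> + real_cond_exp M (F n) W \<omega> + d) sequentially"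
      proof eventually_elim
        case (elim n)
        interpret q: prob_space "\<alpha> n \<omega>" by (rule prob_space_predictive[OF w])
        let ?D = "{x. measure (\<alpha>' \<omega>) {x} \<noteq> 0}"
        have D: "?D \<in> sets borel"
        proof -
          have "?D = UNIV - non_atoms \<omega>" by auto
          then show ?thesis using na by simp
        qed
        show ?case
        proof (rule tv_dist_le)
          fix B :: "'a set" assume B: "B \<in> sets borel"
          \<comment> \<open>This set depends on \<open>\<omega>\<close>; it is the reason why
            \<open>up\<close> and \<open>dn\<close> must hold for all Borel sets off a single null
            set.\<close>
          have Bc: "B \<inter> non_atoms \<omega> \<in> sets borel" and Bd: "B \<inter> ?D \<in> sets borel" using B na D by auto
          have B_eq: "B = (B \<inter> ?D) \<union> (B \<inter> non_atoms \<omega>)" by auto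
          have "measure (\<alpha>' \<omega>) B = measure (\<alpha>' \<omega>) (B \<inter> ?D) + measure (\<alpha>' \<omega>) (B \<inter> non_atoms \<omega>)"
            by (subst B_eq, rule p.finite_measure_Union) (use Bc Bd in \<open>auto simp: sets_limit[OF w]\<close>)
          moreover have "measure (\<alpha> n \<omega>) B = measure (\<alpha> n \<omega>) (B \<inter> ?D) + measure (\<alpha> n \<omega>) (B \<inter> non_atoms \<omega>)"
            by (subst B_eq, rule q.finite_measure_Union) (use Bc Bd in \<open>auto simp: sets_predictive[OF w]\<close>)
          moreover have "measure (\<alpha>' \<omega>) (B \<inter> ?D) \<le> measure (\<alpha> n \<omega>) (B \<inter> ?D) + d"
            using elim(1) B by blast
          moreover have "measure (\<alpha>' \<omega>) (B \<inter> non_atoms \<omega>)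
              \<le> (\<integral>x. indicator (B \<inter> non_atoms \<omega>) x * f (\<omega>, x) \<partial>L)"
            using up[OF Bc] by (simp add: Int_assoc)
          moreover note gW(1)[OF w \<open>integrable L (\<lambda>x. f (\<omega>, x))\<close> Bc] dn[OF Bc elim(2)]
          ultimately show "measure (\<alpha>' \<omega>) B \<le> measure (\<alpha> n \<omega>) B + (W \<omega> + real_cond_exp M (F n) W \<omega> + d)"
            by linarith
        qed (simp_all add: prob_space_predictive[OF w] sets_predictive[OF w] prob_space_limit[OF w] sets_limit[OF w])
      qed
    qed
  qed
  with W W0 We show "\<exists>W. integrable M W \<and> (\<forall>\<omega>. 0 \<le> W \<omega>) \<and> (\<integral>\<omega>. W \<omega> \<partial>M) < e \<and>
      (AE \<omega> in M. \<forall>d>0. eventually (\<lambda>n. tv_dist (\<alpha> n \<omega>) (\<alpha>' \<omega>) \<le> W \<omega> + real_cond_exp M (F n) W \<omega> + d) sequentially)"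
    by (intro exI[of _ W] conjI allI)
qed

end

section \<open>Atoms of the limit\<close>

text \<open>A bump at \<open>x\<close> dominates the indicator of \<open>{x}\<close>, and for large
  \<open>k\<close> its \<nu>-integral is as small as desired. Weak convergence carries this bound
  over to the measures \<open>\<mu> n\<close>.\<close>

lemma singleton_tendsto_0_if_weakly_converges:
  fixes \<mu> :: "nat \<Rightarrow> 'a::metric_space measure"
  assumes weak: "weakly_converges \<mu> \<nu>" and \<nu>: "prob_space \<nu>" "sets \<nu> = sets borel"
    and \<mu>: "\<And>n. prob_space (\<mu> n)" "\<And>n. sets (\<mu> n) = sets borel"
    and null: "measure \<nu> {x} = 0"
  shows "(\<lambda>n. measure (\<mu> n) {x}) \<longlonglongrightarrow> 0"
proof (rule order_tendstoI)
  fix a :: real assume "a < 0"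
  then show "eventually (\<lambda>n. a < measure (\<mu> n) {x}) sequentially"
    by (intro always_eventually) (auto intro: less_le_trans)
next
  fix a :: real assume a: "0 < a"
  interpret \<nu>: prob_space \<nu> by fact
  have "(\<lambda>k. \<integral>y. closed_bump {x} k y \<partial>\<nu>) \<longlonglongrightarrow> (\<integral>y. indicator {x} y \<partial>\<nu>)"
  proof (rule integral_dominated_convergence[where w="\<lambda>_. 1"])
    show "AE y in \<nu>. (\<lambda>k. closed_bump {x} k y) \<longlonglongrightarrow> indicator {x} y"
      by (intro AE_I2 closed_bump_tendsto) auto
    show "AE y in \<nu>. norm (closed_bump {x} k y) \<le> 1" for k
      using closed_bump_bounds[of "{x}" k] by (intro AE_I2) simp
    show "closed_bump {x} k \<in> borel_measurable \<nu>" for k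
      unfolding measurable_cong_sets[OF \<nu>(2) refl] by measurable
    show "indicator {x} \<in> borel_measurable \<nu>"
      unfolding measurable_cong_sets[OF \<nu>(2) refl] by measurable
  qed simp
  also have "(\<integral>y. indicator {x} y \<partial>\<nu>) = (0 :: real)"
    using null sets_eq_imp_space_eq[OF \<nu>(2)] by (simp add: Bochner_Integration.integral_indicator)
  finally have "eventually (\<lambda>k. (\<integral>y. closed_bump {x} k y \<partial>\<nu>) < a) sequentially"
    using a by (rule order_tendstoD)
  then obtain k where k: "(\<integral>y. closed_bump {x} k y \<partial>\<nu>) < a" by (auto simp: eventually_sequentially)
  have "bounded (range (closed_bump {x} k))"
    using closed_bump_bounds[of "{x}" k] by (intro boundedI[of _ 1]) auto
  then have "(\<lambda>n. \<integral>y. closed_bump {x} k y \<partial>\<mu> n) \<longlonglongrightarrow> (\<integral>y. closed_bump {x} k y \<partial>\<nu>)"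
    using weak continuous_closed_bump[of "{x}" k] by (simp add: weakly_converges_def)
  then have "eventually (\<lambda>n. (\<integral>y. closed_bump {x} k y \<partial>\<mu> n) < a) sequentially"
    using k by (rule order_tendstoD)
  then show "eventually (\<lambda>n. measure (\<mu> n) {x} < a) sequentially"
  proof eventually_elim
    case (elim n)
    interpret \<mu>: prob_space "\<mu> n" by (rule \<mu>(1))
    have "closed_bump {x} k \<in> borel_measurable (\<mu> n)"
      unfolding measurable_cong_sets[OF \<mu>(2) refl] by measurable
    then have i: "integrable (\<mu> n) (closed_bump {x} k)"
      using closed_bump_bounds[of "{x}" k] by (intro \<mu>.integrable_const_bound[where B=1]) auto
    have "measure (\<mu> n) {x} = (\<integral>y. indicator {x} y \<partial>\<mu> n)" by (simp add: \<mu>(2))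
    also have "\<dots> \<le> (\<integral>y. closed_bump {x} k y \<partial>\<mu> n)"
    proof (rule integral_mono[OF _ i])
      show "integrable (\<mu> n) (indicator {x} :: 'a \<Rightarrow> real)"
        by (rule integrable_real_indicator) (simp_all add: \<mu>(2) less_top[symmetric])
      show "indicator {x} y \<le> closed_bump {x} k y" for y
        using closed_bump_bounds(1)[of "{x}" k y] closed_bump_in[of x "{x}" k] by (auto simp: indicator_def)
    qed
    finally show ?case using elim by simp
  qed
qed

lemma ex_separating_open_sequence:
  "\<exists>U :: nat \<Rightarrow> 'a::{second_countable_topology, t2_space} set. (\<forall>k. open (U k)) \<and>
    (\<forall>x y. x \<noteq> y \<longrightarrow> (\<exists>k. (x \<in> U k) \<noteq> (y \<in> U k)))"
proof -
  obtain B :: "'a set set" where B: "countable B" "topological_basis B"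
    using ex_countable_basis by blast
  \<comment> \<open>Inserting the empty set makes the enumerated family nonempty, so that
    \<open>from_nat_into\<close> has exactly it as its range.\<close>
  let ?U = "from_nat_into (insert {} B)"
  have r: "range ?U = insert {} B" using B(1) by (intro range_from_nat_into) auto
  have op: "open (?U k)" for k
  proof -
    have "?U k \<in> insert {} B" using r by blast
    then show ?thesis using topological_basis_open[OF B(2)] by auto
  qed
  have sep: "\<exists>k. (x \<in> ?U k) \<noteq> (y \<in> ?U k)" if xy: "x \<noteq> y" for x y
  proof -
    obtain V where V: "open V" "x \<in> V" "y \<notin> V" using t1_space[OF xy] by (elim exE conjE)
    obtain b where b: "b \<in> B" "x \<in> b" "b \<subseteq> V" using topological_basisE[OF B(2) V(1,2)] .
    then have "b \<in> range ?U" using r by simp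
    then obtain k where "b = ?U k" by (elim imageE)
    then show ?thesis using b V(3) by (intro exI[of _ k]) auto
  qed
  show ?thesis using op sep by (intro exI[of _ ?U] conjI allI impI)
qed

text \<open>Exchangeability is stated for permutations of initial segments. Extending an injective
  choice of \<open>n\<close> indices to such a permutation yields invariance under injective
  reindexing; the extension exists because the two complements in \<open>{..<N}\<close> have equal
  size.\<close>

lemma ex_permutation_extending:
  fixes \<sigma> :: "nat \<Rightarrow> nat"
  assumes inj: "inj_on \<sigma> {..<n}"
  shows "\<exists>N \<pi>. n \<le> N \<and> \<pi> permutes {..<N} \<and> (\<forall>l<n. \<pi> l = \<sigma> l)"
proof -
  define N where "N = n + (\<Sum>l<n. Suc (\<sigma> l))"
  have less: "\<sigma> l < N" if "l < n" for l
  proof -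
    have "Suc (\<sigma> l) \<le> (\<Sum>l<n. Suc (\<sigma> l))" by (rule member_le_sum[of l _ "\<lambda>l. Suc (\<sigma> l)"]) (use that in auto)
    then show ?thesis by (simp add: N_def)
  qed
  have nN: "n \<le> N" by (simp add: N_def)
  have sub: "\<sigma> ` {..<n} \<subseteq> {..<N}" using less by auto
  have "card ({..<N} - {..<n}) = card ({..<N} - \<sigma> ` {..<n})"
    using nN sub by (simp add: card_Diff_subset card_image[OF inj])
  then obtain h where h: "bij_betw h ({..<N} - {..<n}) ({..<N} - \<sigma> ` {..<n})"
    using finite_same_card_bij[of "{..<N} - {..<n}" "{..<N} - \<sigma> ` {..<n}"] by auto
  define \<pi> where "\<pi> x = (if x < n then \<sigma> x else if x < N then h x else x)" for x
  have "bij_betw \<pi> {..<n} (\<sigma> ` {..<n})"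
    using inj by (subst bij_betw_cong[of _ _ \<sigma>]) (auto simp: \<pi>_def bij_betw_def)
  moreover have "bij_betw \<pi> ({..<N} - {..<n}) ({..<N} - \<sigma> ` {..<n})"
    using h by (subst bij_betw_cong[of _ _ h]) (auto simp: \<pi>_def)
  ultimately have "bij_betw \<pi> ({..<n} \<union> ({..<N} - {..<n})) (\<sigma> ` {..<n} \<union> ({..<N} - \<sigma> ` {..<n}))"
    by (rule bij_betw_combine) auto
  moreover have "{..<n} \<union> ({..<N} - {..<n}) = {..<N}" "\<sigma> ` {..<n} \<union> ({..<N} - \<sigma> ` {..<n}) = {..<N}"
    using nN sub by auto
  ultimately have "\<pi> permutes {..<N}"
    by (intro bij_imp_permutes) (auto simp: \<pi>_def nN)
  then show ?thesis using nN by (intro exI[of _ N] exI[of _ \<pi>]) (auto simp: \<pi>_def)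
qed

context cid_sequence
begin

text \<open>\<open>E\<close> is the graph of \<open>X i\<close>, with section
  \<open>{X i \<omega>}\<close>, and it belongs to the product with \<open>F n\<close> as soon as
  \<open>i < n\<close>. From then on the predictive mass of the observed point is a conditional
  expectation of a fixed random variable, and Levy's theorem applies. The c.i.d. property already
  gives this.\<close>

lemma AE_predictive_observed_atom:
  "AE \<omega> in M. (\<lambda>n. measure (\<alpha> n \<omega>) {X i \<omega>}) \<longlonglongrightarrow> measure (\<alpha>' \<omega>) {X i \<omega>}"
proof -
  define E where "E = {z \<in> space M \<times> UNIV. snd z = X i (fst z)}"
  have EF: "E \<in> sets (F n \<Otimes>\<^sub>M borel)" if "i < n" for n
  proof -
    have [measurable]: "X i \<in> F n \<rightarrow>\<^sub>M borel" by (rule measurable_X_F[OF that])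
    have "{z \<in> space (F n \<Otimes>\<^sub>M borel). snd z = X i (fst z)} \<in> sets (F n \<Otimes>\<^sub>M borel)" by measurable
    then show ?thesis by (simp add: E_def space_pair_measure space_F)
  qed
  have EG: "E \<in> sets (G \<Otimes>\<^sub>M borel)"
  proof -
    have "sets (F (Suc i) \<Otimes>\<^sub>M (borel :: 'a measure)) \<subseteq> sets (G \<Otimes>\<^sub>M borel)"
      by (rule sets_pair_in_sets) (use subalgebra_G_F[of "Suc i"] in \<open>auto simp: subalgebra_def\<close>)
    then show ?thesis using EF[of "Suc i"] by auto
  qed
  define Y where "Y \<omega> = measure (\<alpha>' \<omega>) (Pair \<omega> -` E)" for \<omega>
  have YG: "Y \<in> borel_measurable G"
    unfolding Y_def by (rule measurable_measure_kernel_section[OF limit_kernel_G EG])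
  have Yi: "integrable M Y"
    using measurable_from_subalg[OF subalgebra_G YG]
    by (intro integrable_const_bound[where B=1]) (auto simp: Y_def prob_space.prob_le_1 prob_space_limit)
  have "AE \<omega> in M. (\<lambda>n. real_cond_exp M (F n) Y \<omega>) \<longlonglongrightarrow> Y \<omega>"
    by (rule levy_upward[OF subalgebra_F sets_F_mono subalgebra_G sets_G Yi YG])
  moreover have "AE \<omega> in M. real_cond_exp M (F n) Y \<omega> = measure (\<alpha> n \<omega>) (Pair \<omega> -` E)" if "i < n" for n
    unfolding Y_def by (rule cond_exp_limit_section[OF EF[OF that]])
  then have "AE \<omega> in M. \<forall>n. i < n \<longrightarrow> real_cond_exp M (F n) Y \<omega> = measure (\<alpha> n \<omega>) (Pair \<omega> -` E)"
    unfolding AE_all_countable by auto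
  ultimately show ?thesis
    using AE_space
  proof eventually_elim
    case (elim \<omega>)
    have P: "Pair \<omega> -` E = {X i \<omega>}" using elim(3) by (auto simp: E_def)
    have "eventually (\<lambda>n. real_cond_exp M (F n) Y \<omega> = measure (\<alpha> n \<omega>) {X i \<omega>}) sequentially"
      using elim(2) P by (auto intro: eventually_mono[OF eventually_gt_at_top[of i]])
    with elim(1) show ?case by (simp add: tendsto_cong Y_def P)
  qed
qed

section \<open>Mixture representation of exchangeable sequences\<close>

text \<open>Stable convergence: far out, \<open>X m\<close> behaves like a draw from
  \<open>\<alpha>'\<close> even jointly with a \<open>G\<close>-measurable weight. For weights
  measurable at a finite stage \<open>k\<close> there is equality from \<open>m = k\<close> on; a
  general weight is approximated in L1, uniformly in \<open>m\<close>.\<close>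

lemma integral_stable:
  assumes Y: "Y \<in> borel_measurable G" "\<And>\<omega>. 0 \<le> Y \<omega>" "\<And>\<omega>. Y \<omega> \<le> (1 :: real)"
    and B[measurable]: "B \<in> sets borel"
  shows "(\<lambda>m. \<integral>\<omega>. Y \<omega> * indicator B (X m \<omega>) \<partial>M) \<longlonglongrightarrow> (\<integral>\<omega>. Y \<omega> * measure (\<alpha>' \<omega>) B \<partial>M)"
proof (rule tendstoI)
  fix e :: real assume "e > 0"
  then have e2: "e / 2 > 0" by simp
  let ?N = restr_G
  have YM[measurable]: "Y \<in> borel_measurable M" using Y(1) by (rule measurable_from_subalg[OF subalgebra_G])
  have Yi: "integrable M Y" using Y by (intro integrable_const_bound[where B=1]) auto
  interpret N: prob_space ?N by (rule prob_space_restr_to_subalg[OF subalgebra_G prob_space_axioms])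
  interpret NF: filtered_finite_measure ?N F
    using subalgebra_G_F sets_F_mono by unfold_locales (auto simp: subalgebra_def space_restr_G sets_restr_G space_G)
  have gen: "sets ?N = sigma_sets (space ?N) (\<Union>n. sets (F n))"
    by (simp add: sets_restr_G sets_G space_restr_G)
  obtain k Z0 K where Z0: "Z0 \<in> borel_measurable (F k)" "\<And>\<omega>. \<bar>Z0 \<omega>\<bar> \<le> K" "(\<integral>\<omega>. \<bar>Y \<omega> - Z0 \<omega>\<bar> \<partial>?N) < e / 2"
    using NF.approx_integrable[OF gen integrable_in_subalg[OF subalgebra_G Y(1) Yi] e2]
    by (elim exE bexE conjE) blast
  \<comment> \<open>Nonnegativity of \<open>Z\<close> allows the identity for nonnegative integrals
    to be used; as \<open>Y\<close> is nonnegative, the truncation costs nothing.\<close>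
  define Z where "Z \<omega> = max 0 (Z0 \<omega>)" for \<omega>
  have ZF: "Z \<in> borel_measurable (F k)" unfolding Z_def using Z0(1) by measurable
  have ZM[measurable]: "Z \<in> borel_measurable M" "Z0 \<in> borel_measurable M"
    by (rule measurable_F_M[OF ZF], rule measurable_F_M[OF Z0(1)])
  have Z: "0 \<le> Z \<omega>" "Z \<omega> \<le> K" for \<omega> using Z0(2)[of \<omega>] by (auto simp: Z_def)
  have Zi: "integrable M Z" "integrable M Z0" using Z Z0(2) by (auto intro!: integrable_const_bound[where B=K])
  have "Z0 \<in> borel_measurable G" by (rule measurable_from_subalg[OF subalgebra_G_F Z0(1)])
  then have "(\<integral>\<omega>. \<bar>Y \<omega> - Z0 \<omega>\<bar> \<partial>M) < e / 2"
    using Z0(3) Y(1) integral_subalgebra2[OF subalgebra_G, of "\<lambda>\<omega>. \<bar>Y \<omega> - Z0 \<omega>\<bar>"] by simp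
  moreover have "(\<integral>\<omega>. \<bar>Y \<omega> - Z \<omega>\<bar> \<partial>M) \<le> (\<integral>\<omega>. \<bar>Y \<omega> - Z0 \<omega>\<bar> \<partial>M)"
  proof (rule integral_mono)
    show "\<bar>Y \<omega> - Z \<omega>\<bar> \<le> \<bar>Y \<omega> - Z0 \<omega>\<bar>" for \<omega> using Y(2)[of \<omega>] unfolding Z_def by linarith
  qed (use Yi Zi in auto)
  ultimately have YZ: "(\<integral>\<omega>. \<bar>Y \<omega> - Z \<omega>\<bar> \<partial>M) < e / 2" by simp
  have close: "\<bar>(\<integral>\<omega>. Y \<omega> * h \<omega> \<partial>M) - (\<integral>\<omega>. Z \<omega> * h \<omega> \<partial>M)\<bar> < e / 2"
    if h[measurable]: "h \<in> borel_measurable M" and hb: "\<And>\<omega>. \<omega> \<in> space M \<Longrightarrow> 0 \<le> h \<omega> \<and> h \<omega> \<le> 1" for h :: "'w \<Rightarrow> real"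
  proof -
    have i1: "integrable M (\<lambda>\<omega>. Y \<omega> * h \<omega>)"
      using hb Y by (intro Bochner_Integration.integrable_bound[OF Yi] AE_I2) (auto simp: abs_mult intro: mult_left_le)
    have i2: "integrable M (\<lambda>\<omega>. Z \<omega> * h \<omega>)"
      using hb Z by (intro Bochner_Integration.integrable_bound[OF Zi(1)] AE_I2) (auto simp: abs_mult intro: mult_left_le)
    have "\<bar>(\<integral>\<omega>. Y \<omega> * h \<omega> \<partial>M) - (\<integral>\<omega>. Z \<omega> * h \<omega> \<partial>M)\<bar> = \<bar>\<integral>\<omega>. Y \<omega> * h \<omega> - Z \<omega> * h \<omega> \<partial>M\<bar>"
      using i1 i2 by simp
    also have "\<dots> \<le> (\<integral>\<omega>. \<bar>Y \<omega> * h \<omega> - Z \<omega> * h \<omega>\<bar> \<partial>M)" by (rule integral_abs_bound)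
    also have "\<dots> \<le> (\<integral>\<omega>. \<bar>Y \<omega> - Z \<omega>\<bar> \<partial>M)"
    proof (rule integral_mono)
      fix \<omega> assume "\<omega> \<in> space M"
      then have "\<bar>Y \<omega> - Z \<omega>\<bar> * h \<omega> \<le> \<bar>Y \<omega> - Z \<omega>\<bar>" using hb[of \<omega>] by (intro mult_left_le) auto
      moreover have "\<bar>Y \<omega> * h \<omega> - Z \<omega> * h \<omega>\<bar> = \<bar>Y \<omega> - Z \<omega>\<bar> * h \<omega>"
        using hb[OF \<open>\<omega> \<in> space M\<close>] by (simp add: left_diff_distrib[symmetric] abs_mult)
      ultimately show "\<bar>Y \<omega> * h \<omega> - Z \<omega> * h \<omega>\<bar> \<le> \<bar>Y \<omega> - Z \<omega>\<bar>" by simp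
    qed (use i1 i2 Yi Zi in auto)
    finally show ?thesis using YZ by simp
  qed
  have a'm[measurable]: "(\<lambda>\<omega>. measure (\<alpha>' \<omega>) B) \<in> borel_measurable M"
    using limit_kernel B by (rule measurable_compose[OF _ measurable_measure_prob_algebra])
  have a'b: "0 \<le> measure (\<alpha>' \<omega>) B \<and> measure (\<alpha>' \<omega>) B \<le> 1" if "\<omega> \<in> space M" for \<omega>
    using prob_space.prob_le_1[OF prob_space_limit[OF that]] by simp
  have eqZ: "(\<integral>\<omega>. Z \<omega> * indicator B (X m \<omega>) \<partial>M) = (\<integral>\<omega>. Z \<omega> * measure (\<alpha>' \<omega>) B \<partial>M)" if m: "k \<le> m" for m
  proof -
    let ?f = "\<lambda>z. ennreal (Z (fst z)) * indicator B (snd z)"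
    have ZFm: "Z \<in> borel_measurable (F m)" using ZF m by (rule measurable_F_mono)
    have f: "?f \<in> borel_measurable (F m \<Otimes>\<^sub>M borel)" using ZFm by measurable
    have i1: "integrable M (\<lambda>\<omega>. Z \<omega> * indicator B (X m \<omega>))"
      using Z by (intro Bochner_Integration.integrable_bound[OF Zi(1)] AE_I2) (auto simp: indicator_def)
    have i2: "integrable M (\<lambda>\<omega>. Z \<omega> * measure (\<alpha>' \<omega>) B)"
      using a'b Z by (intro Bochner_Integration.integrable_bound[OF Zi(1)] AE_I2) (auto simp: abs_mult intro: mult_left_le)
    have "ennreal (\<integral>\<omega>. Z \<omega> * measure (\<alpha>' \<omega>) B \<partial>M) = (\<integral>\<^sup>+\<omega>. ennreal (Z \<omega> * measure (\<alpha>' \<omega>) B) \<partial>M)"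
      using i2 Z by (intro nn_integral_eq_integral[symmetric]) auto
    also have "\<dots> = (\<integral>\<^sup>+\<omega>. \<integral>\<^sup>+x. ?f (\<omega>, x) \<partial>\<alpha>' \<omega> \<partial>M)"
    proof (rule nn_integral_cong)
      fix \<omega> assume w: "\<omega> \<in> space M"
      interpret p: prob_space "\<alpha>' \<omega>" by (rule prob_space_limit[OF w])
      show "ennreal (Z \<omega> * measure (\<alpha>' \<omega>) B) = (\<integral>\<^sup>+x. ?f (\<omega>, x) \<partial>\<alpha>' \<omega>)"
        using Z by (simp add: nn_integral_cmult_indicator sets_limit[OF w] p.emeasure_eq_measure ennreal_mult)
    qed
    also have "\<dots> = (\<integral>\<^sup>+\<omega>. ?f (\<omega>, X m \<omega>) \<partial>M)" by (rule nn_integral_limit[OF f])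
    also have "\<dots> = (\<integral>\<^sup>+\<omega>. ennreal (Z \<omega> * indicator B (X m \<omega>)) \<partial>M)"
      by (intro nn_integral_cong) (simp add: indicator_def)
    also have "\<dots> = ennreal (\<integral>\<omega>. Z \<omega> * indicator B (X m \<omega>) \<partial>M)"
      using i1 Z by (intro nn_integral_eq_integral) auto
    finally show ?thesis
      using Z by (subst (asm) ennreal_inj) (auto intro!: integral_nonneg_AE)
  qed
  show "eventually (\<lambda>m. dist (\<integral>\<omega>. Y \<omega> * indicator B (X m \<omega>) \<partial>M) (\<integral>\<omega>. Y \<omega> * measure (\<alpha>' \<omega>) B \<partial>M) < e) sequentially"
    using eventually_ge_at_top[of k]
  proof eventually_elim
    case (elim m)
    have "\<bar>(\<integral>\<omega>. Y \<omega> * indicator B (X m \<omega>) \<partial>M) - (\<integral>\<omega>. Z \<omega> * indicator B (X m \<omega>) \<partial>M)\<bar> < e / 2"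
      by (rule close) (auto simp: indicator_def)
    moreover have "\<bar>(\<integral>\<omega>. Y \<omega> * measure (\<alpha>' \<omega>) B \<partial>M) - (\<integral>\<omega>. Z \<omega> * measure (\<alpha>' \<omega>) B \<partial>M)\<bar> < e / 2"
      by (rule close[OF a'm a'b])
    ultimately show ?case using eqZ[OF elim] unfolding dist_real_def by linarith
  qed
qed

lemma prod_indicator_X:
  "finite I \<Longrightarrow> \<omega> \<in> space M \<Longrightarrow>
    (\<Prod>l\<in>I. indicator (B l) (X (\<sigma> l) \<omega>)) = (indicator {\<omega>\<in>space M. \<forall>l\<in>I. X (\<sigma> l) \<omega> \<in> B l} \<omega> :: real)"
  by (induction I rule: finite_induct) (auto simp: indicator_def)

lemma exchangeable_reindex:
  assumes ex: "exchangeable M X" and inj: "inj_on \<sigma> {..<n}" and B: "\<And>l. l < n \<Longrightarrow> B l \<in> sets borel"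
  shows "measure M {\<omega>\<in>space M. \<forall>l<n. X (\<sigma> l) \<omega> \<in> B l} = measure M {\<omega>\<in>space M. \<forall>l<n. X l \<omega> \<in> B l}"
proof -
  obtain N \<pi> where N: "n \<le> N" and \<pi>: "\<pi> permutes {..<N}" "\<forall>l<n. \<pi> l = \<sigma> l"
    using ex_permutation_extending[OF inj] by blast
  let ?P = "PiM {..<N} (\<lambda>_. borel :: 'a measure)"
  define D where "D = {y\<in>space ?P. \<forall>l\<in>{..<n}. y l \<in> B l}"
  have D: "D \<in> sets ?P"
    unfolding D_def
  proof (rule sets.sets_Collect_finite_All)
    fix l assume l: "l \<in> {..<n}"
    then have "(\<lambda>y. y l) \<in> ?P \<rightarrow>\<^sub>M borel"
      using N by (intro measurable_component_singleton[where M="\<lambda>_. borel"]) auto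
    then have "(\<lambda>y. y l) -` B l \<inter> space ?P \<in> sets ?P" by (rule measurable_sets) (use B l in auto)
    then show "{y\<in>space ?P. y l \<in> B l} \<in> sets ?P" by (simp add: vimage_def Int_def conj_commute)
  qed simp
  have m: "(\<lambda>\<omega>. \<lambda>i\<in>{..<N}. X (p i) \<omega>) \<in> M \<rightarrow>\<^sub>M ?P" for p
    by (auto intro!: measurable_restrict)
  have e: "measure (distr M ?P (\<lambda>\<omega>. \<lambda>i\<in>{..<N}. X (p i) \<omega>)) D = measure M {\<omega>\<in>space M. \<forall>l<n. X (p l) \<omega> \<in> B l}" for p
    unfolding measure_distr[OF m D]
    by (rule arg_cong[where f="measure M"]) (use N in \<open>auto simp: D_def space_PiM\<close>)
  have "distr M ?P (\<lambda>\<omega>. \<lambda>i\<in>{..<N}. X (\<pi> i) \<omega>) = distr M ?P (\<lambda>\<omega>. \<lambda>i\<in>{..<N}. X i \<omega>)"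
    using ex \<pi>(1) by (simp add: exchangeable_def)
  then have "measure M {\<omega>\<in>space M. \<forall>l<n. X (\<pi> l) \<omega> \<in> B l} = measure M {\<omega>\<in>space M. \<forall>l<n. X l \<omega> \<in> B l}"
    using e[of \<pi>] e[of "\<lambda>i. i"] by simp
  moreover have "{\<omega>\<in>space M. \<forall>l<n. X (\<pi> l) \<omega> \<in> B l} = {\<omega>\<in>space M. \<forall>l<n. X (\<sigma> l) \<omega> \<in> B l}"
    using \<pi>(2) by auto
  ultimately show ?thesis by simp
qed

text \<open>The mixture representation of an exchangeable sequence. The factors
  \<open>indicator (B l) (X (\<sigma> l))\<close> are replaced by \<open>\<alpha>' (B l)\<close> one at a time, starting with the
  last one, by sending its index to infinity.\<close>

lemma exchangeable_mixture:
  assumes ex: "exchangeable M X" and B: "\<And>l. l < n \<Longrightarrow> B l \<in> sets borel"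
  shows "(\<integral>\<omega>. (\<Prod>l<n. measure (\<alpha>' \<omega>) (B l)) \<partial>M) = measure M {\<omega>\<in>space M. \<forall>l<n. X l \<omega> \<in> B l}"
proof -
  let ?c = "measure M {\<omega>\<in>space M. \<forall>l<n. X l \<omega> \<in> B l}"
  have *: "j \<le> n \<Longrightarrow> inj_on \<sigma> {..<j} \<Longrightarrow>
      (\<integral>\<omega>. (\<Prod>l<j. indicator (B l) (X (\<sigma> l) \<omega>)) * (\<Prod>l\<in>{j..<n}. measure (\<alpha>' \<omega>) (B l)) \<partial>M) = ?c" for j and \<sigma> :: "nat \<Rightarrow> nat"
  proof (induction j arbitrary: \<sigma> rule: inc_induct)
    case base
    have "(\<integral>\<omega>. (\<Prod>l<n. indicator (B l) (X (\<sigma> l) \<omega>)) * (\<Prod>l\<in>{n..<n}. measure (\<alpha>' \<omega>) (B l)) \<partial>M)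
        = (\<integral>\<omega>. indicator {\<omega>\<in>space M. \<forall>l\<in>{..<n}. X (\<sigma> l) \<omega> \<in> B l} \<omega> \<partial>M)"
      by (intro Bochner_Integration.integral_cong) (simp_all add: prod_indicator_X)
    also have "\<dots> = measure M {\<omega>\<in>space M. \<forall>l<n. X (\<sigma> l) \<omega> \<in> B l}"
      by (simp add: Bochner_Integration.integral_indicator Int_def conj_commute conj_left_commute Ball_def cong: conj_cong)
    finally show ?case using exchangeable_reindex[OF ex base B] by simp
  next
    case (step j)
    \<comment> \<open>The value 0 outside \<open>space M\<close> makes the bounds hold everywhere,
      where \<open>\<alpha>' \<omega>\<close> might fail to be a probability measure.\<close>
    define Y :: "'w \<Rightarrow> real" where "Y \<omega> = (if \<omega> \<in> space M then (\<Prod>l<j. indicator (B l) (X (\<sigma> l) \<omega>)) *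
      (\<Prod>l\<in>{Suc j..<n}. measure (\<alpha>' \<omega>) (B l)) else 0)" for \<omega>
    have Bj: "B j \<in> sets borel" using B step by auto
    have Xg: "X i \<in> G \<rightarrow>\<^sub>M borel" for i
      using measurable_X_F[of i "Suc i"] by (intro measurable_from_subalg[OF subalgebra_G_F]) auto
    have "(\<lambda>\<omega>. (\<Prod>l<j. indicator (B l) (X (\<sigma> l) \<omega>)) * (\<Prod>l\<in>{Suc j..<n}. measure (\<alpha>' \<omega>) (B l))) \<in> borel_measurable G"
    proof (intro borel_measurable_times borel_measurable_prod)
      fix l assume "l \<in> {..<j}"
      then show "(\<lambda>\<omega>. indicator (B l) (X (\<sigma> l) \<omega>)) \<in> borel_measurable G"
        using B step by (intro measurable_compose[OF Xg]) auto
    next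
      fix l assume "l \<in> {Suc j..<n}"
      then show "(\<lambda>\<omega>. measure (\<alpha>' \<omega>) (B l)) \<in> borel_measurable G"
        using B by (intro measurable_compose[OF limit_kernel_G] measurable_measure_prob_algebra) auto
    qed
    then have YG: "Y \<in> borel_measurable G"
      unfolding Y_def by (rule measurable_cong[THEN iffD1, rotated]) (simp add: space_G)
    have Y: "0 \<le> Y \<omega>" "Y \<omega> \<le> 1" for \<omega>
    proof -
      show "0 \<le> Y \<omega>" by (auto simp: Y_def intro!: mult_nonneg_nonneg prod_nonneg)
      show "Y \<omega> \<le> 1"
        by (auto simp: Y_def prob_space.prob_le_1 prob_space_limit intro!: mult_le_one prod_le_1 prod_nonneg)
    qed
    have lim: "(\<lambda>m. \<integral>\<omega>. Y \<omega> * indicator (B j) (X m \<omega>) \<partial>M) \<longlonglongrightarrow> (\<integral>\<omega>. Y \<omega> * measure (\<alpha>' \<omega>) (B j) \<partial>M)"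
      by (rule integral_stable[OF YG Y Bj])
    \<comment> \<open>Such an \<open>m\<close> exceeds every index in use, so
      \<open>\<sigma>(j := m)\<close> is again injective and the induction hypothesis gives a value
      independent of \<open>m\<close>.\<close>
    have const: "(\<integral>\<omega>. Y \<omega> * indicator (B j) (X m \<omega>) \<partial>M) = ?c" if m: "(\<Sum>l<j. Suc (\<sigma> l)) \<le> m" for m
    proof -
      have less: "\<sigma> l < m" if "l < j" for l
      proof -
        have "Suc (\<sigma> l) \<le> (\<Sum>l<j. Suc (\<sigma> l))" by (rule member_le_sum[of l _ "\<lambda>l. Suc (\<sigma> l)"]) (use that in auto)
        then show ?thesis using m by simp
      qed
      have inj: "inj_on (\<sigma>(j := m)) {..<Suc j}"
        using step.prems by (auto simp: inj_on_def less_Suc_eq dest: less)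
      have "?c = (\<integral>\<omega>. (\<Prod>l<Suc j. indicator (B l) (X ((\<sigma>(j := m)) l) \<omega>)) * (\<Prod>l\<in>{Suc j..<n}. measure (\<alpha>' \<omega>) (B l)) \<partial>M)"
        using step.IH[OF inj] by simp
      also have "\<dots> = (\<integral>\<omega>. Y \<omega> * indicator (B j) (X m \<omega>) \<partial>M)"
        by (intro Bochner_Integration.integral_cong) (simp_all add: Y_def)
      finally show ?thesis by simp
    qed
    have "(\<lambda>m. \<integral>\<omega>. Y \<omega> * indicator (B j) (X m \<omega>) \<partial>M) \<longlonglongrightarrow> ?c"
      by (rule tendsto_eventually) (use const in \<open>auto simp: eventually_sequentially\<close>)
    with lim have "(\<integral>\<omega>. Y \<omega> * measure (\<alpha>' \<omega>) (B j) \<partial>M) = ?c" by (rule LIMSEQ_unique)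
    moreover have "(\<integral>\<omega>. (\<Prod>l<j. indicator (B l) (X (\<sigma> l) \<omega>)) * (\<Prod>l\<in>{j..<n}. measure (\<alpha>' \<omega>) (B l)) \<partial>M)
        = (\<integral>\<omega>. Y \<omega> * measure (\<alpha>' \<omega>) (B j) \<partial>M)"
      using \<open>j < n\<close> by (intro Bochner_Integration.integral_cong) (simp_all add: Y_def prod.atLeast_Suc_lessThan)
    ultimately show ?case by simp
  qed
  show ?thesis using *[of 0 id] by (simp add: atLeast0LessThan)
qed

text \<open>In the mixture representation each of the \<open>n\<close> misses contributes a factor
  \<open>1 - measure (\<alpha>' \<omega>) A\<close>, and the final hit a factor
  \<open>measure (\<alpha>' \<omega>) A\<close>.\<close>

lemma emeasure_new_value_in:
  assumes ex: "exchangeable M X" and A[measurable]: "A \<in> sets borel"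
  shows "emeasure M {\<omega>\<in>space M. X n \<omega> \<in> A \<and> (\<forall>i<n. X i \<omega> \<notin> A)}
    = (\<integral>\<^sup>+\<omega>. ennreal (measure (\<alpha>' \<omega>) A * (1 - measure (\<alpha>' \<omega>) A) ^ n) \<partial>M)"
proof -
  define B where "B l = (if l < n then - A else A)" for l :: nat
  have Bs: "B l \<in> sets borel" for l by (simp add: B_def)
  have prod: "(\<Prod>l<Suc n. measure (\<alpha>' \<omega>) (B l)) = measure (\<alpha>' \<omega>) A * (1 - measure (\<alpha>' \<omega>) A) ^ n"
    if w: "\<omega> \<in> space M" for \<omega>
  proof -
    interpret p: prob_space "\<alpha>' \<omega>" by (rule prob_space_limit[OF w])
    have "space (\<alpha>' \<omega>) = UNIV" using sets_eq_imp_space_eq[OF sets_limit[OF w]] by simp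
    then have "measure (\<alpha>' \<omega>) (- A) = 1 - measure (\<alpha>' \<omega>) A"
      using p.prob_compl[of A] by (simp add: sets_limit[OF w] Compl_eq_Diff_UNIV)
    then show ?thesis by (simp add: B_def)
  qed
  have m: "(\<lambda>\<omega>. measure (\<alpha>' \<omega>) A) \<in> borel_measurable M"
    using limit_kernel A by (rule measurable_compose[OF _ measurable_measure_prob_algebra])
  have b: "0 \<le> measure (\<alpha>' \<omega>) A * (1 - measure (\<alpha>' \<omega>) A) ^ n \<and> measure (\<alpha>' \<omega>) A * (1 - measure (\<alpha>' \<omega>) A) ^ n \<le> 1"
    if w: "\<omega> \<in> space M" for \<omega>
    using prob_space.prob_le_1[OF prob_space_limit[OF w], of A]
    by (auto intro!: mult_nonneg_nonneg mult_le_one power_le_one)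
  have "{\<omega>\<in>space M. X n \<omega> \<in> A \<and> (\<forall>i<n. X i \<omega> \<notin> A)} = {\<omega>\<in>space M. \<forall>l<Suc n. X l \<omega> \<in> B l}"
    by (auto simp: B_def less_Suc_eq)
  then have "emeasure M {\<omega>\<in>space M. X n \<omega> \<in> A \<and> (\<forall>i<n. X i \<omega> \<notin> A)}
      = ennreal (\<integral>\<omega>. (\<Prod>l<Suc n. measure (\<alpha>' \<omega>) (B l)) \<partial>M)"
    using exchangeable_mixture[OF ex, of "Suc n" B] Bs by (simp add: emeasure_eq_measure)
  also have "(\<integral>\<omega>. (\<Prod>l<Suc n. measure (\<alpha>' \<omega>) (B l)) \<partial>M) = (\<integral>\<omega>. measure (\<alpha>' \<omega>) A * (1 - measure (\<alpha>' \<omega>) A) ^ n \<partial>M)"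
    by (intro Bochner_Integration.integral_cong prod) simp_all
  also have "ennreal \<dots> = (\<integral>\<^sup>+\<omega>. ennreal (measure (\<alpha>' \<omega>) A * (1 - measure (\<alpha>' \<omega>) A) ^ n) \<partial>M)"
  proof (rule nn_integral_eq_integral[symmetric])
    show "integrable M (\<lambda>\<omega>. measure (\<alpha>' \<omega>) A * (1 - measure (\<alpha>' \<omega>) A) ^ n)"
      using m b by (intro integrable_const_bound[where B=1]) auto
    show "AE \<omega> in M. 0 \<le> measure (\<alpha>' \<omega>) A * (1 - measure (\<alpha>' \<omega>) A) ^ n"
      using b by (intro AE_I2) auto
  qed
  finally show ?thesis .
qed

text \<open>Approximating the diagonal by the cells of finer and finer finite partitions; since a cell has
  at least the mass of each of its points, every stage already obeys the limiting bound.\<close>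

lemma emeasure_new_value_le:
  assumes ex: "exchangeable M X"
  shows "emeasure M {\<omega>\<in>space M. \<forall>i<n. X i \<omega> \<noteq> X n \<omega>}
    \<le> (\<integral>\<^sup>+\<omega>. \<integral>\<^sup>+x. ennreal ((1 - measure (\<alpha>' \<omega>) {x}) ^ n) \<partial>\<alpha>' \<omega> \<partial>M)" (is "_ \<le> ?b")
proof -
  obtain U :: "nat \<Rightarrow> 'a set" where U: "\<And>k. open (U k)" "\<And>x y. x \<noteq> y \<Longrightarrow> \<exists>k. (x \<in> U k) \<noteq> (y \<in> U k)"
    using ex_separating_open_sequence[where 'a='a] by (elim exE conjE) blast
  \<comment> \<open>The key records which of the first \<open>r\<close> separating sets contain
    \<open>x\<close>; its level sets are the cells of the finite partition generated by
    them.\<close>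
  define key where "key r x = {k. k < r \<and> x \<in> U k}" for r x
  define cell where "cell r c = {x. key r x = c}" for r c
  have cell_b[measurable]: "cell r c \<in> sets borel" for r c
  proof (cases "c \<subseteq> {..<r}")
    case True
    then have "cell r c = {x\<in>space borel. \<forall>k\<in>{..<r}. (x \<in> U k) = (k \<in> c)}"
      by (auto simp: cell_def key_def)
    also have "\<dots> \<in> sets borel"
    proof (rule sets.sets_Collect_finite_All)
      fix k assume "k \<in> {..<r}"
      show "{x\<in>space borel. (x \<in> U k) = (k \<in> c)} \<in> sets borel"
        using U(1)[of k] by (cases "k \<in> c") (auto simp: Collect_neg_eq)
    qed simp
    finally show ?thesis .
  next
    case False
    then have "cell r c = {}" by (auto simp: cell_def key_def)
    then show ?thesis by simp
  qed
  define A where "A r = {\<omega>\<in>space M. \<forall>i<n. key r (X i \<omega>) \<noteq> key r (X n \<omega>)}" for r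
  define E where "E r c = {\<omega>\<in>space M. X n \<omega> \<in> cell r c \<and> (\<forall>i<n. X i \<omega> \<notin> cell r c)}" for r c
  have Em[measurable]: "E r c \<in> sets M" for r c unfolding E_def by measurable
  have AE: "A r = (\<Union>c\<in>Pow {..<r}. E r c)" for r
    by (auto simp: A_def E_def cell_def key_def)
  have Am: "A r \<in> sets M" for r unfolding AE by (intro sets.finite_UN) auto
  have bound: "emeasure M (A r) \<le> ?b" for r
  proof -
    have m: "(\<lambda>\<omega>. measure (\<alpha>' \<omega>) (cell r c)) \<in> borel_measurable M" for c
      using limit_kernel cell_b by (rule measurable_compose[OF _ measurable_measure_prob_algebra])
    have "emeasure M (A r) \<le> (\<Sum>c\<in>Pow {..<r}. emeasure M (E r c))"
      unfolding AE by (intro emeasure_subadditive_finite) auto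
    also have "\<dots> = (\<Sum>c\<in>Pow {..<r}. \<integral>\<^sup>+\<omega>. ennreal (measure (\<alpha>' \<omega>) (cell r c) * (1 - measure (\<alpha>' \<omega>) (cell r c)) ^ n) \<partial>M)"
      unfolding E_def by (intro sum.cong refl emeasure_new_value_in ex cell_b)
    also have "\<dots> = (\<integral>\<^sup>+\<omega>. (\<Sum>c\<in>Pow {..<r}. ennreal (measure (\<alpha>' \<omega>) (cell r c) * (1 - measure (\<alpha>' \<omega>) (cell r c)) ^ n)) \<partial>M)"
      using m by (intro nn_integral_sum[symmetric]) simp
    also have "\<dots> \<le> ?b"
    proof (rule nn_integral_mono)
      fix \<omega> assume w: "\<omega> \<in> space M"
      interpret p: prob_space "\<alpha>' \<omega>" by (rule prob_space_limit[OF w])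
      have cs: "cell r c \<in> sets (\<alpha>' \<omega>)" "{x} \<in> sets (\<alpha>' \<omega>)" for c x by (simp_all add: sets_limit[OF w])
      have "(\<Sum>c\<in>Pow {..<r}. ennreal (measure (\<alpha>' \<omega>) (cell r c) * (1 - measure (\<alpha>' \<omega>) (cell r c)) ^ n))
          = (\<Sum>c\<in>Pow {..<r}. \<integral>\<^sup>+x. ennreal ((1 - measure (\<alpha>' \<omega>) (cell r c)) ^ n) * indicator (cell r c) x \<partial>\<alpha>' \<omega>)"
      proof (intro sum.cong refl)
        fix c
        have "measure (\<alpha>' \<omega>) (cell r c) \<le> 1" by (rule p.prob_le_1)
        then show "ennreal (measure (\<alpha>' \<omega>) (cell r c) * (1 - measure (\<alpha>' \<omega>) (cell r c)) ^ n)
            = (\<integral>\<^sup>+x. ennreal ((1 - measure (\<alpha>' \<omega>) (cell r c)) ^ n) * indicator (cell r c) x \<partial>\<alpha>' \<omega>)"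
          unfolding nn_integral_cmult_indicator[OF cs(1)] p.emeasure_eq_measure
          by (simp add: ennreal_mult[symmetric] mult.commute)
      qed
      also have "\<dots> = (\<integral>\<^sup>+x. (\<Sum>c\<in>Pow {..<r}. ennreal ((1 - measure (\<alpha>' \<omega>) (cell r c)) ^ n) * indicator (cell r c) x) \<partial>\<alpha>' \<omega>)"
        using cs by (intro nn_integral_sum[symmetric]) simp
      also have "\<dots> \<le> (\<integral>\<^sup>+x. ennreal ((1 - measure (\<alpha>' \<omega>) {x}) ^ n) \<partial>\<alpha>' \<omega>)"
      proof (rule nn_integral_mono)
        fix x
        have "(\<Sum>c\<in>Pow {..<r}. ennreal ((1 - measure (\<alpha>' \<omega>) (cell r c)) ^ n) * indicator (cell r c) x)
            = (\<Sum>c\<in>Pow {..<r}. if c = key r x then ennreal ((1 - measure (\<alpha>' \<omega>) (cell r c)) ^ n) else 0)"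
          by (intro sum.cong) (auto simp: cell_def indicator_def)
        also have "\<dots> = ennreal ((1 - measure (\<alpha>' \<omega>) (cell r (key r x))) ^ n)"
          by (subst sum.delta) (auto simp: key_def)
        also have "\<dots> \<le> ennreal ((1 - measure (\<alpha>' \<omega>) {x}) ^ n)"
        proof (intro ennreal_leI power_mono)
          have "measure (\<alpha>' \<omega>) {x} \<le> measure (\<alpha>' \<omega>) (cell r (key r x))"
            using cs by (intro p.finite_measure_mono) (auto simp: cell_def)
          then show "1 - measure (\<alpha>' \<omega>) (cell r (key r x)) \<le> 1 - measure (\<alpha>' \<omega>) {x}" by simp
        qed simp
        finally show "(\<Sum>c\<in>Pow {..<r}. ennreal ((1 - measure (\<alpha>' \<omega>) (cell r c)) ^ n) * indicator (cell r c) x)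
            \<le> ennreal ((1 - measure (\<alpha>' \<omega>) {x}) ^ n)" .
      qed
      finally show "(\<Sum>c\<in>Pow {..<r}. ennreal (measure (\<alpha>' \<omega>) (cell r c) * (1 - measure (\<alpha>' \<omega>) (cell r c)) ^ n))
          \<le> (\<integral>\<^sup>+x. ennreal ((1 - measure (\<alpha>' \<omega>) {x}) ^ n) \<partial>\<alpha>' \<omega>)" .
    qed
    finally show ?thesis .
  qed
  \<comment> \<open>Keys at stage \<open>r\<close> are restrictions of keys at any later stage, so
    separated points stay separated.\<close>
  have key_mono: "key r x \<noteq> key r y \<Longrightarrow> r \<le> s \<Longrightarrow> key s x \<noteq> key s y" for r s x y
  proof
    assume ne: "key r x \<noteq> key r y" and rs: "r \<le> s" and eq: "key s x = key s y"
    have "key r z = key s z \<inter> {..<r}" for z using rs by (auto simp: key_def)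
    then show False using ne eq by metis
  qed
  have incA: "incseq A"
    unfolding incseq_def
  proof (intro allI impI subsetI)
    fix r s \<omega> assume rs: "r \<le> s" and w: "\<omega> \<in> A r"
    show "\<omega> \<in> A s"
      using w key_mono[OF _ rs] by (simp add: A_def)
  qed
  have UA: "(\<Union>r. A r) = {\<omega>\<in>space M. \<forall>i<n. X i \<omega> \<noteq> X n \<omega>}"
  proof (intro equalityI subsetI)
    fix \<omega> assume "\<omega> \<in> {\<omega>\<in>space M. \<forall>i<n. X i \<omega> \<noteq> X n \<omega>}"
    then have w: "\<omega> \<in> space M" and ne: "\<And>i. i < n \<Longrightarrow> X i \<omega> \<noteq> X n \<omega>" by auto
    have "\<exists>k. i < n \<longrightarrow> (X i \<omega> \<in> U k) \<noteq> (X n \<omega> \<in> U k)" for i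
      using U(2)[OF ne[of i]] by auto
    then obtain k where k: "\<And>i. i < n \<Longrightarrow> (X i \<omega> \<in> U (k i)) \<noteq> (X n \<omega> \<in> U (k i))" by metis
    define r where "r = (\<Sum>i<n. Suc (k i))"
    have "key r (X i \<omega>) \<noteq> key r (X n \<omega>)" if i: "i < n" for i
    proof -
      have "Suc (k i) \<le> r" unfolding r_def by (rule member_le_sum[of i _ "\<lambda>i. Suc (k i)"]) (use i in auto)
      then have "(k i \<in> key r (X i \<omega>)) \<noteq> (k i \<in> key r (X n \<omega>))" using k[OF i] by (auto simp: key_def)
      then show ?thesis by auto
    qed
    then show "\<omega> \<in> (\<Union>r. A r)" using w by (auto simp: A_def)
  qed (auto simp: A_def)
  have "(SUP r. emeasure M (A r)) = emeasure M (\<Union>r. A r)"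
    using Am incA by (intro SUP_emeasure_incseq) auto
  moreover have "(SUP r. emeasure M (A r)) \<le> ?b" by (rule SUP_least) (rule bound)
  ultimately show ?thesis by (simp only: UA)
qed

text \<open>Under \<open>?K\<close> a point is drawn afresh from \<open>\<alpha>' \<omega>\<close>;
  \<open>S\<close> says that it never occurs among the observations and \<open>C\<close> that it is
  not an atom. The bound on new values gives that \<open>S\<close> has at most the mass of
  \<open>C\<close>. Since \<open>C - S\<close> is null, \<open>S - C\<close> must be null as well,
  and a section of \<open>S - C\<close> containing an atom would have positive mass.\<close>

lemma AE_atoms_observed:
  assumes ex: "exchangeable M X"
  shows "AE \<omega> in M. \<forall>x. measure (\<alpha>' \<omega>) {x} \<noteq> 0 \<longrightarrow> (\<exists>i. x = X i \<omega>)"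
proof -
  let ?K = "kernel_prod M borel \<alpha>'"
  let ?S = "M \<Otimes>\<^sub>M (borel :: 'a measure)"
  note sK = sets_kernel_prod[OF limit_kernel not_empty]
  note nnK = nn_integral_kernel_prod[OF limit_kernel not_empty]
  have KT: "emeasure ?K (space ?S) = 1"
  proof -
    have "emeasure ?K (space ?S) = (\<integral>\<^sup>+\<omega>. emeasure (\<alpha>' \<omega>) (Pair \<omega> -` space ?S) \<partial>M)"
      by (rule emeasure_kernel_prod[OF limit_kernel not_empty]) simp
    also have "\<dots> = (\<integral>\<^sup>+\<omega>. 1 \<partial>M)"
    proof (rule nn_integral_cong)
      fix \<omega> assume w: "\<omega> \<in> space M"
      interpret p: prob_space "\<alpha>' \<omega>" by (rule prob_space_limit[OF w])
      have "Pair \<omega> -` space ?S = space (\<alpha>' \<omega>)"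
        using w sets_eq_imp_space_eq[OF sets_limit[OF w]] by (auto simp: space_pair_measure)
      then show "emeasure (\<alpha>' \<omega>) (Pair \<omega> -` space ?S) = 1" by (simp add: p.emeasure_space_1)
    qed
    finally show ?thesis by (simp add: emeasure_space_1)
  qed
  have spK: "space ?K = space ?S" using sets_eq_imp_space_eq[OF sK] .
  interpret K: prob_space ?K by (rule prob_spaceI) (simp add: spK KT)
  define a where "a z = measure (\<alpha>' (fst z)) {snd z}" for z
  have a[measurable]: "a \<in> borel_measurable ?S" unfolding a_def by (rule measurable_atom[OF limit_kernel])
  have a01: "0 \<le> a z \<and> a z \<le> 1" if "z \<in> space ?S" for z
    using that prob_space.prob_le_1[OF prob_space_limit] by (auto simp: a_def space_pair_measure)
  define C where "C = {z\<in>space ?S. a z = 0}"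
  define S where "S = {z\<in>space ?S. \<forall>i. X i (fst z) \<noteq> snd z}"
  have C: "C \<in> sets ?S" and S: "S \<in> sets ?S" unfolding C_def S_def by measurable
  \<comment> \<open>Being different from the first \<open>n\<close> observations is an event of the
    product with \<open>F n\<close>, so the fresh draw from \<open>\<alpha>'\<close> may be
    exchanged for \<open>X n\<close>.\<close>
  have KS: "emeasure ?K S \<le> (\<integral>\<^sup>+z. ennreal ((1 - a z) ^ n) \<partial>?K)" for n
  proof -
    define Sn where "Sn = {z\<in>space (F n \<Otimes>\<^sub>M borel). \<forall>i\<in>{..<n}. X i (fst z) \<noteq> snd z}"
    have SnF: "Sn \<in> sets (F n \<Otimes>\<^sub>M borel)"
      unfolding Sn_def
    proof (rule sets.sets_Collect_finite_All)
      fix i assume "i \<in> {..<n}"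
      then have [measurable]: "X i \<in> F n \<rightarrow>\<^sub>M borel" by (intro measurable_X_F) simp
      show "{z\<in>space (F n \<Otimes>\<^sub>M borel). X i (fst z) \<noteq> snd z} \<in> sets (F n \<Otimes>\<^sub>M borel)" by measurable
    qed simp
    have "sets (F n \<Otimes>\<^sub>M (borel :: 'a measure)) \<subseteq> sets ?S"
      by (rule sets_pair_in_sets) (auto intro: sets_F_in_sets)
    then have SnM: "Sn \<in> sets ?S" using SnF by blast
    have sub: "S \<subseteq> Sn" by (auto simp: S_def Sn_def space_pair_measure space_F)
    have "emeasure ?K S \<le> emeasure ?K Sn"
      using sub SnM sK by (intro emeasure_mono) auto
    also have "\<dots> = (\<integral>\<^sup>+z. indicator Sn z \<partial>?K)" using SnM sK by simp
    also have "\<dots> = (\<integral>\<^sup>+\<omega>. \<integral>\<^sup>+x. indicator Sn (\<omega>, x) \<partial>\<alpha>' \<omega> \<partial>M)"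
      using SnM by (intro nnK) simp
    also have "\<dots> = (\<integral>\<^sup>+\<omega>. indicator Sn (\<omega>, X n \<omega>) \<partial>M)"
      using SnF by (intro nn_integral_limit) simp
    also have "\<dots> = (\<integral>\<^sup>+\<omega>. indicator {\<omega>\<in>space M. \<forall>i<n. X i \<omega> \<noteq> X n \<omega>} \<omega> \<partial>M)"
      by (intro nn_integral_cong) (auto simp: indicator_def Sn_def space_pair_measure space_F)
    also have "\<dots> = emeasure M {\<omega>\<in>space M. \<forall>i<n. X i \<omega> \<noteq> X n \<omega>}"
      by (intro nn_integral_indicator) measurable
    also have "\<dots> \<le> (\<integral>\<^sup>+\<omega>. \<integral>\<^sup>+x. ennreal ((1 - measure (\<alpha>' \<omega>) {x}) ^ n) \<partial>\<alpha>' \<omega> \<partial>M)"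
      by (rule emeasure_new_value_le[OF ex])
    also have "\<dots> = (\<integral>\<^sup>+\<omega>. \<integral>\<^sup>+x. ennreal ((1 - a (\<omega>, x)) ^ n) \<partial>\<alpha>' \<omega> \<partial>M)"
      by (simp add: a_def)
    also have "\<dots> = (\<integral>\<^sup>+z. ennreal ((1 - a z) ^ n) \<partial>?K)"
      by (rule nnK[symmetric]) measurable
    finally show ?thesis .
  qed
  have "(\<lambda>n. \<integral>\<^sup>+z. ennreal ((1 - a z) ^ n) \<partial>?K) \<longlonglongrightarrow> (\<integral>\<^sup>+z. indicator C z \<partial>?K)"
  proof (rule nn_integral_dominated_convergence[where w="\<lambda>_. 1"])
    show "(\<lambda>z. ennreal ((1 - a z) ^ n)) \<in> borel_measurable ?K" for n
      unfolding measurable_cong_sets[OF sK refl] by measurable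
    show "indicator C \<in> borel_measurable ?K"
      using C by (simp add: measurable_cong_sets[OF sK refl])
    show "AE z in ?K. ennreal ((1 - a z) ^ n) \<le> 1" for n
      using a01 by (intro AE_I2) (auto simp: spK ennreal_le_1 intro!: power_le_one)
    show "AE z in ?K. (\<lambda>n. ennreal ((1 - a z) ^ n)) \<longlonglongrightarrow> indicator C z"
    proof (rule AE_I2)
      fix z assume "z \<in> space ?K"
      then have z: "z \<in> space ?S" by (simp add: spK)
      show "(\<lambda>n. ennreal ((1 - a z) ^ n)) \<longlonglongrightarrow> indicator C z"
      proof (cases "a z = 0")
        case False
        then have "(\<lambda>n. (1 - a z) ^ n) \<longlonglongrightarrow> 0" using a01[OF z] by (intro LIMSEQ_realpow_zero) auto
        then have "(\<lambda>n. ennreal ((1 - a z) ^ n)) \<longlonglongrightarrow> ennreal 0" by (rule tendsto_ennrealI)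
        then show ?thesis using False by (simp add: C_def)
      qed (use z in \<open>simp add: C_def\<close>)
    qed
    show "(\<integral>\<^sup>+z. 1 \<partial>?K) < \<infinity>" by (simp add: K.emeasure_space_1)
  qed simp
  then have "emeasure ?K S \<le> (\<integral>\<^sup>+z. indicator C z \<partial>?K)"
    by (rule LIMSEQ_le_const) (use KS in blast)
  then have KSC: "emeasure ?K S \<le> emeasure ?K C" using C sK by simp
  \<comment> \<open>For fixed \<open>\<omega>\<close> the section consists of observed points
    without mass, of which there are only countably many.\<close>
  have "emeasure ?K (C - S) = (\<integral>\<^sup>+\<omega>. emeasure (\<alpha>' \<omega>) (Pair \<omega> -` (C - S)) \<partial>M)"
    using C S by (intro emeasure_kernel_prod[OF limit_kernel not_empty]) auto
  also have "\<dots> = (\<integral>\<^sup>+\<omega>. 0 \<partial>M)"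
  proof (rule nn_integral_cong)
    fix \<omega> assume w: "\<omega> \<in> space M"
    interpret p: prob_space "\<alpha>' \<omega>" by (rule prob_space_limit[OF w])
    let ?T = "{x\<in>range (\<lambda>i. X i \<omega>). measure (\<alpha>' \<omega>) {x} = 0}"
    have "?T \<in> null_sets (\<alpha>' \<omega>)"
    proof -
      have "(\<Union>x\<in>?T. {x}) \<in> null_sets (\<alpha>' \<omega>)"
      proof (rule null_sets_UN')
        show "countable ?T" by (rule countable_subset[of _ "range (\<lambda>i. X i \<omega>)"]) auto
      qed (auto simp: null_sets_def p.emeasure_eq_measure sets_limit[OF w])
      then show ?thesis by simp
    qed
    moreover have "Pair \<omega> -` (C - S) \<in> sets (\<alpha>' \<omega>)"
      using C S by (simp only: sets_limit[OF w]) (intro sets_Pair1[of _ M borel] sets.Diff)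
    moreover have "Pair \<omega> -` (C - S) \<subseteq> ?T"
      using w by (auto simp: C_def S_def a_def space_pair_measure)
    ultimately have "Pair \<omega> -` (C - S) \<in> null_sets (\<alpha>' \<omega>)" by (rule null_sets_subset)
    then show "emeasure (\<alpha>' \<omega>) (Pair \<omega> -` (C - S)) = 0" by auto
  qed
  finally have "emeasure ?K (C - S) = 0" by simp
  then have CS: "measure ?K (C - S) = 0" by (simp add: measure_def)
  have "measure ?K S \<le> measure ?K C" using KSC by (simp add: K.emeasure_eq_measure)
  also have "measure ?K C = measure ?K (C \<inter> S) + measure ?K (C - S)"
    using C S sK by (subst K.finite_measure_Union[symmetric]) (auto intro!: arg_cong[where f="measure ?K"])
  also have "measure ?K S = measure ?K (C \<inter> S) + measure ?K (S - C)"
    using C S sK by (subst K.finite_measure_Union[symmetric]) (auto intro!: arg_cong[where f="measure ?K"])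
  finally have "measure ?K (S - C) = 0" using CS measure_nonneg[of ?K "S - C"] by simp
  then have "(\<integral>\<^sup>+\<omega>. emeasure (\<alpha>' \<omega>) (Pair \<omega> -` (S - C)) \<partial>M) = 0"
    using C S emeasure_kernel_prod[OF limit_kernel not_empty, of "S - C"]
    by (simp add: K.emeasure_eq_measure)
  moreover have "(\<lambda>\<omega>. emeasure (\<alpha>' \<omega>) (Pair \<omega> -` (S - C))) \<in> borel_measurable M"
  proof (rule emeasure_measurable_subprob_algebra2[OF _ measurable_prob_algebraD[OF limit_kernel]])
    have "(SIGMA \<omega>:space M. Pair \<omega> -` (S - C)) = S - C" by (auto simp: S_def space_pair_measure)
    then show "(SIGMA \<omega>:space M. Pair \<omega> -` (S - C)) \<in> sets ?S" using C S by auto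
  qed
  ultimately have "AE \<omega> in M. emeasure (\<alpha>' \<omega>) (Pair \<omega> -` (S - C)) = 0"
    by (simp add: nn_integral_0_iff_AE)
  then show ?thesis
    using AE_space
  proof eventually_elim
    case (elim \<omega>)
    note w = elim(2)
    interpret p: prob_space "\<alpha>' \<omega>" by (rule prob_space_limit[OF w])
    show ?case
    proof (intro allI impI, rule ccontr)
      fix x assume x: "measure (\<alpha>' \<omega>) {x} \<noteq> 0" and no: "\<nexists>i. x = X i \<omega>"
      have "{x} \<subseteq> Pair \<omega> -` (S - C)"
        using w x no by (auto simp: S_def C_def a_def space_pair_measure)
      moreover have "Pair \<omega> -` (S - C) \<in> sets (\<alpha>' \<omega>)"
        using C S by (simp only: sets_limit[OF w]) (intro sets_Pair1[of _ M borel] sets.Diff)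
      ultimately have "emeasure (\<alpha>' \<omega>) {x} \<le> emeasure (\<alpha>' \<omega>) (Pair \<omega> -` (S - C))"
        by (rule emeasure_mono)
      then show False using elim(1) x by (simp add: p.emeasure_eq_measure measure_le_0_iff)
    qed
  qed
qed

section \<open>Almost sure statements and passage to a \<sigma>-finite reference measure\<close>

lemma atoms_convergeI:
  assumes "AE \<omega> in M. \<forall>x. (\<lambda>n. measure (\<alpha> n \<omega>) {x}) \<longlonglongrightarrow> measure (\<alpha>' \<omega>) {x}"
  shows "atoms_converge M \<alpha> \<alpha>'"
proof -
  obtain N where N: "\<And>\<omega>. \<omega> \<in> space M - N \<Longrightarrow> \<forall>x. (\<lambda>n. measure (\<alpha> n \<omega>) {x}) \<longlonglongrightarrow> measure (\<alpha>' \<omega>) {x}"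
    "N \<in> null_sets M"
    using AE_E3[OF assms] by blast
  have "measure M (space M - N) = 1"
    using N(2) by (subst prob_compl) (auto simp: measure_eq_0_null_sets)
  then show ?thesis
    unfolding atoms_converge_def using N by (intro bexI[of _ "space M - N"]) auto
qed

lemma atoms_convergeD:
  assumes "atoms_converge M \<alpha> \<alpha>'"
  shows "AE \<omega> in M. \<forall>x. (\<lambda>n. measure (\<alpha> n \<omega>) {x}) \<longlonglongrightarrow> measure (\<alpha>' \<omega>) {x}"
proof -
  obtain A0 where A0: "A0 \<in> sets M" "measure M A0 = 1"
    "\<forall>x. \<forall>\<omega>\<in>A0. (\<lambda>n. measure (\<alpha> n \<omega>) {x}) \<longlonglongrightarrow> measure (\<alpha>' \<omega>) {x}"
    using assms unfolding atoms_converge_def by blast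
  have "AE \<omega> in M. \<omega> \<in> A0" using A0(1,2) by (simp add: prob_eq_1)
  then show ?thesis by eventually_elim (use A0(3) in blast)
qed

lemma exchangeable_imp_atoms_converge:
  assumes ex: "exchangeable M X"
  shows "atoms_converge M \<alpha> \<alpha>'"
proof (rule atoms_convergeI)
  have "AE \<omega> in M. \<forall>i. (\<lambda>n. measure (\<alpha> n \<omega>) {X i \<omega>}) \<longlonglongrightarrow> measure (\<alpha>' \<omega>) {X i \<omega>}"
    unfolding AE_all_countable using AE_predictive_observed_atom by blast
  then show "AE \<omega> in M. \<forall>x. (\<lambda>n. measure (\<alpha> n \<omega>) {x}) \<longlonglongrightarrow> measure (\<alpha>' \<omega>) {x}"
    using AE_atoms_observed[OF ex] weak_limit AE_space
  proof eventually_elim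
    case (elim \<omega>)
    note w = elim(4)
    show ?case
    proof
      fix x show "(\<lambda>n. measure (\<alpha> n \<omega>) {x}) \<longlonglongrightarrow> measure (\<alpha>' \<omega>) {x}"
      proof (cases "measure (\<alpha>' \<omega>) {x} = 0")
        case True
        then show ?thesis
          using singleton_tendsto_0_if_weakly_converges[OF elim(3) prob_space_limit[OF w] sets_limit[OF w]
              prob_space_predictive[OF w] sets_predictive[OF w]] by simp
      next
        case False
        then obtain i where "x = X i \<omega>" using elim(2) by blast
        then show ?thesis using elim(1) by simp
      qed
    qed
  qed
qed

lemma abs_diff_le_tv_dist:
  assumes w: "\<omega> \<in> space M" and B: "B \<in> sets borel"
  shows "\<bar>measure (\<alpha> n \<omega>) B - measure (\<alpha>' \<omega>) B\<bar> \<le> tv_dist (\<alpha> n \<omega>) (\<alpha>' \<omega>)"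
  unfolding tv_dist_def
proof (rule cSUP_upper[OF B])
  show "bdd_above ((\<lambda>B. \<bar>measure (\<alpha> n \<omega>) B - measure (\<alpha>' \<omega>) B\<bar>) ` sets borel)"
  proof (rule bdd_aboveI2)
    fix B :: "'a set"
    show "\<bar>measure (\<alpha> n \<omega>) B - measure (\<alpha>' \<omega>) B\<bar> \<le> 1"
      using prob_space.prob_le_1[OF prob_space_predictive[OF w], of n B]
        prob_space.prob_le_1[OF prob_space_limit[OF w], of B]
        measure_nonneg[of "\<alpha> n \<omega>" B] measure_nonneg[of "\<alpha>' \<omega>" B] by linarith
  qed
qed

lemma tv_dist_tendsto_imp_atoms_converge:
  assumes "AE \<omega> in M. (\<lambda>n. tv_dist (\<alpha> n \<omega>) (\<alpha>' \<omega>)) \<longlonglongrightarrow> 0"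
  shows "atoms_converge M \<alpha> \<alpha>'"
proof (rule atoms_convergeI)
  show "AE \<omega> in M. \<forall>x. (\<lambda>n. measure (\<alpha> n \<omega>) {x}) \<longlonglongrightarrow> measure (\<alpha>' \<omega>) {x}"
    using assms AE_space
  proof eventually_elim
    case (elim \<omega>)
    show ?case
    proof
      fix x
      have "(\<lambda>n. measure (\<alpha> n \<omega>) {x} - measure (\<alpha>' \<omega>) {x}) \<longlonglongrightarrow> 0"
        by (rule Lim_null_comparison[OF _ elim(1)]) (use abs_diff_le_tv_dist[OF elim(2)] in simp)
      then show "(\<lambda>n. measure (\<alpha> n \<omega>) {x}) \<longlonglongrightarrow> measure (\<alpha>' \<omega>) {x}" by (rule LIM_zero_cancel)
    qed
  qed
qed

text \<open>A strictly positive integrable \<open>h\<close> turns \<open>L\<close> into a finite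
  measure \<open>L'\<close>. Positivity ensures that every \<open>L'\<close>-null set is
  \<open>L\<close>-null, so absolute continuity with respect to \<open>L\<close> carries over to
  \<open>L'\<close>.\<close>

lemma atoms_converge_imp_tv_dist_tendsto:
  assumes L: "sigma_finite_measure L" and sL: "sets L = sets borel"
    and ac: "AE \<omega> in M. absolutely_continuous L (continuous_part (\<alpha>' \<omega>))"
    and at: "atoms_converge M \<alpha> \<alpha>'"
  shows "AE \<omega> in M. (\<lambda>n. tv_dist (\<alpha> n \<omega>) (\<alpha>' \<omega>)) \<longlonglongrightarrow> 0"
proof -
  interpret L: sigma_finite_measure L by fact
  obtain h :: "'a \<Rightarrow> real" where h: "h \<in> borel_measurable L" "\<And>x. h x > 0" "\<And>x. h x \<le> 1" "integrable L h"
    by (rule L.obtain_positive_integrable_function) (rule that; assumption)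
  have [measurable]: "h \<in> borel_measurable L" by fact
  define L' where "L' = density L (\<lambda>x. ennreal (h x))"
  have fin: "finite_measure L'"
    unfolding L'_def by (rule measure_density_real(1)[OF h(4) _ sets.top]) (simp add: h(2) less_imp_le)
  have null: "null_sets L' \<subseteq> null_sets L"
  proof
    fix N assume "N \<in> null_sets L'"
    then have "N \<in> sets L" "AE x in L. x \<in> N \<longrightarrow> ennreal (h x) = 0"
      unfolding L'_def by (simp_all add: null_sets_density_iff)
    then have "N \<in> sets L" "AE x in L. x \<notin> N"
      using h(2) by (simp_all add: ennreal_eq_0_iff not_le[symmetric])
    then show "N \<in> null_sets L" by (simp add: AE_iff_null_sets)
  qed
  have "AE \<omega> in M. absolutely_continuous L' (continuous_part (\<alpha>' \<omega>))"
    using ac by eventually_elim (use null in \<open>auto simp: absolutely_continuous_def\<close>)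
  moreover have "sets L' = sets borel" by (simp add: L'_def sL)
  ultimately have "AE \<omega> in M. \<forall>d>0. eventually (\<lambda>n. tv_dist (\<alpha> n \<omega>) (\<alpha>' \<omega>) \<le> d) sequentially"
    using AE_tv_dist_tendsto_0[OF fin _ _ atoms_convergeD[OF at]] by simp
  then show ?thesis
    using AE_space
  proof eventually_elim
    case (elim \<omega>)
    have nn: "0 \<le> tv_dist (\<alpha> n \<omega>) (\<alpha>' \<omega>)" for n
      using abs_diff_le_tv_dist[OF elim(2), of "{}" n] by simp
    show ?case
    proof (rule tendstoI)
      fix e :: real assume e: "e > 0"
      then have "eventually (\<lambda>n. tv_dist (\<alpha> n \<omega>) (\<alpha>' \<omega>) \<le> e / 2) sequentially"
        using elim(1)[rule_format, of "e / 2"] by (meson half_gt_zero)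
      then show "eventually (\<lambda>n. dist (tv_dist (\<alpha> n \<omega>) (\<alpha>' \<omega>)) 0 < e) sequentially"
        using e nn by (auto simp: dist_real_def elim!: eventually_mono)
    qed
  qed
qed

end

theorem theorem2:
  fixes M :: "'w measure"
    and X :: "nat \<Rightarrow> 'w \<Rightarrow> 'a::polish_space"
    and \<alpha> :: "nat \<Rightarrow> 'w \<Rightarrow> 'a measure"
    and \<alpha>' :: "'w \<Rightarrow> 'a measure"
    and L :: "'a measure"
  assumes "prob_space M"
    and "sets L = sets borel" and "sigma_finite_measure L"
    and "\<And>n. X n \<in> M \<rightarrow>\<^sub>M borel"
    and "cid M X"
    and "predictive_measures M X \<alpha>"
    and "\<alpha>' \<in> M \<rightarrow>\<^sub>M prob_algebra borel"
    and "sets (vimage_algebra (space M) \<alpha>' (prob_algebra borel)) \<subseteq> sets (nat_filt_inf M X)"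
    and "AE \<omega> in M. weakly_converges (\<lambda>n. \<alpha> n \<omega>) (\<alpha>' \<omega>)"
  shows "((AE \<omega> in M. absolutely_continuous L (continuous_part (\<alpha>' \<omega>))) \<longrightarrow>
            ((AE \<omega> in M. (\<lambda>n. tv_dist (\<alpha> n \<omega>) (\<alpha>' \<omega>)) \<longlonglongrightarrow> 0) \<longleftrightarrow>
             atoms_converge M \<alpha> \<alpha>')) \<and>
         (exchangeable M X \<longrightarrow> atoms_converge M \<alpha> \<alpha>') \<and>
         (exchangeable M X \<and> (AE \<omega> in M. absolutely_continuous L (continuous_part (\<alpha>' \<omega>))) \<longrightarrow>
            (AE \<omega> in M. (\<lambda>n. tv_dist (\<alpha> n \<omega>) (\<alpha>' \<omega>)) \<longlonglongrightarrow> 0))"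
proof -
  interpret cid_sequence M X \<alpha> \<alpha>'
    using assms by (simp add: cid_sequence_def cid_sequence_axioms_def)
  note tv = atoms_converge_imp_tv_dist_tendsto[OF assms(3,2)]
  show ?thesis
    using tv tv_dist_tendsto_imp_atoms_converge exchangeable_imp_atoms_converge by blast
qed

end
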